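(* Let $K$ be a field of characteristic zero, $E/K$ a finite Galois extension, and $N_1,N_2$ finite abelian groups. Let $e$ be the least common multiple of the exponents of $N_1$ and $N_2$, $\zeta$ a primitive $e$-th root of unity (in an algebraic closure of $E$), $\tilde E=E(\zeta)$ and $\Gamma=\mathrm{Gal}(\tilde E/K)$. Suppose $(N_1,\ast_1)$ and $(N_2,\ast_2)$ are $\Gamma$-groups, and for $i=1,2$ let $\Gamma$ act on $\tilde E[N_i]$ by acting on $\tilde E$ as Galois automorphisms and on $N_i$ via $\ast_i$. Then $\tilde E[N_1]^\Gamma\cong\tilde E[N_2]^\Gamma$ as $K$-algebras if and only if $\widehat{N_1}\cong\widehat{N_2}$ as $\Gamma$-sets.
   Context: A $\Gamma$-group is a group with a $\Gamma$-action by group automorphisms. $\widehat{N_i}=\mathrm{Hom}(N_i,\tilde E^{\times})$ is the group of characters of $N_i$, on which $\Gamma$ acts by $(\gamma\ast\chi)(\eta)=\gamma\big(\chi(\gamma^{-1}\ast_i\eta)\big)$. Two $\Gamma$-sets are isomorphic as $\Gamma$-sets if there is a $\Gamma$-equivariant bijection between them. *)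

theory Defs
  imports "HOL-Algebra.Algebra"
begin

definition char_zero :: "('a, 'b) ring_scheme \<Rightarrow> bool" where
  "char_zero R \<longleftrightarrow> (\<forall>n::nat. n > 0 \<longrightarrow> [n] \<cdot>\<^bsub>R\<^esub> \<one>\<^bsub>R\<^esub> \<noteq> \<zero>\<^bsub>R\<^esub>)"

definition primitive_root_of_unity :: "('a, 'b) ring_scheme \<Rightarrow> nat \<Rightarrow> 'a \<Rightarrow> bool" where
  "primitive_root_of_unity R n z \<longleftrightarrow>
     n > 0 \<and> z \<in> carrier R \<and> z [^]\<^bsub>R\<^esub> n = \<one>\<^bsub>R\<^esub> \<and>
     (\<forall>m. 0 < m \<and> m < n \<longrightarrow> z [^]\<^bsub>R\<^esub> m \<noteq> \<one>\<^bsub>R\<^esub>)"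

definition group_exponent :: "('n, 'b) monoid_scheme \<Rightarrow> nat" where
  "group_exponent G = (LEAST n. n > 0 \<and> (\<forall>x \<in> carrier G. x [^]\<^bsub>G\<^esub> n = \<one>\<^bsub>G\<^esub>))"

text \<open>
  Fields are subfields of one ambient field \<open>L\<close>. Automorphisms of \<open>F\<close> are extensional
  (arbitrary but fixed outside \<open>F\<close>), so that they are determined by their values on \<open>F\<close>.
\<close>

definition galois_group :: "('a, 'b) ring_scheme \<Rightarrow> 'a set \<Rightarrow> 'a set \<Rightarrow> ('a \<Rightarrow> 'a) monoid" where
  "galois_group L K F =
     (BijGroup F) \<lparr> carrier :=
       {\<sigma> \<in> Bij F. \<sigma> \<in> ring_iso (L \<lparr> carrier := F \<rparr>) (L \<lparr> carrier := F \<rparr>) \<and> (\<forall>k \<in> K. \<sigma> k = k)} \<rparr>"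

definition finite_galois_extension :: "('a, 'b) ring_scheme \<Rightarrow> 'a set \<Rightarrow> 'a set \<Rightarrow> bool" where
  "finite_galois_extension L K F \<longleftrightarrow>
     subfield K L \<and> subfield F L \<and> K \<subseteq> F \<and> ring.finite_dimension L K F \<and>
     {x \<in> F. \<forall>\<sigma> \<in> carrier (galois_group L K F). \<sigma> x = x} = K"

definition acts_by_automorphisms ::
  "('g, 'b) monoid_scheme \<Rightarrow> ('n, 'c) monoid_scheme \<Rightarrow> ('g \<Rightarrow> 'n \<Rightarrow> 'n) \<Rightarrow> bool" where
  "acts_by_automorphisms G N \<phi> \<longleftrightarrow> group_hom G (AutoGroup N) \<phi>"

text \<open>
  The group algebra of a \<^emph>\<open>finite\<close> group \<open>N\<close>: an element \<open>\<Sum> a\<^sub>\<eta> \<eta>\<close> is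
  represented by its coefficient function \<open>\<eta> \<mapsto> a\<^sub>\<eta>\<close> on \<open>carrier N\<close>.
\<close>

definition group_algebra ::
  "('a, 'b) ring_scheme \<Rightarrow> ('n, 'c) monoid_scheme \<Rightarrow> ('a, 'n \<Rightarrow> 'a) module" where
  "group_algebra R N =
     \<lparr> carrier = carrier N \<rightarrow>\<^sub>E carrier R,
       monoid.mult = (\<lambda>f g. \<lambda>\<eta> \<in> carrier N. \<Oplus>\<^bsub>R\<^esub>\<mu> \<in> carrier N. f \<mu> \<otimes>\<^bsub>R\<^esub> g (inv\<^bsub>N\<^esub> \<mu> \<otimes>\<^bsub>N\<^esub> \<eta>)),
       monoid.one = (\<lambda>\<eta> \<in> carrier N. if \<eta> = \<one>\<^bsub>N\<^esub> then \<one>\<^bsub>R\<^esub> else \<zero>\<^bsub>R\<^esub>),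
       ring.zero = (\<lambda>\<eta> \<in> carrier N. \<zero>\<^bsub>R\<^esub>),
       ring.add = (\<lambda>f g. \<lambda>\<eta> \<in> carrier N. f \<eta> \<oplus>\<^bsub>R\<^esub> g \<eta>),
       module.smult = (\<lambda>a f. \<lambda>\<eta> \<in> carrier N. a \<otimes>\<^bsub>R\<^esub> f \<eta>) \<rparr>"

text \<open>
  For \<open>G\<close> a group of field automorphisms acting on \<open>N\<close> via \<open>\<phi>\<close>. On coefficient functions this
  is \<open>\<Sum> a\<^sub>\<eta> \<eta> \<mapsto> \<Sum> \<gamma>(a\<^sub>\<eta>) (\<gamma> * \<eta>)\<close>, whose coefficient at \<open>\<eta>\<close> is \<open>\<gamma>(a\<^sub>\<mu>)\<close> with
  \<open>\<mu> = \<gamma>\<inverse> * \<eta>\<close>; on characters it is the action \<open>(\<gamma> * \<chi>)(\<eta>) = \<gamma>(\<chi>(\<gamma>\<inverse> * \<eta>))\<close>.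
\<close>

definition twisted_action ::
  "('a \<Rightarrow> 'a, 'b) monoid_scheme \<Rightarrow> ('n, 'c) monoid_scheme \<Rightarrow> (('a \<Rightarrow> 'a) \<Rightarrow> 'n \<Rightarrow> 'n) \<Rightarrow>
   ('a \<Rightarrow> 'a) \<Rightarrow> ('n \<Rightarrow> 'a) \<Rightarrow> 'n \<Rightarrow> 'a" where
  "twisted_action G N \<phi> \<gamma> f = (\<lambda>\<eta> \<in> carrier N. \<gamma> (f (\<phi> (inv\<^bsub>G\<^esub> \<gamma>) \<eta>)))"

definition fixed_group_algebra ::
  "('a, 'b) ring_scheme \<Rightarrow> ('a \<Rightarrow> 'a, 'c) monoid_scheme \<Rightarrow> ('n, 'd) monoid_scheme \<Rightarrow>
   (('a \<Rightarrow> 'a) \<Rightarrow> 'n \<Rightarrow> 'n) \<Rightarrow> ('a, 'n \<Rightarrow> 'a) module" where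
  "fixed_group_algebra R G N \<phi> =
     (group_algebra R N) \<lparr> carrier :=
       {f \<in> carrier (group_algebra R N). \<forall>\<gamma> \<in> carrier G. twisted_action G N \<phi> \<gamma> f = f} \<rparr>"

definition isomorphic_algebras ::
  "'a set \<Rightarrow> ('a, 'm, 'b) module_scheme \<Rightarrow> ('a, 'n, 'c) module_scheme \<Rightarrow> bool" where
  "isomorphic_algebras K A B \<longleftrightarrow>
     (\<exists>h \<in> ring_iso A B. \<forall>k \<in> K. \<forall>a \<in> carrier A. h (k \<odot>\<^bsub>A\<^esub> a) = k \<odot>\<^bsub>B\<^esub> h a)"

definition characters ::
  "('n, 'b) monoid_scheme \<Rightarrow> ('a, 'c) ring_scheme \<Rightarrow> ('n \<Rightarrow> 'a) set" where
  "characters N R = hom N (mult_of R) \<inter> extensional (carrier N)"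

definition isomorphic_gsets ::
  "('g, 'b) monoid_scheme \<Rightarrow> 'x set \<Rightarrow> ('g \<Rightarrow> 'x \<Rightarrow> 'x) \<Rightarrow> 'y set \<Rightarrow> ('g \<Rightarrow> 'y \<Rightarrow> 'y) \<Rightarrow> bool" where
  "isomorphic_gsets G S \<alpha> T \<beta> \<longleftrightarrow>
     (\<exists>f. bij_betw f S T \<and> (\<forall>g \<in> carrier G. \<forall>x \<in> S. f (\<alpha> g x) = \<beta> g (f x)))"

end

theory Submission
  imports Defs
begin

text \<open>
  The Fourier transform \<open>a \<mapsto> (\<chi> \<mapsto> \<Sum>\<^sub>\<eta> a\<^sub>\<eta> \<chi>(\<eta>))\<close> is an isomorphism from \<open>E'[N]\<close> to the algebra of functions on the
  character group, because \<open>E'\<close> contains enough roots of unity, and it carries the fixed algebra onto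
  the \<open>\<Gamma>\<close>-equivariant maps \<open>\<chi> \<mapsto> f(\<chi>) \<in> E'\<close>. A finite \<open>\<Gamma>\<close>-set \<open>S\<close> is recovered from the \<open>K\<close>-algebra \<open>Map\<^sub>\<Gamma>(S, E')\<close>
  as its set of \<open>K\<close>-algebra homomorphisms to \<open>E'\<close>, which are exactly the evaluations at points of \<open>S\<close>.
  The latter needs that \<open>K\<close> is the fixed field of \<open>\<Gamma>\<close>: each automorphism \<open>\<sigma>\<close> of \<open>E\<close> over \<open>K\<close> has as many
  extensions to \<open>E' = E(\<zeta>)\<close> as the degree of the minimal polynomial \<open>m\<close> of \<open>\<zeta>\<close>, since \<open>\<sigma>(m)\<close> divides \<open>X\<^sup>e - 1\<close>.
\<close>

section \<open>Independence of characters\<close>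

text \<open>The indicator function of a point of \<open>S\<close> is usually not equivariant, so a
  homomorphism \<psi> from \<open>Map_\<Gamma>(S, E')\<close> to \<open>E'\<close> cannot be tested
  on idempotents of points. Instead, an element \<open>c\<close> of \<open>E'\<close> is placed at
  \<open>s\<close> and the result is summed over \<Gamma>; applying \<psi> gives, for fixed
  \<open>s\<close>, a \<open>K\<close>-linear map of \<open>c\<close> from \<open>E'\<close> to
  \<open>E'\<close>. Every such map has the form \<open>\<Sum> b(\<gamma>) \<gamma>\<close>. As
  \<psi> is multiplicative and the automorphisms are independent over \<open>E'\<close>, any
  \<gamma> with \<open>b(\<gamma>) \<noteq> 0\<close> makes \<psi> the evaluation at
  \<open>\<gamma> s\<close>. The expansion of linear maps is built from traces, so the degree of
  \<open>E'\<close> over \<open>K\<close> is never compared with the order of \<Gamma>. In the same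
  spirit, neither the number of characters nor a decomposition of \<open>N\<close> into cyclic
  groups is used: orthogonality makes the Fourier transform onto, and a nonzero kernel would contain
  a multiple of a character, whose transform does not vanish at the inverse character.
  Characteristic zero is what permits division by \<open>|N|\<close>, by \<open>e\<close> and by
  \<open>|\<Gamma>|\<close>.\<close>

lemma (in abelian_monoid) finsum_swap:
  assumes "finite A" "finite B"
    and "\<And>i j. i \<in> A \<Longrightarrow> j \<in> B \<Longrightarrow> f i j \<in> carrier G"
  shows "(\<Oplus>i\<in>A. \<Oplus>j\<in>B. f i j) = (\<Oplus>j\<in>B. \<Oplus>i\<in>A. f i j)"
  using assms(1,3)
proof (induction A rule: finite_induct)
  case empty
  then show ?case by (simp add: finsum_zero)
next
  case (insert x A)
  have "(\<Oplus>i\<in>insert x A. \<Oplus>j\<in>B. f i j) = (\<Oplus>j\<in>B. f x j) \<oplus> (\<Oplus>i\<in>A. \<Oplus>j\<in>B. f i j)"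
    using insert by (intro finsum_insert) (auto intro!: finsum_closed)
  also have "\<dots> = (\<Oplus>j\<in>B. f x j) \<oplus> (\<Oplus>j\<in>B. \<Oplus>i\<in>A. f i j)"
    using insert by simp
  also have "\<dots> = (\<Oplus>j\<in>B. f x j \<oplus> (\<Oplus>i\<in>A. f i j))"
    using insert by (intro finsum_addf[symmetric]) (auto intro!: finsum_closed)
  also have "\<dots> = (\<Oplus>j\<in>B. \<Oplus>i\<in>insert x A. f i j)"
    using insert by (intro finsum_cong') (auto intro!: finsum_closed)
  finally show ?case .
qed

lemma (in abelian_monoid) finsum_delta:
  assumes "finite A" "a \<in> A" "f a \<in> carrier G"
  shows "(\<Oplus>i\<in>A. if i = a then f i else \<zero>) = f a"
proof -
  have "(\<Oplus>i\<in>A. if i = a then f i else \<zero>) = (\<Oplus>i\<in>insert a (A - {a}). if i = a then f i else \<zero>)"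
    using assms by (simp add: insert_absorb)
  also have "\<dots> = f a \<oplus> (\<Oplus>i\<in>A - {a}. if i = a then f i else \<zero>)"
    using assms by (subst finsum_insert) auto
  also have "(\<Oplus>i\<in>A - {a}. if i = a then f i else \<zero>) = (\<Oplus>i\<in>A - {a}. \<zero>)"
    by (intro finsum_cong') auto
  finally show ?thesis using assms by (simp add: finsum_zero)
qed

lemma (in abelian_group) finsum_minus:
  assumes "f \<in> A \<rightarrow> carrier G" "g \<in> A \<rightarrow> carrier G"
  shows "(\<Oplus>i\<in>A. f i \<ominus> g i) = (\<Oplus>i\<in>A. f i) \<ominus> (\<Oplus>i\<in>A. g i)"
proof -
  have "(\<Oplus>i\<in>A. f i \<ominus> g i) \<oplus> (\<Oplus>i\<in>A. g i) = (\<Oplus>i\<in>A. (f i \<ominus> g i) \<oplus> g i)"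
    using assms by (intro finsum_addf[symmetric]) (auto simp: Pi_def)
  also have "\<dots> = (\<Oplus>i\<in>A. f i)"
  proof (intro finsum_cong' refl assms)
    fix i assume "i \<in> A"
    then have "f i \<in> carrier G" "g i \<in> carrier G" using assms by auto
    then show "(f i \<ominus> g i) \<oplus> g i = f i"
      by (simp add: a_minus_def a_assoc l_neg)
  qed
  finally have eq: "(\<Oplus>i\<in>A. f i \<ominus> g i) \<oplus> (\<Oplus>i\<in>A. g i) = (\<Oplus>i\<in>A. f i)" .
  have c: "(\<Oplus>i\<in>A. f i \<ominus> g i) \<in> carrier G" "(\<Oplus>i\<in>A. g i) \<in> carrier G"
    using assms by (auto intro!: finsum_closed simp: Pi_def)
  show ?thesis unfolding eq[symmetric] using c by (simp add: a_minus_def a_assoc r_neg)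
qed

text \<open>Comparing the relation at \<open>x \<cdot> y\<close> with \<open>\<chi> j y\<close> times the relation at \<open>x\<close> eliminates the index \<open>j\<close>.\<close>

lemma (in field) dedekind_independence:
  fixes \<chi> :: "'i \<Rightarrow> 'm \<Rightarrow> 'a"
  assumes "finite I" and M: "monoid M"
    and \<chi>: "\<And>i. i \<in> I \<Longrightarrow> \<chi> i \<in> hom M R" "\<And>i. i \<in> I \<Longrightarrow> \<chi> i \<one>\<^bsub>M\<^esub> = \<one>"
    and "\<And>i j. \<lbrakk>i \<in> I; j \<in> I; i \<noteq> j\<rbrakk> \<Longrightarrow> \<exists>m\<in>carrier M. \<chi> i m \<noteq> \<chi> j m"
    and "\<And>i. i \<in> I \<Longrightarrow> c i \<in> carrier R"
    and "\<And>m. m \<in> carrier M \<Longrightarrow> (\<Oplus>i\<in>I. c i \<otimes> \<chi> i m) = \<zero>"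
    and "i \<in> I"
  shows "c i = \<zero>"
  using assms(1,3-)
proof (induction I arbitrary: c i rule: finite_induct)
  case empty
  then show ?case by simp
next
  case (insert j I)
  interpret M: monoid M by (rule M)
  have \<chi>c: "\<chi> i m \<in> carrier R" if "i \<in> insert j I" "m \<in> carrier M" for i m
    using insert.prems(1)[OF that(1)] that(2) by (auto simp: hom_def)
  have \<chi>m: "\<chi> i (m \<otimes>\<^bsub>M\<^esub> n) = \<chi> i m \<otimes> \<chi> i n" if "i \<in> insert j I" "m \<in> carrier M" "n \<in> carrier M" for i m n
    using insert.prems(1)[OF that(1)] that by (auto simp: hom_def)
  have cc: "c i \<in> carrier R" if "i \<in> insert j I" for i using insert.prems(4) that by auto
  have rel: "c j \<otimes> \<chi> j m \<oplus> (\<Oplus>i\<in>I. c i \<otimes> \<chi> i m) = \<zero>" if "m \<in> carrier M" for m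
    using insert.prems(5)[OF that] insert.hyps that cc \<chi>c by (subst (asm) finsum_insert) auto
  have zI: "c i = \<zero>" if i: "i \<in> I" for i
  proof -
    have "c i \<otimes> (\<chi> i y \<ominus> \<chi> j y) = \<zero>" if y: "y \<in> carrier M" for y
    proof (rule insert.IH[of "\<lambda>i. c i \<otimes> (\<chi> i y \<ominus> \<chi> j y)" i])
      fix m assume m: "m \<in> carrier M"
      have "(\<Oplus>i\<in>I. c i \<otimes> (\<chi> i y \<ominus> \<chi> j y) \<otimes> \<chi> i m)
          = (\<Oplus>i\<in>I. c i \<otimes> \<chi> i (m \<otimes>\<^bsub>M\<^esub> y) \<ominus> \<chi> j y \<otimes> (c i \<otimes> \<chi> i m))"
      proof (intro finsum_cong' refl)
        fix i assume "i \<in> I"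
        then have "c i \<in> carrier R" "\<chi> i y \<in> carrier R" "\<chi> i m \<in> carrier R" "\<chi> j y \<in> carrier R"
          using cc \<chi>c m y by auto
        then show "c i \<otimes> (\<chi> i y \<ominus> \<chi> j y) \<otimes> \<chi> i m = c i \<otimes> \<chi> i (m \<otimes>\<^bsub>M\<^esub> y) \<ominus> \<chi> j y \<otimes> (c i \<otimes> \<chi> i m)"
          using \<open>i \<in> I\<close> m y by (simp add: \<chi>m) algebra
      qed (use cc \<chi>c m y in auto)
      also have "\<dots> = (\<Oplus>i\<in>I. c i \<otimes> \<chi> i (m \<otimes>\<^bsub>M\<^esub> y)) \<ominus> \<chi> j y \<otimes> (\<Oplus>i\<in>I. c i \<otimes> \<chi> i m)"
        using cc \<chi>c m y insert.hyps by (subst finsum_minus) (auto simp: finsum_rdistr)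
      also have "\<dots> = (c j \<otimes> \<chi> j (m \<otimes>\<^bsub>M\<^esub> y) \<oplus> (\<Oplus>i\<in>I. c i \<otimes> \<chi> i (m \<otimes>\<^bsub>M\<^esub> y)))
                  \<ominus> \<chi> j y \<otimes> (c j \<otimes> \<chi> j m \<oplus> (\<Oplus>i\<in>I. c i \<otimes> \<chi> i m))"
      proof -
        have *: "a \<ominus> z \<otimes> b = (d \<otimes> (x \<otimes> z) \<oplus> a) \<ominus> z \<otimes> (d \<otimes> x \<oplus> b)"
          if "a \<in> carrier R" "b \<in> carrier R" "d \<in> carrier R" "x \<in> carrier R" "z \<in> carrier R" for a b d x z
          using that by algebra
        show ?thesis
          using m y cc \<chi>c by (subst (2) \<chi>m) (auto intro!: * finsum_closed)
      qed
      also have "\<dots> = \<zero>" using rel m y \<chi>c by simp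
      finally show "(\<Oplus>i\<in>I. c i \<otimes> (\<chi> i y \<ominus> \<chi> j y) \<otimes> \<chi> i m) = \<zero>" .
    qed (use insert.prems insert.hyps cc \<chi>c y i in auto)
    moreover obtain y where y: "y \<in> carrier M" "\<chi> i y \<noteq> \<chi> j y"
      using insert.prems(3)[of i j] i insert.hyps by auto
    ultimately show ?thesis
      using integral[of "c i" "\<chi> i y \<ominus> \<chi> j y"] cc i \<chi>c r_right_minus_eq by auto
  qed
  \<comment> \<open>With all other coefficients zero, the relation at the identity leaves only the
    term of \<open>j\<close>; the normalisation of \<open>\<chi> j\<close> there, which excludes the
    zero map, gives \<open>c j = 0\<close>.\<close>
  have "(\<Oplus>i\<in>I. c i \<otimes> \<chi> i \<one>\<^bsub>M\<^esub>) = (\<Oplus>i\<in>I. \<zero>)"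
    using zI \<chi>c by (intro finsum_cong') auto
  then have "c j = \<zero>"
    using rel[of "\<one>\<^bsub>M\<^esub>"] cc insert.prems(2)[of j] by (simp add: finsum_zero)
  then show ?case using zI insert.prems(6) by auto
qed

section \<open>Linear maps over the fixed field\<close>

text \<open>In \<open>twistable_step\<close> the variables \<open>y\<close>, \<open>v\<close>,
  \<open>w\<close> stand for \<open>\<gamma> y\<close>, \<open>v \<gamma>\<close>,
  \<open>\<gamma> c\<close>, so that \<open>y \<otimes> w\<close> becomes
  \<open>\<gamma> (y \<otimes> c)\<close>: the factor is absorbed into the argument of the
  automorphism.\<close>

lemma (in cring) twisted_term_expand:
  assumes "u \<in> carrier R" "y \<in> carrier R" "z \<in> carrier R" "v \<in> carrier R" "w \<in> carrier R"
  shows "u \<otimes> (y \<ominus> z) \<otimes> v \<otimes> w = u \<otimes> (v \<otimes> (y \<otimes> w)) \<ominus> u \<otimes> z \<otimes> (v \<otimes> w)"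
  using assms by algebra

text \<open>Artin's setting: a finite group of automorphisms and its fixed field. Group elements are
  functions on a whole type, so \<open>mult_apply\<close> and \<open>one_apply\<close> tie the group
  structure only to values on the carrier, and \<open>distinct\<close> supplies a point of the
  carrier where two elements differ, as independence of characters requires.\<close>

locale galois_action = field R + G: group G
  for R :: "('a, 'b) ring_scheme" (structure) and G :: "('a \<Rightarrow> 'a, 'c) monoid_scheme" +
  fixes K :: "'a set"
  assumes finite_G: "finite (carrier G)"
    and aut_hom: "\<gamma> \<in> carrier G \<Longrightarrow> \<gamma> \<in> ring_hom R R"
    and mult_apply: "\<lbrakk>\<gamma> \<in> carrier G; \<delta> \<in> carrier G; x \<in> carrier R\<rbrakk> \<Longrightarrow> (\<gamma> \<otimes>\<^bsub>G\<^esub> \<delta>) x = \<gamma> (\<delta> x)"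
    and one_apply: "x \<in> carrier R \<Longrightarrow> \<one>\<^bsub>G\<^esub> x = x"
    and distinct: "\<lbrakk>\<gamma> \<in> carrier G; \<delta> \<in> carrier G; \<gamma> \<noteq> \<delta>\<rbrakk> \<Longrightarrow> \<exists>x\<in>carrier R. \<gamma> x \<noteq> \<delta> x"
    and K_eq: "K = {x \<in> carrier R. \<forall>\<gamma>\<in>carrier G. \<gamma> x = x}"
begin

lemma aut_closed [simp]: "\<gamma> \<in> carrier G \<Longrightarrow> x \<in> carrier R \<Longrightarrow> \<gamma> x \<in> carrier R"
  using aut_hom by (auto dest: ring_hom_closed)

lemma aut_mult: "\<gamma> \<in> carrier G \<Longrightarrow> x \<in> carrier R \<Longrightarrow> y \<in> carrier R \<Longrightarrow> \<gamma> (x \<otimes> y) = \<gamma> x \<otimes> \<gamma> y"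
  using aut_hom by (auto simp: ring_hom_mult)

lemma aut_add: "\<gamma> \<in> carrier G \<Longrightarrow> x \<in> carrier R \<Longrightarrow> y \<in> carrier R \<Longrightarrow> \<gamma> (x \<oplus> y) = \<gamma> x \<oplus> \<gamma> y"
  using aut_hom by (auto simp: ring_hom_add)

lemma aut_one: "\<gamma> \<in> carrier G \<Longrightarrow> \<gamma> \<one> = \<one>"
  using aut_hom by (auto simp: ring_hom_one)

lemma aut_ring_hom_cring: "\<gamma> \<in> carrier G \<Longrightarrow> ring_hom_cring R R \<gamma>"
  by (intro ring_hom_cringI is_cring aut_hom)

lemma aut_zero: "\<gamma> \<in> carrier G \<Longrightarrow> \<gamma> \<zero> = \<zero>"
  by (intro ring_hom_zero aut_hom is_ring)

lemma aut_finsum: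
  assumes "\<gamma> \<in> carrier G" "f \<in> A \<rightarrow> carrier R"
  shows "\<gamma> (\<Oplus>i\<in>A. f i) = (\<Oplus>i\<in>A. \<gamma> (f i))"
  using ring_hom_cring.hom_finsum[OF aut_ring_hom_cring[OF assms(1)] assms(2)] by (simp add: comp_def)

lemma aut_inv_apply:
  assumes "\<gamma> \<in> carrier G" "x \<in> carrier R"
  shows "\<gamma> ((inv\<^bsub>G\<^esub> \<gamma>) x) = x" "(inv\<^bsub>G\<^esub> \<gamma>) (\<gamma> x) = x"
  using assms mult_apply[of \<gamma> "inv\<^bsub>G\<^esub> \<gamma>" x] mult_apply[of "inv\<^bsub>G\<^esub> \<gamma>" \<gamma> x]
  by (simp_all add: one_apply)

lemma K_sub: "k \<in> K \<Longrightarrow> k \<in> carrier R"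
  by (simp add: K_eq)

lemma K_fixed: "k \<in> K \<Longrightarrow> \<gamma> \<in> carrier G \<Longrightarrow> \<gamma> k = k"
  by (simp add: K_eq)

lemma finsum_reindex_mult:
  assumes "\<delta> \<in> carrier G" "f \<in> carrier G \<rightarrow> carrier R"
  shows "(\<Oplus>\<gamma>\<in>carrier G. f (\<delta> \<otimes>\<^bsub>G\<^esub> \<gamma>)) = (\<Oplus>\<gamma>\<in>carrier G. f \<gamma>)"
proof -
  have im: "(\<otimes>\<^bsub>G\<^esub>) \<delta> ` carrier G = carrier G"
    using assms(1) by (rule G.surj_const_mult)
  have "inj_on ((\<otimes>\<^bsub>G\<^esub>) \<delta>) (carrier G)"
    using assms(1) by (rule G.inj_on_cmult)
  then show ?thesis
    using finsum_reindex[of f "(\<otimes>\<^bsub>G\<^esub>) \<delta>" "carrier G"] assms(2) by (simp add: im)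
qed

text \<open>Left multiplication permutes \<open>G\<close>, so the trace is fixed. In this locale it
  is the only place where fixed elements are concluded to lie in \<open>K\<close>; everything that
  depends on \<open>K\<close> being the full fixed field passes through it.\<close>

lemma trace_in_K:
  assumes "c \<in> carrier R"
  shows "(\<Oplus>\<gamma>\<in>carrier G. \<gamma> c) \<in> K"
proof -
  have "\<delta> (\<Oplus>\<gamma>\<in>carrier G. \<gamma> c) = (\<Oplus>\<gamma>\<in>carrier G. \<gamma> c)" if \<delta>: "\<delta> \<in> carrier G" for \<delta>
  proof -
    have "\<delta> (\<Oplus>\<gamma>\<in>carrier G. \<gamma> c) = (\<Oplus>\<gamma>\<in>carrier G. \<delta> (\<gamma> c))"
      using assms \<delta> by (intro aut_finsum) auto
    also have "\<dots> = (\<Oplus>\<gamma>\<in>carrier G. (\<delta> \<otimes>\<^bsub>G\<^esub> \<gamma>) c)"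
      using assms \<delta> by (intro finsum_cong') (auto simp: mult_apply)
    also have "\<dots> = (\<Oplus>\<gamma>\<in>carrier G. \<gamma> c)"
      using assms \<delta> by (intro finsum_reindex_mult) auto
    finally show ?thesis .
  qed
  moreover have "(\<Oplus>\<gamma>\<in>carrier G. \<gamma> c) \<in> carrier R" using assms by (intro finsum_closed) auto
  ultimately show ?thesis by (simp add: K_eq)
qed

text \<open>Automorphisms are viewed as characters of the multiplicative monoid of the whole field,
  zero included, which is why independence was stated for monoids. In this form it compares the
  coefficients of two twisted sums that agree for all \<open>c\<close>.\<close>

lemma aut_independence:
  assumes "b \<in> carrier G \<rightarrow> carrier R"
    and "\<And>c. c \<in> carrier R \<Longrightarrow> (\<Oplus>\<gamma>\<in>carrier G. b \<gamma> \<otimes> \<gamma> c) = \<zero>"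
    and "\<gamma> \<in> carrier G"
  shows "b \<gamma> = \<zero>"
proof (rule dedekind_independence[where M = R and \<chi> = "\<lambda>\<gamma>. \<gamma>" and I = "carrier G" and c = b])
  show "\<gamma> \<in> hom R R" if "\<gamma> \<in> carrier G" for \<gamma>
    using aut_hom[OF that] by (auto simp: hom_def ring_hom_def)
  show "b \<gamma> \<in> carrier R" if "\<gamma> \<in> carrier G" for \<gamma>
    using assms(1) that by auto
qed (fact finite_G monoid_axioms aut_one distinct assms)+

section \<open>Endomorphisms over the fixed field as twisted sums of automorphisms\<close>

definition K_linear :: "('a \<Rightarrow> 'a) \<Rightarrow> bool" where
  "K_linear lam \<longleftrightarrow> lam \<in> carrier R \<rightarrow> carrier R \<and>
     (\<forall>x\<in>carrier R. \<forall>y\<in>carrier R. lam (x \<oplus> y) = lam x \<oplus> lam y) \<and>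
     (\<forall>k\<in>K. \<forall>x\<in>carrier R. lam (k \<otimes> x) = k \<otimes> lam x)"

text \<open>A scalar of \<open>R\<close> cannot be pulled out of \<open>lam\<close>, but it can be
  made part of \<open>lam\<close>. This is the reason why \<open>twistable\<close> quantifies over
  all \<open>K\<close>-linear maps at once.\<close>

lemma K_linear_scale: "K_linear lam \<Longrightarrow> u \<in> carrier R \<Longrightarrow> K_linear (\<lambda>x. lam (u \<otimes> x))"
  unfolding K_linear_def by (simp add: r_distr m_lcomm[of u] K_sub Pi_def)

lemma K_linear_minus:
  assumes lam: "K_linear lam" and x: "x \<in> carrier R" and y: "y \<in> carrier R"
  shows "lam (x \<ominus> y) = lam x \<ominus> lam y"
proof -
  have c: "lam x \<in> carrier R" "lam y \<in> carrier R" "lam (x \<ominus> y) \<in> carrier R"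
    using lam x y by (auto simp: K_linear_def Pi_def)
  have "lam (x \<ominus> y) \<oplus> lam y = lam ((x \<ominus> y) \<oplus> y)"
    using lam x y by (simp add: K_linear_def)
  also have "(x \<ominus> y) \<oplus> y = x" using x y by (simp add: a_minus_def a_assoc l_neg)
  finally have "lam x = lam (x \<ominus> y) \<oplus> lam y" ..
  then show ?thesis using c by (simp add: a_minus_def a_assoc r_neg)
qed

text \<open>The functions \<open>v\<close> on \<open>G\<close> with this property contain \<open>1\<close> and are closed under the operation of
  \<open>twistable_step\<close>, so they contain the indicator function of the identity, built as a product over
  the other elements \<open>\<delta>\<close> of the factors \<open>\<gamma> \<mapsto> (\<gamma> y - \<delta> y) / (y - \<delta> y)\<close> with \<open>\<delta> y \<noteq> y\<close>.\<close>

definition twistable :: "(('a \<Rightarrow> 'a) \<Rightarrow> 'a) \<Rightarrow> bool" where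
  "twistable v \<longleftrightarrow> v \<in> carrier G \<rightarrow> carrier R \<and>
     (\<forall>lam. K_linear lam \<longrightarrow> (\<exists>b\<in>carrier G \<rightarrow> carrier R. \<forall>c\<in>carrier R.
        lam (\<Oplus>\<gamma>\<in>carrier G. v \<gamma> \<otimes> \<gamma> c) = (\<Oplus>\<gamma>\<in>carrier G. b \<gamma> \<otimes> \<gamma> c)))"

text \<open>The sum is now the trace of \<open>c\<close>, a scalar of \<open>K\<close>, so
  \<open>lam\<close> sends it to the trace times \<open>lam \<one>\<close>. The coefficients are
  therefore constantly \<open>lam \<one>\<close>.\<close>

lemma twistable_one: "twistable (\<lambda>_. \<one>)"
  unfolding twistable_def
proof (intro conjI allI impI)
  fix lam assume lam: "K_linear lam"
  then have l1: "lam \<one> \<in> carrier R" by (auto simp: K_linear_def)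
  show "\<exists>b\<in>carrier G \<rightarrow> carrier R. \<forall>c\<in>carrier R.
        lam (\<Oplus>\<gamma>\<in>carrier G. \<one> \<otimes> \<gamma> c) = (\<Oplus>\<gamma>\<in>carrier G. b \<gamma> \<otimes> \<gamma> c)"
  proof (intro bexI[of _ "\<lambda>_. lam \<one>"] ballI)
    fix c assume c: "c \<in> carrier R"
    define t where "t = (\<Oplus>\<gamma>\<in>carrier G. \<gamma> c)"
    have t: "t \<in> K" unfolding t_def using c by (rule trace_in_K)
    have "(\<Oplus>\<gamma>\<in>carrier G. \<one> \<otimes> \<gamma> c) = t"
      unfolding t_def using c by (intro finsum_cong') auto
    then have "lam (\<Oplus>\<gamma>\<in>carrier G. \<one> \<otimes> \<gamma> c) = lam (t \<otimes> \<one>)" using t by (simp add: K_sub)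
    also have "\<dots> = t \<otimes> lam \<one>" using lam t by (auto simp: K_linear_def)
    also have "\<dots> = lam \<one> \<otimes> t" using l1 t K_sub m_comm by auto
    also have "\<dots> = (\<Oplus>\<gamma>\<in>carrier G. lam \<one> \<otimes> \<gamma> c)"
      unfolding t_def using c l1 finite_G by (intro finsum_rdistr) auto
    finally show "lam (\<Oplus>\<gamma>\<in>carrier G. \<one> \<otimes> \<gamma> c) = (\<Oplus>\<gamma>\<in>carrier G. lam \<one> \<otimes> \<gamma> c)" .
  qed (use l1 in auto)
qed auto

text \<open>Writing \<open>T c\<close> for the twisted sum of \<open>c\<close> with coefficients
  \<open>v\<close>, the new sum is \<open>u T(y c) - u z T(c)\<close>. Each term is handled by a
  rescaled \<open>lam\<close>, and passing from \<open>c\<close> to \<open>y c\<close> multiplies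
  the coefficient at \<gamma> by \<open>\<gamma> y\<close>.\<close>

lemma twistable_step:
  assumes v: "twistable v" and u: "u \<in> carrier R" and y: "y \<in> carrier R" and z: "z \<in> carrier R"
  shows "twistable (\<lambda>\<gamma>. u \<otimes> (\<gamma> y \<ominus> z) \<otimes> v \<gamma>)"
  unfolding twistable_def
proof (intro conjI allI impI)
  have vc: "v \<gamma> \<in> carrier R" if "\<gamma> \<in> carrier G" for \<gamma> using v that by (auto simp: twistable_def)
  show "(\<lambda>\<gamma>. u \<otimes> (\<gamma> y \<ominus> z) \<otimes> v \<gamma>) \<in> carrier G \<rightarrow> carrier R"
    using vc u y z by auto
  fix lam assume lam: "K_linear lam"
  obtain b where b: "b \<in> carrier G \<rightarrow> carrier R"
    "\<And>c. c \<in> carrier R \<Longrightarrow> lam (u \<otimes> (\<Oplus>\<gamma>\<in>carrier G. v \<gamma> \<otimes> \<gamma> c)) = (\<Oplus>\<gamma>\<in>carrier G. b \<gamma> \<otimes> \<gamma> c)"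
    using v K_linear_scale[OF lam u] unfolding twistable_def by blast
  obtain b' where b': "b' \<in> carrier G \<rightarrow> carrier R"
    "\<And>c. c \<in> carrier R \<Longrightarrow> lam (u \<otimes> z \<otimes> (\<Oplus>\<gamma>\<in>carrier G. v \<gamma> \<otimes> \<gamma> c)) = (\<Oplus>\<gamma>\<in>carrier G. b' \<gamma> \<otimes> \<gamma> c)"
    using v K_linear_scale[OF lam, of "u \<otimes> z"] u z unfolding twistable_def by blast
  have bc: "b \<gamma> \<in> carrier R" "b' \<gamma> \<in> carrier R" if "\<gamma> \<in> carrier G" for \<gamma>
    using b(1) b'(1) that by auto
  show "\<exists>b\<in>carrier G \<rightarrow> carrier R. \<forall>c\<in>carrier R.
      lam (\<Oplus>\<gamma>\<in>carrier G. u \<otimes> (\<gamma> y \<ominus> z) \<otimes> v \<gamma> \<otimes> \<gamma> c) = (\<Oplus>\<gamma>\<in>carrier G. b \<gamma> \<otimes> \<gamma> c)"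
  proof (intro bexI[of _ "\<lambda>\<gamma>. b \<gamma> \<otimes> \<gamma> y \<ominus> b' \<gamma>"] ballI)
    fix c assume c: "c \<in> carrier R"
    have "(\<Oplus>\<gamma>\<in>carrier G. u \<otimes> (\<gamma> y \<ominus> z) \<otimes> v \<gamma> \<otimes> \<gamma> c)
        = (\<Oplus>\<gamma>\<in>carrier G. u \<otimes> (v \<gamma> \<otimes> \<gamma> (y \<otimes> c)) \<ominus> u \<otimes> z \<otimes> (v \<gamma> \<otimes> \<gamma> c))"
      using vc u y z c by (intro finsum_cong') (auto simp: aut_mult twisted_term_expand)
    also have "\<dots> = u \<otimes> (\<Oplus>\<gamma>\<in>carrier G. v \<gamma> \<otimes> \<gamma> (y \<otimes> c)) \<ominus> u \<otimes> z \<otimes> (\<Oplus>\<gamma>\<in>carrier G. v \<gamma> \<otimes> \<gamma> c)"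
      using vc u y z c finite_G by (subst finsum_minus) (auto simp: finsum_rdistr)
    finally have "lam (\<Oplus>\<gamma>\<in>carrier G. u \<otimes> (\<gamma> y \<ominus> z) \<otimes> v \<gamma> \<otimes> \<gamma> c) =
        lam (u \<otimes> (\<Oplus>\<gamma>\<in>carrier G. v \<gamma> \<otimes> \<gamma> (y \<otimes> c))) \<ominus> lam (u \<otimes> z \<otimes> (\<Oplus>\<gamma>\<in>carrier G. v \<gamma> \<otimes> \<gamma> c))"
      using vc u y z c by (simp add: K_linear_minus[OF lam] finsum_closed Pi_def)
    also have "\<dots> = (\<Oplus>\<gamma>\<in>carrier G. b \<gamma> \<otimes> \<gamma> (y \<otimes> c)) \<ominus> (\<Oplus>\<gamma>\<in>carrier G. b' \<gamma> \<otimes> \<gamma> c)"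
      using b b' y c by simp
    also have "\<dots> = (\<Oplus>\<gamma>\<in>carrier G. b \<gamma> \<otimes> \<gamma> (y \<otimes> c) \<ominus> b' \<gamma> \<otimes> \<gamma> c)"
      using bc y c by (intro finsum_minus[symmetric]) auto
    also have "\<dots> = (\<Oplus>\<gamma>\<in>carrier G. (b \<gamma> \<otimes> \<gamma> y \<ominus> b' \<gamma>) \<otimes> \<gamma> c)"
      using bc y c by (intro finsum_cong') (auto simp: aut_mult m_assoc a_minus_def l_distr l_minus)
    finally show "lam (\<Oplus>\<gamma>\<in>carrier G. u \<otimes> (\<gamma> y \<ominus> z) \<otimes> v \<gamma> \<otimes> \<gamma> c) =
        (\<Oplus>\<gamma>\<in>carrier G. (b \<gamma> \<otimes> \<gamma> y \<ominus> b' \<gamma>) \<otimes> \<gamma> c)" .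
  qed (use bc y in auto)
qed

lemma twistable_indicator:
  assumes "finite F" "F \<subseteq> carrier G - {\<one>\<^bsub>G\<^esub>}"
  shows "\<exists>v. twistable v \<and> v \<one>\<^bsub>G\<^esub> = \<one> \<and> (\<forall>\<gamma>\<in>F. v \<gamma> = \<zero>)"
  using assms
proof (induction F rule: finite_induct)
  case empty
  then show ?case using twistable_one by auto
next
  case (insert \<delta> F)
  then obtain v where v: "twistable v" "v \<one>\<^bsub>G\<^esub> = \<one>" "\<And>\<gamma>. \<gamma> \<in> F \<Longrightarrow> v \<gamma> = \<zero>" by auto
  have \<delta>: "\<delta> \<in> carrier G" "\<delta> \<noteq> \<one>\<^bsub>G\<^esub>" using insert.prems by auto
  then obtain y where y: "y \<in> carrier R" "y \<noteq> \<delta> y"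
    using distinct[of \<delta> "\<one>\<^bsub>G\<^esub>"] one_apply by fastforce
  define u where "u = inv (y \<ominus> \<delta> y)"
  have "y \<ominus> \<delta> y \<noteq> \<zero>" using y \<delta> by simp
  then have U: "y \<ominus> \<delta> y \<in> Units R" using y \<delta> by (simp add: field_Units)
  then have u: "u \<in> carrier R" "u \<otimes> (y \<ominus> \<delta> y) = \<one>" unfolding u_def by auto
  have vc: "v \<gamma> \<in> carrier R" if "\<gamma> \<in> carrier G" for \<gamma> using v(1) that by (auto simp: twistable_def)
  show ?case
  proof (intro exI conjI ballI)
    show "twistable (\<lambda>\<gamma>. u \<otimes> (\<gamma> y \<ominus> \<delta> y) \<otimes> v \<gamma>)"
      using twistable_step[OF v(1) u(1) y(1)] \<delta> y by auto
    show "u \<otimes> (\<one>\<^bsub>G\<^esub> y \<ominus> \<delta> y) \<otimes> v \<one>\<^bsub>G\<^esub> = \<one>"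
      using u v(2) y by (simp add: one_apply)
    show "u \<otimes> (\<gamma> y \<ominus> \<delta> y) \<otimes> v \<gamma> = \<zero>" if "\<gamma> \<in> insert \<delta> F" for \<gamma>
    proof (cases "\<gamma> = \<delta>")
      case True
      then show ?thesis using u y \<delta> vc by (simp add: a_minus_def r_neg)
    next
      case False
      then show ?thesis using that v(3) insert.prems u y \<delta> by auto
    qed
  qed
qed

text \<open>For the indicator of the identity the twisted sum of \<open>c\<close> is
  \<open>c\<close> itself, so its twistability is the claim. Together with
  \<open>aut_independence\<close> this identifies the \<open>K\<close>-linear endomorphisms of
  \<open>R\<close> with the twisted group ring of \<open>G\<close> over \<open>R\<close>.\<close>

lemma K_linear_is_twisted_sum:
  assumes lam: "K_linear lam"
  obtains b where "b \<in> carrier G \<rightarrow> carrier R"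
    "\<And>c. c \<in> carrier R \<Longrightarrow> lam c = (\<Oplus>\<gamma>\<in>carrier G. b \<gamma> \<otimes> \<gamma> c)"
proof -
  obtain v where v: "twistable v" "v \<one>\<^bsub>G\<^esub> = \<one>" "\<And>\<gamma>. \<gamma> \<in> carrier G - {\<one>\<^bsub>G\<^esub>} \<Longrightarrow> v \<gamma> = \<zero>"
    using twistable_indicator[of "carrier G - {\<one>\<^bsub>G\<^esub>}"] finite_G by auto
  obtain b where b: "b \<in> carrier G \<rightarrow> carrier R"
    "\<And>c. c \<in> carrier R \<Longrightarrow> lam (\<Oplus>\<gamma>\<in>carrier G. v \<gamma> \<otimes> \<gamma> c) = (\<Oplus>\<gamma>\<in>carrier G. b \<gamma> \<otimes> \<gamma> c)"
    using v(1) lam unfolding twistable_def by blast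
  have "(\<Oplus>\<gamma>\<in>carrier G. v \<gamma> \<otimes> \<gamma> c) = c" if c: "c \<in> carrier R" for c
  proof -
    have "(\<Oplus>\<gamma>\<in>carrier G. v \<gamma> \<otimes> \<gamma> c) = (\<Oplus>\<gamma>\<in>carrier G. if \<gamma> = \<one>\<^bsub>G\<^esub> then \<gamma> c else \<zero>)"
      using v(2,3) c by (intro finsum_cong') (auto simp: one_apply)
    also have "\<dots> = c"
      using finsum_delta[OF finite_G G.one_closed, of "\<lambda>\<gamma>. \<gamma> c"] c by (simp add: one_apply)
    finally show ?thesis .
  qed
  with b show thesis by (intro that[of b]) simp_all
qed

end

section \<open>Algebras of equivariant maps\<close>

text \<open>The scalar operation accepts every element of \<open>R\<close>, but equivariance
  survives only for scalars fixed by \<open>G\<close>; this is an algebra over \<open>K\<close>, not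
  over \<open>R\<close>. Functions are extensional, so that agreement on \<open>S\<close> is
  equality.\<close>

definition equivariant_maps ::
  "('a, 'b) ring_scheme \<Rightarrow> ('a \<Rightarrow> 'a, 'c) monoid_scheme \<Rightarrow> 's set \<Rightarrow> (('a \<Rightarrow> 'a) \<Rightarrow> 's \<Rightarrow> 's) \<Rightarrow>
   ('a, 's \<Rightarrow> 'a) module" where
  "equivariant_maps R G S \<alpha> =
     \<lparr> carrier = {f \<in> S \<rightarrow>\<^sub>E carrier R. \<forall>\<gamma>\<in>carrier G. \<forall>s\<in>S. f (\<alpha> \<gamma> s) = \<gamma> (f s)},
       monoid.mult = (\<lambda>f g. \<lambda>s\<in>S. f s \<otimes>\<^bsub>R\<^esub> g s),
       monoid.one = (\<lambda>s\<in>S. \<one>\<^bsub>R\<^esub>),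
       ring.zero = (\<lambda>s\<in>S. \<zero>\<^bsub>R\<^esub>),
       ring.add = (\<lambda>f g. \<lambda>s\<in>S. f s \<oplus>\<^bsub>R\<^esub> g s),
       module.smult = (\<lambda>a f. \<lambda>s\<in>S. a \<otimes>\<^bsub>R\<^esub> f s) \<rparr>"

locale galois_set = galois_action +
  fixes S :: "'s set" and \<alpha> :: "('a \<Rightarrow> 'a) \<Rightarrow> 's \<Rightarrow> 's"
  assumes finite_S: "finite S"
    and act_closed [simp]: "\<lbrakk>\<gamma> \<in> carrier G; s \<in> S\<rbrakk> \<Longrightarrow> \<alpha> \<gamma> s \<in> S"
    and act_one: "s \<in> S \<Longrightarrow> \<alpha> \<one>\<^bsub>G\<^esub> s = s"
    and act_mult: "\<lbrakk>\<gamma> \<in> carrier G; \<delta> \<in> carrier G; s \<in> S\<rbrakk> \<Longrightarrow> \<alpha> (\<gamma> \<otimes>\<^bsub>G\<^esub> \<delta>) s = \<alpha> \<gamma> (\<alpha> \<delta> s)"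
begin

abbreviation "M \<equiv> equivariant_maps R G S \<alpha>"

lemma act_inv:
  assumes "\<gamma> \<in> carrier G" "s \<in> S"
  shows "\<alpha> \<gamma> (\<alpha> (inv\<^bsub>G\<^esub> \<gamma>) s) = s" "\<alpha> (inv\<^bsub>G\<^esub> \<gamma>) (\<alpha> \<gamma> s) = s"
  using assms act_mult[of \<gamma> "inv\<^bsub>G\<^esub> \<gamma>" s] act_mult[of "inv\<^bsub>G\<^esub> \<gamma>" \<gamma> s]
  by (simp_all add: act_one)

lemma act_inv_eq_iff:
  assumes "\<gamma> \<in> carrier G" "s \<in> S" "t \<in> S"
  shows "\<alpha> (inv\<^bsub>G\<^esub> \<gamma>) t = s \<longleftrightarrow> \<alpha> \<gamma> s = t"
  using act_inv assms by metis

lemma maps_carrier_iff: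
  "f \<in> carrier M \<longleftrightarrow> f \<in> S \<rightarrow>\<^sub>E carrier R \<and> (\<forall>\<gamma>\<in>carrier G. \<forall>s\<in>S. f (\<alpha> \<gamma> s) = \<gamma> (f s))"
  by (simp add: equivariant_maps_def)

lemma maps_closed: "f \<in> carrier M \<Longrightarrow> s \<in> S \<Longrightarrow> f s \<in> carrier R"
  by (auto simp: maps_carrier_iff)

lemma maps_equivariant: "f \<in> carrier M \<Longrightarrow> \<gamma> \<in> carrier G \<Longrightarrow> s \<in> S \<Longrightarrow> f (\<alpha> \<gamma> s) = \<gamma> (f s)"
  by (simp add: maps_carrier_iff)

lemma maps_apply:
  "s \<in> S \<Longrightarrow> (f \<otimes>\<^bsub>M\<^esub> g) s = f s \<otimes> g s"
  "s \<in> S \<Longrightarrow> (f \<oplus>\<^bsub>M\<^esub> g) s = f s \<oplus> g s"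
  "s \<in> S \<Longrightarrow> \<one>\<^bsub>M\<^esub> s = \<one>"
  "s \<in> S \<Longrightarrow> (k \<odot>\<^bsub>M\<^esub> f) s = k \<otimes> f s"
  by (simp_all add: equivariant_maps_def)

lemma maps_ops_closed:
  "f \<in> carrier M \<Longrightarrow> g \<in> carrier M \<Longrightarrow> f \<otimes>\<^bsub>M\<^esub> g \<in> carrier M"
  "f \<in> carrier M \<Longrightarrow> g \<in> carrier M \<Longrightarrow> f \<oplus>\<^bsub>M\<^esub> g \<in> carrier M"
  "\<one>\<^bsub>M\<^esub> \<in> carrier M"
  "k \<in> K \<Longrightarrow> f \<in> carrier M \<Longrightarrow> k \<odot>\<^bsub>M\<^esub> f \<in> carrier M"
  by (auto simp: equivariant_maps_def PiE_iff aut_mult aut_add aut_one K_fixed K_sub)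

lemma maps_eqI:
  assumes "f \<in> extensional S" "g \<in> extensional S" "\<And>s. s \<in> S \<Longrightarrow> f s = g s"
  shows "f = g"
  using assms by (rule extensionalityI)

lemma maps_extensional: "f \<in> carrier M \<Longrightarrow> f \<in> extensional S"
  by (auto simp: maps_carrier_iff PiE_iff)

lemma maps_ops_extensional:
  "f \<otimes>\<^bsub>M\<^esub> g \<in> extensional S" "f \<oplus>\<^bsub>M\<^esub> g \<in> extensional S" "k \<odot>\<^bsub>M\<^esub> f \<in> extensional S"
  "\<one>\<^bsub>M\<^esub> \<in> extensional S"
  by (simp_all add: equivariant_maps_def)

text \<open>The group acts on all functions \<open>S \<rightarrow> R\<close> by
  \<open>(\<gamma> d)(t) = \<gamma> (d (\<gamma>^-1 t))\<close>, and the equivariant maps are the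
  fixed points. This is the sum over the group for that action.\<close>

definition trace :: "('s \<Rightarrow> 'a) \<Rightarrow> 's \<Rightarrow> 'a" where
  "trace d = (\<lambda>t\<in>S. \<Oplus>\<gamma>\<in>carrier G. \<gamma> (d (\<alpha> (inv\<^bsub>G\<^esub> \<gamma>) t)))"

lemma trace_apply: "t \<in> S \<Longrightarrow> trace d t = (\<Oplus>\<gamma>\<in>carrier G. \<gamma> (d (\<alpha> (inv\<^bsub>G\<^esub> \<gamma>) t)))"
  by (simp add: trace_def)

lemma trace_extensional: "trace d \<in> extensional S"
  by (simp add: trace_def)

lemma trace_in_maps:
  assumes d: "d \<in> S \<rightarrow> carrier R"
  shows "trace d \<in> carrier M"
proof -
  have dc: "d s \<in> carrier R" if "s \<in> S" for s using d that by auto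
  have "trace d (\<alpha> \<delta> t) = \<delta> (trace d t)" if \<delta>: "\<delta> \<in> carrier G" and t: "t \<in> S" for \<delta> t
  proof -
    have "\<delta> (trace d t) = (\<Oplus>\<gamma>\<in>carrier G. \<delta> (\<gamma> (d (\<alpha> (inv\<^bsub>G\<^esub> \<gamma>) t))))"
      using \<delta> t dc by (simp add: trace_def) (subst aut_finsum, auto)
    also have "\<dots> = (\<Oplus>\<gamma>\<in>carrier G. (\<delta> \<otimes>\<^bsub>G\<^esub> \<gamma>) (d (\<alpha> (inv\<^bsub>G\<^esub> (\<delta> \<otimes>\<^bsub>G\<^esub> \<gamma>)) (\<alpha> \<delta> t))))"
      using \<delta> t dc
      by (intro finsum_cong') (auto simp: mult_apply G.inv_mult_group act_mult act_inv)
    also have "\<dots> = (\<Oplus>\<gamma>\<in>carrier G. \<gamma> (d (\<alpha> (inv\<^bsub>G\<^esub> \<gamma>) (\<alpha> \<delta> t))))"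
      using \<delta> t dc
      by (intro finsum_reindex_mult[where f = "\<lambda>\<gamma>. \<gamma> (d (\<alpha> (inv\<^bsub>G\<^esub> \<gamma>) (\<alpha> \<delta> t)))"]) auto
    also have "\<dots> = trace d (\<alpha> \<delta> t)" using \<delta> t by (simp add: trace_def)
    finally show ?thesis by simp
  qed
  moreover have "trace d \<in> S \<rightarrow>\<^sub>E carrier R"
    using dc by (auto simp: trace_def intro!: finsum_closed)
  ultimately show ?thesis by (simp add: maps_carrier_iff)
qed

lemma trace_add:
  assumes "d \<in> S \<rightarrow> carrier R" "d' \<in> S \<rightarrow> carrier R"
  shows "trace (\<lambda>s. d s \<oplus> d' s) = trace d \<oplus>\<^bsub>M\<^esub> trace d'"
proof (rule maps_eqI[OF trace_extensional maps_ops_extensional(2)])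
  fix t assume t: "t \<in> S"
  have dc: "d s \<in> carrier R" "d' s \<in> carrier R" if "s \<in> S" for s using assms that by auto
  have "trace (\<lambda>s. d s \<oplus> d' s) t =
      (\<Oplus>\<gamma>\<in>carrier G. \<gamma> (d (\<alpha> (inv\<^bsub>G\<^esub> \<gamma>) t)) \<oplus> \<gamma> (d' (\<alpha> (inv\<^bsub>G\<^esub> \<gamma>) t)))"
    unfolding trace_apply[OF t] using t dc by (intro finsum_cong') (auto simp: aut_add)
  also have "\<dots> = trace d t \<oplus> trace d' t"
    unfolding trace_apply[OF t] using t dc by (intro finsum_addf) auto
  finally show "trace (\<lambda>s. d s \<oplus> d' s) t = (trace d \<oplus>\<^bsub>M\<^esub> trace d') t"
    using t by (simp add: maps_apply)
qed

text \<open>An equivariant \<open>a\<close> satisfies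
  \<open>\<gamma> (a (\<gamma>^-1 t)) = a t\<close>, so it leaves every summand as the same
  factor.\<close>

lemma trace_mult:
  assumes a: "a \<in> carrier M" and "d \<in> S \<rightarrow> carrier R"
  shows "trace (\<lambda>s. a s \<otimes> d s) = a \<otimes>\<^bsub>M\<^esub> trace d"
proof (rule maps_eqI[OF trace_extensional maps_ops_extensional(1)])
  fix t assume t: "t \<in> S"
  have dc: "d s \<in> carrier R" if "s \<in> S" for s using assms that by auto
  have "trace (\<lambda>s. a s \<otimes> d s) t = (\<Oplus>\<gamma>\<in>carrier G. a t \<otimes> \<gamma> (d (\<alpha> (inv\<^bsub>G\<^esub> \<gamma>) t)))"
  proof -
    have "\<gamma> (a (\<alpha> (inv\<^bsub>G\<^esub> \<gamma>) t)) = a t" if "\<gamma> \<in> carrier G" for \<gamma>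
      using maps_equivariant[OF a that, of "\<alpha> (inv\<^bsub>G\<^esub> \<gamma>) t"] that t by (simp add: act_inv)
    then show ?thesis
      unfolding trace_apply[OF t] using t dc maps_closed[OF a]
      by (intro finsum_cong') (auto simp: aut_mult)
  qed
  also have "\<dots> = a t \<otimes> trace d t"
    unfolding trace_apply[OF t] using t dc maps_closed[OF a] finite_G
    by (intro finsum_rdistr[symmetric]) auto
  finally show "trace (\<lambda>s. a s \<otimes> d s) t = (a \<otimes>\<^bsub>M\<^esub> trace d) t"
    using t by (simp add: maps_apply)
qed

text \<open>The equivariant substitute for the function with value \<open>c\<close> at
  \<open>s\<close> and zero elsewhere: its value at \<open>t\<close> is the sum of
  \<open>\<gamma> c\<close> over the \<gamma> that move \<open>s\<close> to \<open>t\<close>, so it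
  lives on the orbit of \<open>s\<close>.\<close>

definition bump :: "'s \<Rightarrow> 'a \<Rightarrow> 's \<Rightarrow> 'a" where
  "bump s c = trace (\<lambda>t. if t = s then c else \<zero>)"

lemma bump_in_maps: "c \<in> carrier R \<Longrightarrow> bump s c \<in> carrier M"
  unfolding bump_def by (intro trace_in_maps) auto

lemma bump_add:
  assumes "c \<in> carrier R" "c' \<in> carrier R"
  shows "bump s (c \<oplus> c') = bump s c \<oplus>\<^bsub>M\<^esub> bump s c'"
proof -
  have "(\<lambda>t. if t = s then c \<oplus> c' else \<zero>) = (\<lambda>t. (if t = s then c else \<zero>) \<oplus> (if t = s then c' else \<zero>))"
    by auto
  then show ?thesis unfolding bump_def using assms
    by (simp only:) (intro trace_add, auto)
qed

text \<open>Only the value of \<open>a\<close> at \<open>s\<close> matters, because the function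
  under the trace is supported there. Through this relation the multiplicativity of an algebra
  homomorphism becomes a condition on a linear map of \<open>c\<close>.\<close>

lemma bump_mult:
  assumes "a \<in> carrier M" "c \<in> carrier R" "s \<in> S"
  shows "bump s (a s \<otimes> c) = a \<otimes>\<^bsub>M\<^esub> bump s c"
proof -
  have "trace (\<lambda>t. if t = s then a s \<otimes> c else \<zero>) = trace (\<lambda>t. a t \<otimes> (if t = s then c else \<zero>))"
  proof (unfold trace_def, intro restrict_ext finsum_cong' refl)
    fix t \<gamma> assume "t \<in> S" "\<gamma> \<in> carrier G"
    then show "\<gamma> (if \<alpha> (inv\<^bsub>G\<^esub> \<gamma>) t = s then a s \<otimes> c else \<zero>) =
        \<gamma> (a (\<alpha> (inv\<^bsub>G\<^esub> \<gamma>) t) \<otimes> (if \<alpha> (inv\<^bsub>G\<^esub> \<gamma>) t = s then c else \<zero>))"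
      using maps_closed[OF assms(1)] by auto
  qed (use maps_closed[OF assms(1)] assms in auto)
  then show ?thesis unfolding bump_def using assms
    by (simp only:) (intro trace_mult, auto)
qed

lemma bump_smult:
  assumes k: "k \<in> K" and c: "c \<in> carrier R" and s: "s \<in> S"
  shows "bump s (k \<otimes> c) = k \<odot>\<^bsub>M\<^esub> bump s c"
proof -
  \<comment> \<open>A scalar of \<open>K\<close> acts as multiplication by an equivariant constant
    map, which reduces the claim to \<open>bump_mult\<close>.\<close>
  have km: "k \<odot>\<^bsub>M\<^esub> \<one>\<^bsub>M\<^esub> \<in> carrier M" using k maps_ops_closed by auto
  have "bump s (k \<otimes> c) = (k \<odot>\<^bsub>M\<^esub> \<one>\<^bsub>M\<^esub>) \<otimes>\<^bsub>M\<^esub> bump s c"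
    using bump_mult[OF km c s] k s by (simp add: maps_apply K_sub)
  also have "\<dots> = k \<odot>\<^bsub>M\<^esub> bump s c"
    using maps_closed[OF bump_in_maps[OF c]] k
    by (intro maps_eqI maps_ops_extensional) (simp_all add: maps_apply K_sub)
  finally show ?thesis .
qed

text \<open>The condition on \<gamma> is turned into a coefficient one or zero, the form to which
  \<open>aut_independence\<close> applies.\<close>

lemma bump_apply:
  assumes "s \<in> S" "t \<in> S" "c \<in> carrier R"
  shows "bump s c t = (\<Oplus>\<gamma>\<in>carrier G. (if \<alpha> \<gamma> s = t then \<one> else \<zero>) \<otimes> \<gamma> c)"
  unfolding bump_def trace_apply[OF assms(2)] using assms
  by (intro finsum_cong') (auto simp: act_inv_eq_iff aut_zero)

text \<open>If \<open>bump s c\<close> agreed at \<open>s\<close> and \<open>t\<close> for all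
  \<open>c\<close>, the differences of the coefficients for \<open>\<gamma> s = s\<close> and for
  \<open>\<gamma> s = t\<close> would form a relation among the automorphisms. Its coefficient at
  the identity is one, against independence.\<close>

lemma maps_separate_points:
  assumes s: "s \<in> S" and t: "t \<in> S" and "s \<noteq> t"
  obtains a where "a \<in> carrier M" "a s \<noteq> a t"
proof -
  have "\<exists>c\<in>carrier R. bump s c s \<noteq> bump s c t"
  proof (rule ccontr)
    assume "\<not> ?thesis"
    then have eq: "bump s c s = bump s c t" if "c \<in> carrier R" for c using that by auto
    define b where "b \<gamma> = (if \<alpha> \<gamma> s = s then \<one> else \<zero>) \<ominus> (if \<alpha> \<gamma> s = t then \<one> else \<zero>)" for \<gamma>
    have "b \<one>\<^bsub>G\<^esub> = \<zero>"
    proof (rule aut_independence[of b])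
      fix c assume c: "c \<in> carrier R"
      have "(\<Oplus>\<gamma>\<in>carrier G. b \<gamma> \<otimes> \<gamma> c) = (\<Oplus>\<gamma>\<in>carrier G. (if \<alpha> \<gamma> s = s then \<one> else \<zero>) \<otimes> \<gamma> c
          \<ominus> (if \<alpha> \<gamma> s = t then \<one> else \<zero>) \<otimes> \<gamma> c)"
        unfolding b_def using c by (intro finsum_cong') (auto simp: a_minus_def l_distr l_minus)
      also have "\<dots> = bump s c s \<ominus> bump s c t"
        using s t c by (subst finsum_minus) (auto simp: bump_apply)
      also have "\<dots> = \<zero>"
        using eq[OF c] maps_closed[OF bump_in_maps[OF c] t] by (simp add: a_minus_def r_neg)
      finally show "(\<Oplus>\<gamma>\<in>carrier G. b \<gamma> \<otimes> \<gamma> c) = \<zero>" .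
    qed (auto simp: b_def)
    moreover have "b \<one>\<^bsub>G\<^esub> = \<one>" using s \<open>s \<noteq> t\<close> by (simp add: b_def act_one a_minus_def)
    ultimately show False by simp
  qed
  then show thesis using that bump_in_maps by blast
qed

lemma algebra_hom_is_evaluation:
  assumes char0: "char_zero R"
    and \<psi>: "\<psi> \<in> ring_hom M R" and \<psi>s: "\<And>k f. k \<in> K \<Longrightarrow> f \<in> carrier M \<Longrightarrow> \<psi> (k \<odot>\<^bsub>M\<^esub> f) = k \<otimes> \<psi> f"
  obtains t where "t \<in> S" "\<And>a. a \<in> carrier M \<Longrightarrow> \<psi> a = a t"
proof -
  have \<psi>c: "\<psi> f \<in> carrier R" if "f \<in> carrier M" for f using \<psi> that by (rule ring_hom_closed)
  \<comment> \<open>If \<psi> killed every bump it would kill the trace of the constant one, which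
    is the sum of the \<open>bump s \<one>\<close>. That trace is \<open>|G|\<close> times the unit,
    so \<psi> sends it to \<open>|G|\<close>, nonzero in characteristic zero. The argument also
    shows that \<open>S\<close> is not empty.\<close>
  have "\<exists>s\<in>S. \<exists>c\<in>carrier R. \<psi> (bump s c) \<noteq> \<zero>"
  proof (rule ccontr)
    assume "\<not> ?thesis"
    then have z: "\<psi> (bump s c) = \<zero>" if "s \<in> S" "c \<in> carrier R" for s c using that by auto
    have "\<psi> (trace (\<lambda>t. if t \<in> A then \<one> else \<zero>)) = \<zero>" if "finite A" "A \<subseteq> S" for A
      using that
    proof (induction A rule: finite_induct)
      case empty
      have c: "trace (\<lambda>_. \<zero>) \<in> carrier M" by (intro trace_in_maps) auto
      have "trace (\<lambda>t. \<zero>) = trace (\<lambda>t. \<zero> \<oplus> \<zero>)" by simp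
      also have "\<dots> = trace (\<lambda>t. \<zero>) \<oplus>\<^bsub>M\<^esub> trace (\<lambda>t. \<zero>)" by (intro trace_add) auto
      finally have "\<psi> (trace (\<lambda>t. \<zero>)) = \<psi> (trace (\<lambda>t. \<zero>)) \<oplus> \<psi> (trace (\<lambda>t. \<zero>))"
        using ring_hom_add[OF \<psi> c c] by simp
      then show ?case using \<psi>c[OF c] by simp
    next
      case (insert s A)
      have c: "trace (\<lambda>t. if t \<in> A then \<one> else \<zero>) \<in> carrier M" by (intro trace_in_maps) auto
      have "(\<lambda>t. if t \<in> insert s A then \<one> else \<zero>) =
          (\<lambda>t. (if t = s then \<one> else \<zero>) \<oplus> (if t \<in> A then \<one> else \<zero>))"
        using insert.hyps by auto
      then have "trace (\<lambda>t. if t \<in> insert s A then \<one> else \<zero>) =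
          bump s \<one> \<oplus>\<^bsub>M\<^esub> trace (\<lambda>t. if t \<in> A then \<one> else \<zero>)"
        unfolding bump_def by (simp only:) (intro trace_add, auto)
      then show ?case
        using ring_hom_add[OF \<psi> bump_in_maps[OF one_closed] c] insert z by simp
    qed
    from this[OF finite_S subset_refl]
    have "\<psi> (trace (\<lambda>t. if t \<in> S then \<one> else \<zero>)) = \<zero>" .
    moreover have "trace (\<lambda>t. if t \<in> S then \<one> else \<zero>) = ([card (carrier G)] \<cdot> \<one>) \<odot>\<^bsub>M\<^esub> \<one>\<^bsub>M\<^esub>"
    proof (intro maps_eqI trace_extensional maps_ops_extensional)
      fix t assume t: "t \<in> S"
      have "trace (\<lambda>t. if t \<in> S then \<one> else \<zero>) t = (\<Oplus>\<gamma>\<in>carrier G. \<one>)"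
        unfolding trace_apply[OF t] using t by (intro finsum_cong') (auto simp: aut_one)
      also have "\<dots> = [card (carrier G)] \<cdot> \<one>" by (rule add.finprod_const) simp
      finally show "trace (\<lambda>t. if t \<in> S then \<one> else \<zero>) t = (([card (carrier G)] \<cdot> \<one>) \<odot>\<^bsub>M\<^esub> \<one>\<^bsub>M\<^esub>) t"
        using t by (simp add: maps_apply)
    qed
    \<comment> \<open>The integer \<open>|G|\<close> is the trace of one; it has to be recognised as
      a scalar of \<open>K\<close> before \<psi> can be moved past it.\<close>
    moreover have K1: "[card (carrier G)] \<cdot> \<one> \<in> K"
      using trace_in_K[OF one_closed] add.finprod_const[of \<one> "carrier G"]
        finsum_cong'[of "carrier G" "carrier G" "\<lambda>_. \<one>" "\<lambda>\<gamma>. \<gamma> \<one>"] aut_one by auto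
    ultimately have "[card (carrier G)] \<cdot> \<one> = \<zero>"
      using \<psi>s[OF K1 maps_ops_closed(3)] ring_hom_one[OF \<psi>] by (simp add: K_sub)
    moreover have "card (carrier G) > 0" using finite_G G.one_closed card_gt_0_iff by blast
    ultimately show False using char0 by (simp add: char_zero_def)
  qed
  then obtain s c0 where s: "s \<in> S" and c0: "c0 \<in> carrier R" "\<psi> (bump s c0) \<noteq> \<zero>" by blast
  define lam where "lam c = \<psi> (bump s c)" for c
  have lamc: "lam c \<in> carrier R" if "c \<in> carrier R" for c
    unfolding lam_def using that by (intro \<psi>c bump_in_maps)
  have "K_linear lam"
    unfolding K_linear_def using s lamc
    by (auto simp: lam_def bump_add bump_smult \<psi>s bump_in_maps ring_hom_add[OF \<psi>])
  then obtain b where b: "b \<in> carrier G \<rightarrow> carrier R"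
    "\<And>c. c \<in> carrier R \<Longrightarrow> lam c = (\<Oplus>\<gamma>\<in>carrier G. b \<gamma> \<otimes> \<gamma> c)"
    using K_linear_is_twisted_sum by blast
  have bc: "b \<gamma> \<in> carrier R" if "\<gamma> \<in> carrier G" for \<gamma> using b(1) that by auto
  have "\<exists>\<gamma>\<in>carrier G. b \<gamma> \<noteq> \<zero>"
  proof (rule ccontr)
    assume "\<not> ?thesis"
    then have "lam c0 = (\<Oplus>\<gamma>\<in>carrier G. \<zero>)"
      unfolding b(2)[OF c0(1)] using c0(1) by (intro finsum_cong') auto
    then show False using c0(2) by (simp add: lam_def)
  qed
  then obtain \<gamma> where \<gamma>: "\<gamma> \<in> carrier G" "b \<gamma> \<noteq> \<zero>" by blast
  have "\<psi> a = a (\<alpha> \<gamma> s)" if a: "a \<in> carrier M" for a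
  proof -
    have as: "a s \<in> carrier R" "\<psi> a \<in> carrier R" using maps_closed[OF a s] \<psi>c[OF a] .
    \<comment> \<open>By \<open>bump_mult\<close>,
      \<open>lam (a s \<otimes> c) = \<psi> a \<otimes> lam c\<close>. Expanding both sides in the
      automorphisms gives a relation valid for all \<open>c\<close>, with these expressions as
      coefficients.\<close>
    have "b \<gamma> \<otimes> (\<gamma> (a s) \<ominus> \<psi> a) = \<zero>"
    proof (rule aut_independence[of "\<lambda>\<gamma>. b \<gamma> \<otimes> (\<gamma> (a s) \<ominus> \<psi> a)" \<gamma>])
      fix c assume c: "c \<in> carrier R"
      have "(\<Oplus>\<gamma>\<in>carrier G. b \<gamma> \<otimes> (\<gamma> (a s) \<ominus> \<psi> a) \<otimes> \<gamma> c) =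
          (\<Oplus>\<gamma>\<in>carrier G. b \<gamma> \<otimes> \<gamma> (a s \<otimes> c) \<ominus> \<psi> a \<otimes> (b \<gamma> \<otimes> \<gamma> c))"
        using bc as c
        by (intro finsum_cong')
           (auto simp: aut_mult a_minus_def l_distr r_distr l_minus r_minus m_assoc m_lcomm)
      also have "\<dots> = (\<Oplus>\<gamma>\<in>carrier G. b \<gamma> \<otimes> \<gamma> (a s \<otimes> c)) \<ominus> \<psi> a \<otimes> (\<Oplus>\<gamma>\<in>carrier G. b \<gamma> \<otimes> \<gamma> c)"
        using bc as c finite_G by (subst finsum_minus) (auto simp: finsum_rdistr)
      also have "\<dots> = lam (a s \<otimes> c) \<ominus> \<psi> a \<otimes> lam c"
        using as c by (simp add: b(2))
      also have "\<dots> = \<zero>"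
        using as c s lamc
        by (simp add: lam_def bump_mult[OF a] ring_hom_mult[OF \<psi> a] bump_in_maps a_minus_def r_neg)
      finally show "(\<Oplus>\<gamma>\<in>carrier G. b \<gamma> \<otimes> (\<gamma> (a s) \<ominus> \<psi> a) \<otimes> \<gamma> c) = \<zero>" .
    qed (use bc as \<gamma> in auto)
    then have "\<gamma> (a s) = \<psi> a"
      using integral[of "b \<gamma>" "\<gamma> (a s) \<ominus> \<psi> a"] \<gamma> bc as by auto
    then show ?thesis using maps_equivariant[OF a \<gamma>(1) s] by simp
  qed
  then show thesis using that[of "\<alpha> \<gamma> s"] \<gamma> s by auto
qed

end

text \<open>The two structures are bare records. The inverse map respects an operation only because
  the result of that operation in \<open>A\<close> stays in the carrier of \<open>A\<close>, where
  the inverse undoes \<open>h\<close>; hence the closure conditions on \<open>A\<close>.\<close>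

lemma isomorphic_algebras_sym:
  assumes "isomorphic_algebras K A B"
    and closed: "\<And>x y. \<lbrakk>x \<in> carrier A; y \<in> carrier A\<rbrakk> \<Longrightarrow> x \<otimes>\<^bsub>A\<^esub> y \<in> carrier A"
      "\<And>x y. \<lbrakk>x \<in> carrier A; y \<in> carrier A\<rbrakk> \<Longrightarrow> x \<oplus>\<^bsub>A\<^esub> y \<in> carrier A"
      "\<one>\<^bsub>A\<^esub> \<in> carrier A" "\<And>k x. \<lbrakk>k \<in> K; x \<in> carrier A\<rbrakk> \<Longrightarrow> k \<odot>\<^bsub>A\<^esub> x \<in> carrier A"
  shows "isomorphic_algebras K B A"
proof -
  obtain h where hom: "h \<in> ring_hom A B" and bij: "bij_betw h (carrier A) (carrier B)"
    and sm: "\<And>k a. k \<in> K \<Longrightarrow> a \<in> carrier A \<Longrightarrow> h (k \<odot>\<^bsub>A\<^esub> a) = k \<odot>\<^bsub>B\<^esub> h a"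
    using assms(1) by (auto simp: isomorphic_algebras_def ring_iso_def)
  define g where "g = inv_into (carrier A) h"
  have gb: "bij_betw g (carrier B) (carrier A)" unfolding g_def by (rule bij_betw_inv_into[OF bij])
  have gc: "g y \<in> carrier A" if "y \<in> carrier B" for y using gb that by (auto simp: bij_betw_def)
  have hg: "h (g y) = y" if "y \<in> carrier B" for y
    unfolding g_def using bij that by (simp add: bij_betw_inv_into_right)
  have gh: "g (h x) = x" if "x \<in> carrier A" for x
    unfolding g_def using bij that by (simp add: bij_betw_inv_into_left)
  have "g \<in> ring_hom B A"
  proof (rule ring_hom_memI)
    fix x y assume x: "x \<in> carrier B" and y: "y \<in> carrier B"
    show "g (x \<otimes>\<^bsub>B\<^esub> y) = g x \<otimes>\<^bsub>A\<^esub> g y"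
      using gh[OF closed(1)[OF gc[OF x] gc[OF y]]] ring_hom_mult[OF hom gc[OF x] gc[OF y]] x y
      by (simp add: hg)
    show "g (x \<oplus>\<^bsub>B\<^esub> y) = g x \<oplus>\<^bsub>A\<^esub> g y"
      using gh[OF closed(2)[OF gc[OF x] gc[OF y]]] ring_hom_add[OF hom gc[OF x] gc[OF y]] x y
      by (simp add: hg)
  qed (use gc gh[OF closed(3)] ring_hom_one[OF hom] in simp_all)
  moreover have "g (k \<odot>\<^bsub>B\<^esub> y) = k \<odot>\<^bsub>A\<^esub> g y" if "k \<in> K" "y \<in> carrier B" for k y
    using gh[OF closed(4)[OF that(1) gc[OF that(2)]]] sm[OF that(1) gc[OF that(2)]] that
    by (simp add: hg)
  ultimately show ?thesis using gb by (auto simp: isomorphic_algebras_def ring_iso_def)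
qed

lemma isomorphic_algebras_trans:
  assumes "isomorphic_algebras K A B" "isomorphic_algebras K B C"
  shows "isomorphic_algebras K A C"
proof -
  obtain g where g: "g \<in> ring_iso A B" "\<And>k a. k \<in> K \<Longrightarrow> a \<in> carrier A \<Longrightarrow> g (k \<odot>\<^bsub>A\<^esub> a) = k \<odot>\<^bsub>B\<^esub> g a"
    using assms(1) by (auto simp: isomorphic_algebras_def)
  obtain h where h: "h \<in> ring_iso B C" "\<And>k a. k \<in> K \<Longrightarrow> a \<in> carrier B \<Longrightarrow> h (k \<odot>\<^bsub>B\<^esub> a) = k \<odot>\<^bsub>C\<^esub> h a"
    using assms(2) by (auto simp: isomorphic_algebras_def)
  have "g a \<in> carrier B" if "a \<in> carrier A" for a
    using g(1) that by (auto simp: ring_iso_def dest: ring_hom_closed)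
  then have "\<forall>k\<in>K. \<forall>a\<in>carrier A. (h \<circ> g) (k \<odot>\<^bsub>A\<^esub> a) = k \<odot>\<^bsub>C\<^esub> (h \<circ> g) a"
    by (simp add: g(2) h(2))
  then show ?thesis
    unfolding isomorphic_algebras_def using ring_iso_set_trans[OF g(1) h(1)] by blast
qed

text \<open>Following \<open>h\<close> by evaluation at \<open>t\<close> is an algebra homomorphism
  on the maps of \<open>S\<close>, hence evaluation at a point \<open>g t\<close> of
  \<open>S\<close>. Injectivity holds since \<open>h\<close> is onto and the maps on
  \<open>T\<close> separate points; equivariance holds since the maps on \<open>S\<close> separate
  points. Surjectivity of \<open>g\<close> is left to a count.\<close>

lemma isomorphic_maps_imp_equivariant_injection:
  assumes "galois_set R G K S \<alpha>" "galois_set R G K T \<beta>" "char_zero R"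
    and "isomorphic_algebras K (equivariant_maps R G S \<alpha>) (equivariant_maps R G T \<beta>)"
  obtains g where "inj_on g T" "g \<in> T \<rightarrow> S"
    "\<And>\<gamma> t. \<gamma> \<in> carrier G \<Longrightarrow> t \<in> T \<Longrightarrow> g (\<beta> \<gamma> t) = \<alpha> \<gamma> (g t)"
proof -
  interpret S: galois_set R G K S \<alpha> by fact
  interpret T: galois_set R G K T \<beta> by fact
  obtain h where hom: "h \<in> ring_hom S.M T.M" and bij: "bij_betw h (carrier S.M) (carrier T.M)"
    and sm: "\<And>k a. k \<in> K \<Longrightarrow> a \<in> carrier S.M \<Longrightarrow> h (k \<odot>\<^bsub>S.M\<^esub> a) = k \<odot>\<^bsub>T.M\<^esub> h a"
    using assms(4) by (auto simp: isomorphic_algebras_def ring_iso_def)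
  have "\<exists>s\<in>S. \<forall>a\<in>carrier S.M. h a t = a s" if t: "t \<in> T" for t
  proof -
    have hom_t: "(\<lambda>a. h a t) \<in> ring_hom S.M R"
      using t ring_hom_closed[OF hom]
      by (intro ring_hom_memI)
         (simp_all add: T.maps_closed ring_hom_mult[OF hom] ring_hom_add[OF hom] ring_hom_one[OF hom]
           T.maps_apply)
    have sm_t: "h (k \<odot>\<^bsub>S.M\<^esub> a) t = k \<otimes>\<^bsub>R\<^esub> h a t" if "k \<in> K" "a \<in> carrier S.M" for k a
      using sm[OF that] t by (simp add: T.maps_apply)
    obtain s where "s \<in> S" "\<And>a. a \<in> carrier S.M \<Longrightarrow> h a t = a s"
      using S.algebra_hom_is_evaluation[OF assms(3) hom_t sm_t] by blast
    then show ?thesis by blast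
  qed
  then obtain g where g: "\<And>t. t \<in> T \<Longrightarrow> g t \<in> S"
    "\<And>t a. t \<in> T \<Longrightarrow> a \<in> carrier S.M \<Longrightarrow> h a t = a (g t)" by metis
  show thesis
  proof
    show "g \<in> T \<rightarrow> S" using g(1) by auto
    show "inj_on g T"
    proof (rule inj_onI, rule ccontr)
      fix t t' assume t: "t \<in> T" "t' \<in> T" "g t = g t'" "t \<noteq> t'"
      then obtain b where b: "b \<in> carrier T.M" "b t \<noteq> b t'" using T.maps_separate_points by blast
      then obtain a where "a \<in> carrier S.M" "b = h a" using bij by (auto simp: bij_betw_def)
      then show False using b t g(2) by auto
    qed
    fix \<gamma> t assume \<gamma>: "\<gamma> \<in> carrier G" and t: "t \<in> T"
    show "g (\<beta> \<gamma> t) = \<alpha> \<gamma> (g t)"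
    proof (rule ccontr)
      assume "\<not> ?thesis"
      then obtain a where a: "a \<in> carrier S.M" "a (g (\<beta> \<gamma> t)) \<noteq> a (\<alpha> \<gamma> (g t))"
        using S.maps_separate_points[of "g (\<beta> \<gamma> t)" "\<alpha> \<gamma> (g t)"] g(1) \<gamma> t by auto
      have "a (g (\<beta> \<gamma> t)) = h a (\<beta> \<gamma> t)" using g(2) a \<gamma> t by simp
      also have "\<dots> = \<gamma> (h a t)" using T.maps_equivariant[OF ring_hom_closed[OF hom a(1)] \<gamma> t] .
      also have "\<dots> = a (\<alpha> \<gamma> (g t))" using S.maps_equivariant[OF a(1) \<gamma>] g t a by simp
      finally show False using a by simp
    qed
  qed
qed

theorem isomorphic_maps_iff_isomorphic_gsets:
  fixes R :: "('a, 'b) ring_scheme" and T :: "'t set"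
  assumes S: "galois_set R G K S \<alpha>" and T: "galois_set R G K T \<beta>" and char0: "char_zero R"
  shows "isomorphic_algebras K (equivariant_maps R G S \<alpha>) (equivariant_maps R G T \<beta>)
    \<longleftrightarrow> isomorphic_gsets G S \<alpha> T \<beta>"
proof
  interpret S: galois_set R G K S \<alpha> by fact
  interpret T: galois_set R G K T \<beta> by fact
  {
    assume iso: "isomorphic_algebras K S.M T.M"
    have iso': "isomorphic_algebras K T.M S.M"
      using isomorphic_algebras_sym[OF iso] S.maps_ops_closed by blast
    obtain g where g: "inj_on g T" "g \<in> T \<rightarrow> S"
      by (rule isomorphic_maps_imp_equivariant_injection[OF S T char0 iso])
    obtain f where f: "inj_on f S" "f \<in> S \<rightarrow> T"
      "\<And>\<gamma> s. \<gamma> \<in> carrier G \<Longrightarrow> s \<in> S \<Longrightarrow> f (\<alpha> \<gamma> s) = \<beta> \<gamma> (f s)"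
      by (rule isomorphic_maps_imp_equivariant_injection[OF T S char0 iso']) auto
    \<comment> \<open>The injection \<open>g\<close> serves only to compare the sizes of two finite
      sets; the wanted bijection is \<open>f\<close>, obtained from the inverse isomorphism.\<close>
    have "card T \<le> card S" using card_inj_on_le[OF g(1)] g(2) S.finite_S by auto
    moreover have "card (f ` S) = card S" using f(1) by (rule card_image)
    moreover have "f ` S \<subseteq> T" using f(2) by auto
    ultimately have "f ` S = T" using T.finite_S by (intro card_seteq) auto
    then have "bij_betw f S T" using f(1) by (simp add: bij_betw_def)
    then show "isomorphic_gsets G S \<alpha> T \<beta>" using f(3) by (auto simp: isomorphic_gsets_def)
  next
    assume "isomorphic_gsets G S \<alpha> T \<beta>"
    then obtain f where f: "bij_betw f S T"
      "\<And>\<gamma> s. \<gamma> \<in> carrier G \<Longrightarrow> s \<in> S \<Longrightarrow> f (\<alpha> \<gamma> s) = \<beta> \<gamma> (f s)"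
      by (auto simp: isomorphic_gsets_def)
    have fc: "f s \<in> T" if "s \<in> S" for s using f(1) that by (auto simp: bij_betw_def)
    \<comment> \<open>Pulling back along \<open>f\<close> reverses the direction, so the isomorphism
      found goes from the maps on \<open>T\<close> to those on \<open>S\<close> and is inverted at
      the end.\<close>
    define h where "h b = (\<lambda>s\<in>S. b (f s))" for b :: "'t \<Rightarrow> 'a"
    have hc: "h b \<in> carrier S.M" if "b \<in> carrier T.M" for b
      using T.maps_closed[OF that] T.maps_equivariant[OF that] fc
      by (auto simp: h_def S.maps_carrier_iff f(2))
    have "h \<in> ring_hom T.M S.M"
      using hc fc
      by (intro ring_hom_memI S.maps_eqI S.maps_ops_extensional) 
         (auto simp: h_def S.maps_apply T.maps_apply)
    moreover have "bij_betw h (carrier T.M) (carrier S.M)"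
    proof (rule bij_betw_imageI)
      show "inj_on h (carrier T.M)"
      proof (rule inj_onI)
        fix b b' assume b: "b \<in> carrier T.M" "b' \<in> carrier T.M" "h b = h b'"
        show "b = b'"
        proof (rule T.maps_eqI)
          fix t assume "t \<in> T"
          then obtain s where "s \<in> S" "t = f s" using f(1) by (auto simp: bij_betw_def)
          then show "b t = b' t" using fun_cong[OF b(3), of s] by (simp add: h_def)
        qed (use b T.maps_extensional in auto)
      qed
      have "a \<in> h ` carrier T.M" if a: "a \<in> carrier S.M" for a
      proof (rule image_eqI)
        define b where "b = (\<lambda>t\<in>T. a (inv_into S f t))"
        have bf: "b (f s) = a s" if "s \<in> S" for s
          using f(1) fc that by (simp add: b_def bij_betw_inv_into_left)
        show "a = h b"
          using a bf by (intro S.maps_eqI) (auto simp: h_def S.maps_extensional)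
        have b_props: "b (\<beta> \<gamma> t) = \<gamma> (b t)" "b t \<in> carrier R" if \<gamma>t: "\<gamma> \<in> carrier G" "t \<in> T" for \<gamma> t
        proof -
          obtain s where s: "s \<in> S" "t = f s" using \<gamma>t f(1) by (auto simp: bij_betw_def)
          then show "b (\<beta> \<gamma> t) = \<gamma> (b t)" "b t \<in> carrier R"
            using bf[of "\<alpha> \<gamma> s"] bf[of s] that S.maps_equivariant[OF a] S.maps_closed[OF a]
            by (simp_all add: f(2))
        qed
        show "b \<in> carrier T.M"
          using b_props b_props(2)[OF S.G.one_closed]
          by (auto simp: T.maps_carrier_iff PiE_iff) (simp add: b_def)
      qed
      then show "h ` carrier T.M = carrier S.M" using hc by auto
    qed
    moreover have "h (k \<odot>\<^bsub>T.M\<^esub> b) = k \<odot>\<^bsub>S.M\<^esub> h b" for k b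
      using fc by (intro S.maps_eqI S.maps_ops_extensional) (auto simp: h_def S.maps_apply T.maps_apply)
    ultimately have "isomorphic_algebras K T.M S.M"
      by (auto simp: isomorphic_algebras_def ring_iso_def)
    then show "isomorphic_algebras K S.M T.M"
      using isomorphic_algebras_sym T.maps_ops_closed by blast
  }
qed

section \<open>The Fourier transform of a finite abelian group\<close>

text \<open>Both sums arise from the one over \<open>{..Suc n}\<close> by dropping an end term, and
  the two end terms agree. It is applied with \<open>n = e - 1\<close> to terms of period
  \<open>e\<close>, where it says that a sum over a full period may start anywhere.\<close>

lemma (in ring) finsum_shift:
  assumes g: "\<And>i. g i \<in> carrier R" and "g (Suc n) = g 0"
  shows "(\<Oplus>i\<in>{..n}. g (Suc i)) = (\<Oplus>i\<in>{..n}. g i)"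
proof -
  have c: "(\<Oplus>i\<in>{..n}. g (Suc i)) \<in> carrier R" "(\<Oplus>i\<in>{..n}. g i) \<in> carrier R"
    using g by (auto intro!: finsum_closed)
  have "(\<Oplus>i\<in>{..n}. g (Suc i)) \<oplus> g 0 = (\<Oplus>i\<in>{..Suc n}. g i)"
    using g by (intro finsum_Suc2[symmetric]) auto
  also have "\<dots> = g (Suc n) \<oplus> (\<Oplus>i\<in>{..n}. g i)"
    using g by (intro finsum_Suc) auto
  also have "\<dots> = (\<Oplus>i\<in>{..n}. g i) \<oplus> g 0"
    using c g assms(2) by (simp add: a_comm)
  finally show ?thesis using c g by (simp only: add.right_cancel)
qed

lemma (in domain) scaled_eq_imp_zero:
  assumes "q \<otimes> x = x" "q \<noteq> \<one>" "q \<in> carrier R" "x \<in> carrier R"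
  shows "x = \<zero>"
proof -
  have "(q \<ominus> \<one>) \<otimes> x = \<zero>"
    using assms by (simp add: a_minus_def l_distr l_minus r_neg)
  moreover have "q \<ominus> \<one> \<noteq> \<zero>" using assms by simp
  ultimately show ?thesis using integral[of "q \<ominus> \<one>" x] assms by auto
qed

text \<open>The coefficients of \<open>X^n - 1\<close>, leading one first, for positive
  \<open>n\<close>. At \<open>n = 0\<close> truncated subtraction yields \<open>X - 1\<close>, hence
  the positivity condition in \<open>eval_unity_poly\<close>.\<close>

definition (in ring) unity_poly :: "nat \<Rightarrow> 'a list" where
  "unity_poly n = \<one> # replicate (n - 1) \<zero> @ [\<ominus> \<one>]"

lemma (in domain) unity_poly_carrier: "subring K R \<Longrightarrow> unity_poly n \<in> carrier (K[X])"
  using subringE[of K R]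
  by (auto simp: unity_poly_def polynomial_def simp flip: univ_poly_carrier)

lemma (in domain) eval_unity_poly:
  assumes "0 < n" "x \<in> carrier R"
  shows "eval (unity_poly n) x = x [^] n \<ominus> \<one>"
proof -
  have "eval (replicate (n - 1) \<zero> @ [\<ominus> \<one>]) x = \<ominus> \<one>"
    using assms by (subst eval_replicate) auto
  then show ?thesis using assms by (simp add: unity_poly_def a_minus_def)
qed

lemma (in domain) finite_roots_of_unity:
  assumes "0 < (n::nat)"
  shows "finite {x \<in> carrier R. x [^] n = \<one>}"
proof (rule finite_subset)
  show "{x \<in> carrier R. x [^] n = \<one>} \<subseteq> {x. is_root (unity_poly n) x}"
    using assms by (auto simp: is_root_def eval_unity_poly) (simp add: unity_poly_def)
  show "finite {x. is_root (unity_poly n) x}"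
    by (intro finite_number_of_roots unity_poly_carrier carrier_is_subring)
qed

text \<open>Here \<open>e\<close> is a common multiple of the orders of the elements and not the
  exponent itself, because one \<open>e\<close> and one \<zeta> have to serve two groups.\<close>

locale character_setting = field R + N: comm_group N
  for R :: "('a, 'b) ring_scheme" (structure) and N :: "('n, 'd) monoid_scheme" +
  fixes e :: nat and \<zeta> :: 'a
  assumes finite_N: "finite (carrier N)"
    and exponent: "\<eta> \<in> carrier N \<Longrightarrow> \<eta> [^]\<^bsub>N\<^esub> e = \<one>\<^bsub>N\<^esub>"
    and primitive: "primitive_root_of_unity R e \<zeta>"
    and char0: "char_zero R"
begin

lemma e_pos: "e > 0" and \<zeta>_closed: "\<zeta> \<in> carrier R" and \<zeta>_e: "\<zeta> [^] e = \<one>"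
  and \<zeta>_less: "0 < m \<Longrightarrow> m < e \<Longrightarrow> \<zeta> [^] m \<noteq> \<one>" for m
  using primitive by (auto simp: primitive_root_of_unity_def)

lemma nat_mult_nonzero: "n > 0 \<Longrightarrow> x \<in> carrier R \<Longrightarrow> x \<noteq> \<zero> \<Longrightarrow> [n] \<cdot> x \<noteq> \<zero>" for n :: nat
proof
  assume "n > 0" "x \<in> carrier R" "x \<noteq> \<zero>" "[n] \<cdot> x = \<zero>"
  then have "([n] \<cdot> \<one>) \<otimes> x = \<zero>" by (simp add: add_pow_ldistr)
  then show False
    using integral[of "[n] \<cdot> \<one>" x] \<open>n > 0\<close> \<open>x \<in> carrier R\<close> \<open>x \<noteq> \<zero>\<close> char0
    by (auto simp: char_zero_def)
qed

lemma card_N_pos: "card (carrier N) > 0"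
  using finite_N N.one_closed card_gt_0_iff by blast

lemma character_closed: "\<chi> \<in> characters N R \<Longrightarrow> \<eta> \<in> carrier N \<Longrightarrow> \<chi> \<eta> \<in> carrier R"
  and character_nonzero: "\<chi> \<in> characters N R \<Longrightarrow> \<eta> \<in> carrier N \<Longrightarrow> \<chi> \<eta> \<noteq> \<zero>"
  and character_mult: "\<chi> \<in> characters N R \<Longrightarrow> \<eta> \<in> carrier N \<Longrightarrow> \<mu> \<in> carrier N \<Longrightarrow>
    \<chi> (\<eta> \<otimes>\<^bsub>N\<^esub> \<mu>) = \<chi> \<eta> \<otimes> \<chi> \<mu>"
  and character_extensional: "\<chi> \<in> characters N R \<Longrightarrow> \<chi> \<in> extensional (carrier N)"
  by (auto simp: characters_def hom_def Pi_def)

lemma characterI: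
  assumes "\<chi> \<in> extensional (carrier N)" "\<And>\<eta>. \<eta> \<in> carrier N \<Longrightarrow> \<chi> \<eta> \<in> carrier R"
    "\<And>\<eta>. \<eta> \<in> carrier N \<Longrightarrow> \<chi> \<eta> \<noteq> \<zero>"
    "\<And>\<eta> \<mu>. \<eta> \<in> carrier N \<Longrightarrow> \<mu> \<in> carrier N \<Longrightarrow> \<chi> (\<eta> \<otimes>\<^bsub>N\<^esub> \<mu>) = \<chi> \<eta> \<otimes> \<chi> \<mu>"
  shows "\<chi> \<in> characters N R"
  using assms by (auto simp: characters_def hom_def)

lemma character_one:
  assumes "\<chi> \<in> characters N R"
  shows "\<chi> \<one>\<^bsub>N\<^esub> = \<one>"
proof -
  have c: "\<chi> \<one>\<^bsub>N\<^esub> \<in> carrier R" "\<chi> \<one>\<^bsub>N\<^esub> \<noteq> \<zero>"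
    using assms character_closed character_nonzero by auto
  have "\<chi> \<one>\<^bsub>N\<^esub> \<otimes> \<chi> \<one>\<^bsub>N\<^esub> = \<chi> \<one>\<^bsub>N\<^esub> \<otimes> \<one>"
    using character_mult[OF assms N.one_closed N.one_closed] c by simp
  then show ?thesis using c m_lcancel by blast
qed

lemma character_inv:
  assumes "\<chi> \<in> characters N R" "\<eta> \<in> carrier N"
  shows "\<chi> \<eta> \<otimes> \<chi> (inv\<^bsub>N\<^esub> \<eta>) = \<one>" "\<chi> (inv\<^bsub>N\<^esub> \<eta>) \<otimes> \<chi> \<eta> = \<one>"
  using character_mult[OF assms(1), of \<eta> "inv\<^bsub>N\<^esub> \<eta>"] character_mult[OF assms(1), of "inv\<^bsub>N\<^esub> \<eta>" \<eta>]
    character_one[OF assms(1)] assms(2) by simp_all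

lemma character_pow:
  assumes "\<chi> \<in> characters N R" "\<eta> \<in> carrier N"
  shows "\<chi> (\<eta> [^]\<^bsub>N\<^esub> (n::nat)) = \<chi> \<eta> [^] n"
  by (induction n) (use assms in \<open>simp_all add: character_one character_mult\<close>)

text \<open>The values of a character are roots of \<open>X^e - 1\<close>, and both this set of
  roots and \<open>N\<close> are finite.\<close>

lemma finite_characters: "finite (characters N R)"
proof (rule finite_subset)
  show "characters N R \<subseteq> carrier N \<rightarrow>\<^sub>E {x \<in> carrier R. x [^] e = \<one>}"
  proof
    fix \<chi> assume \<chi>: "\<chi> \<in> characters N R"
    have "\<chi> \<eta> [^] e = \<one>" if "\<eta> \<in> carrier N" for \<eta>
      using character_pow[OF \<chi> that, of e] exponent[OF that] character_one[OF \<chi>] by simp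
    then show "\<chi> \<in> carrier N \<rightarrow>\<^sub>E {x \<in> carrier R. x [^] e = \<one>}"
      using character_closed[OF \<chi>] character_extensional[OF \<chi>] by (auto simp: PiE_iff)
  qed
  show "finite (carrier N \<rightarrow>\<^sub>E {x \<in> carrier R. x [^] e = \<one>})"
    using finite_N finite_roots_of_unity[OF e_pos] by (intro finite_PiE) auto
qed

lemma finsum_translate:
  assumes "\<mu> \<in> carrier N" "f \<in> carrier N \<rightarrow> carrier R"
  shows "(\<Oplus>\<eta>\<in>carrier N. f (\<mu> \<otimes>\<^bsub>N\<^esub> \<eta>)) = (\<Oplus>\<eta>\<in>carrier N. f \<eta>)"
  using finsum_reindex[of f "(\<otimes>\<^bsub>N\<^esub>) \<mu>" "carrier N"] assms
    N.surj_const_mult[OF assms(1)] N.inj_on_cmult[OF assms(1)] by simp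

text \<open>The summand \<theta> is multiplicative in \<eta>. If \<chi> and \<psi> differ at \<mu>,
  then \<open>\<theta> \<mu> \<noteq> \<one>\<close>, while translation by \<mu> multiplies the sum
  by \<open>\<theta> \<mu>\<close> and at the same time leaves it unchanged.\<close>

lemma character_orthogonality:
  assumes \<chi>: "\<chi> \<in> characters N R" and \<psi>: "\<psi> \<in> characters N R"
  shows "(\<Oplus>\<eta>\<in>carrier N. \<chi> (inv\<^bsub>N\<^esub> \<eta>) \<otimes> \<psi> \<eta>) = (if \<chi> = \<psi> then [card (carrier N)] \<cdot> \<one> else \<zero>)"
proof (cases "\<chi> = \<psi>")
  case True
  then have "(\<Oplus>\<eta>\<in>carrier N. \<chi> (inv\<^bsub>N\<^esub> \<eta>) \<otimes> \<psi> \<eta>) = (\<Oplus>\<eta>\<in>carrier N. \<one>)"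
    using character_inv[OF \<psi>] by (intro finsum_cong') auto
  also have "\<dots> = [card (carrier N)] \<cdot> \<one>" by (rule add.finprod_const) simp
  finally show ?thesis using True by simp
next
  case False
  then obtain \<mu> where \<mu>: "\<mu> \<in> carrier N" "\<chi> \<mu> \<noteq> \<psi> \<mu>"
    using extensionalityI[OF character_extensional[OF \<chi>] character_extensional[OF \<psi>]] by blast
  define \<theta> where "\<theta> \<eta> = \<chi> (inv\<^bsub>N\<^esub> \<eta>) \<otimes> \<psi> \<eta>" for \<eta>
  have c: "\<chi> \<eta> \<in> carrier R" "\<psi> \<eta> \<in> carrier R" if "\<eta> \<in> carrier N" for \<eta>
    using that character_closed \<chi> \<psi> by auto
  have \<theta>c: "\<theta> \<eta> \<in> carrier R" if "\<eta> \<in> carrier N" for \<eta>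
    unfolding \<theta>_def using that c by auto
  have \<theta>m: "\<theta> (\<mu> \<otimes>\<^bsub>N\<^esub> \<eta>) = \<theta> \<mu> \<otimes> \<theta> \<eta>" if "\<eta> \<in> carrier N" for \<eta>
    unfolding \<theta>_def using that \<mu> c
    by (simp add: N.inv_mult character_mult[OF \<chi>] character_mult[OF \<psi>] m_ac)
  have "\<theta> \<mu> \<noteq> \<one>"
  proof
    assume "\<theta> \<mu> = \<one>"
    then have "\<chi> \<mu> \<otimes> \<theta> \<mu> = \<chi> \<mu>" using c \<mu> by simp
    then have "(\<chi> \<mu> \<otimes> \<chi> (inv\<^bsub>N\<^esub> \<mu>)) \<otimes> \<psi> \<mu> = \<chi> \<mu>"
      unfolding \<theta>_def using c \<mu> by (simp add: m_assoc)
    then show False using character_inv[OF \<chi> \<mu>(1)] c \<mu> by simp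
  qed
  moreover have "\<theta> \<mu> \<otimes> (\<Oplus>\<eta>\<in>carrier N. \<theta> \<eta>) = (\<Oplus>\<eta>\<in>carrier N. \<theta> \<eta>)"
  proof -
    have "\<theta> \<mu> \<otimes> (\<Oplus>\<eta>\<in>carrier N. \<theta> \<eta>) = (\<Oplus>\<eta>\<in>carrier N. \<theta> \<mu> \<otimes> \<theta> \<eta>)"
      using \<theta>c \<mu> finite_N by (intro finsum_rdistr) auto
    also have "\<dots> = (\<Oplus>\<eta>\<in>carrier N. \<theta> (\<mu> \<otimes>\<^bsub>N\<^esub> \<eta>))"
      using \<theta>c \<theta>m \<mu> by (intro finsum_cong') auto
    also have "\<dots> = (\<Oplus>\<eta>\<in>carrier N. \<theta> \<eta>)"
      using \<theta>c \<mu> by (intro finsum_translate) auto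
    finally show ?thesis .
  qed
  ultimately have "(\<Oplus>\<eta>\<in>carrier N. \<theta> \<eta>) = \<zero>"
    using scaled_eq_imp_zero[of "\<theta> \<mu>" "\<Oplus>\<eta>\<in>carrier N. \<theta> \<eta>"] \<theta>c \<mu>
    by (auto intro!: finsum_closed)
  then show ?thesis using False by (simp add: \<theta>_def)
qed

section \<open>Bijectivity of the Fourier transform\<close>

definition fourier :: "('n \<Rightarrow> 'a) \<Rightarrow> ('n \<Rightarrow> 'a) \<Rightarrow> 'a" where
  "fourier a = (\<lambda>\<chi>\<in>characters N R. \<Oplus>\<eta>\<in>carrier N. a \<eta> \<otimes> \<chi> \<eta>)"

lemma fourier_apply:
  "\<chi> \<in> characters N R \<Longrightarrow> fourier a \<chi> = (\<Oplus>\<eta>\<in>carrier N. a \<eta> \<otimes> \<chi> \<eta>)"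
  by (simp add: fourier_def)

lemma fourier_closed:
  "a \<in> carrier N \<rightarrow> carrier R \<Longrightarrow> \<chi> \<in> characters N R \<Longrightarrow> fourier a \<chi> \<in> carrier R"
  unfolding fourier_apply by (intro finsum_closed) (auto simp: character_closed)

text \<open>The preimage is the inverse transform,
  \<open>a(\<eta>) = |N|^-1 \<Sum> b(\<chi>) \<chi>(\<eta>^-1)\<close> summed over the characters.
  Orthogonality makes it work however many characters there are; that there are enough of them is
  the content of injectivity.\<close>

lemma fourier_surj:
  assumes b: "b \<in> characters N R \<rightarrow>\<^sub>E carrier R"
  obtains a where "a \<in> carrier N \<rightarrow>\<^sub>E carrier R" "fourier a = b"
proof -
  define n where "n = [card (carrier N)] \<cdot> \<one>"
  have n: "n \<in> Units R"
    using nat_mult_nonzero[OF card_N_pos] by (simp add: n_def field_Units)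
  have bc: "b \<chi> \<in> carrier R" if "\<chi> \<in> characters N R" for \<chi> using b that by auto
  define a where "a = (\<lambda>\<eta>\<in>carrier N. \<Oplus>\<chi>\<in>characters N R. inv n \<otimes> b \<chi> \<otimes> \<chi> (inv\<^bsub>N\<^esub> \<eta>))"
  have "a \<in> carrier N \<rightarrow>\<^sub>E carrier R"
    unfolding a_def using n bc character_closed by (auto intro!: finsum_closed)
  moreover have "fourier a = b"
  proof (rule extensionalityI)
    show "fourier a \<in> extensional (characters N R)" by (simp add: fourier_def)
    show "b \<in> extensional (characters N R)" using b by (simp add: PiE_iff)
    fix \<psi> assume \<psi>: "\<psi> \<in> characters N R"
    have "fourier a \<psi> = (\<Oplus>\<eta>\<in>carrier N. \<Oplus>\<chi>\<in>characters N R. inv n \<otimes> b \<chi> \<otimes> (\<chi> (inv\<^bsub>N\<^esub> \<eta>) \<otimes> \<psi> \<eta>))"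
      unfolding fourier_apply[OF \<psi>] a_def using n bc character_closed \<psi> finite_characters
      by (intro finsum_cong') (auto simp: finsum_ldistr m_assoc intro!: finsum_closed finsum_cong')
    also have "\<dots> = (\<Oplus>\<chi>\<in>characters N R. \<Oplus>\<eta>\<in>carrier N. inv n \<otimes> b \<chi> \<otimes> (\<chi> (inv\<^bsub>N\<^esub> \<eta>) \<otimes> \<psi> \<eta>))"
      using n bc character_closed \<psi> finite_characters finite_N by (intro finsum_swap) auto
    also have "\<dots> = (\<Oplus>\<chi>\<in>characters N R. inv n \<otimes> b \<chi> \<otimes> (\<Oplus>\<eta>\<in>carrier N. \<chi> (inv\<^bsub>N\<^esub> \<eta>) \<otimes> \<psi> \<eta>))"
      using n bc character_closed \<psi> finite_N
      by (intro finsum_cong' finsum_rdistr[symmetric]) (auto intro!: finsum_closed)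
    also have "\<dots> = (\<Oplus>\<chi>\<in>characters N R. if \<chi> = \<psi> then b \<chi> else \<zero>)"
    proof (intro finsum_cong' refl)
      fix \<chi> assume \<chi>: "\<chi> \<in> characters N R"
      have "inv n \<otimes> b \<chi> \<otimes> n = b \<chi> \<otimes> (inv n \<otimes> n)"
        using n bc[OF \<chi>] by (simp add: m_ac Units_closed del: Units_l_inv Units_r_inv)
      then have "inv n \<otimes> b \<chi> \<otimes> n = b \<chi>"
        using n bc[OF \<chi>] by simp
      then show "inv n \<otimes> b \<chi> \<otimes> (\<Oplus>\<eta>\<in>carrier N. \<chi> (inv\<^bsub>N\<^esub> \<eta>) \<otimes> \<psi> \<eta>) = (if \<chi> = \<psi> then b \<chi> else \<zero>)"
        using n bc[OF \<chi>] by (auto simp: character_orthogonality[OF \<chi> \<psi>] simp flip: n_def)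
    qed (use bc in auto)
    also have "\<dots> = b \<psi>" using \<psi> bc finite_characters by (intro finsum_delta) auto
    finally show "fourier a \<psi> = b \<psi>" .
  qed
  ultimately show thesis by (rule that)
qed

text \<open>This is a geometric sum over a full period of \<open>q = \<zeta> [^] i\<close>.
  Multiplication by \<open>q\<close> only shifts it, and \<open>q \<noteq> \<one>\<close> because
  \<zeta> is primitive.\<close>

lemma root_powers_sum:
  assumes "0 < i" "i < e"
  shows "(\<Oplus>j\<in>{..e - 1}. \<zeta> [^] (i * j)) = \<zero>"
proof -
  define q where "q = \<zeta> [^] i"
  have q: "q \<in> carrier R" "q \<noteq> \<one>" using \<zeta>_closed \<zeta>_less assms by (auto simp: q_def)
  have qe: "q [^] e = \<one>"
    using \<zeta>_e \<zeta>_closed by (simp add: q_def nat_pow_pow mult.commute[of i e]) (metis nat_pow_pow nat_pow_one)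
  have "q \<otimes> (\<Oplus>j\<in>{..e - 1}. q [^] j) = (\<Oplus>j\<in>{..e - 1}. q [^] Suc j)"
    using q by (subst finsum_rdistr) (auto simp: m_comm)
  also have "\<dots> = (\<Oplus>j\<in>{..e - 1}. q [^] j)"
    using q qe e_pos by (intro finsum_shift) auto
  finally have "(\<Oplus>j\<in>{..e - 1}. q [^] j) = \<zero>"
    using q by (intro scaled_eq_imp_zero[of q]) (auto intro!: finsum_closed)
  then show ?thesis using \<zeta>_closed by (simp add: q_def nat_pow_pow)
qed

text \<open>The functions with vanishing Fourier transform form a translation invariant subspace; if it were
  nonzero, projecting successively to eigenspaces of the translations would yield a common
  eigenfunction in it, which is a multiple of a character.\<close>

lemma fourier_kernel_eigenfunction:
  assumes "finite Y" "Y \<subseteq> carrier N" "w \<in> carrier N \<rightarrow> carrier R"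
    "\<forall>\<chi>\<in>characters N R. fourier w \<chi> = \<zero>" "\<exists>\<eta>\<in>carrier N. w \<eta> \<noteq> \<zero>"
  shows "\<exists>v. v \<in> carrier N \<rightarrow> carrier R \<and> (\<forall>\<chi>\<in>characters N R. fourier v \<chi> = \<zero>) \<and>
    (\<exists>\<eta>\<in>carrier N. v \<eta> \<noteq> \<zero>) \<and>
    (\<forall>x\<in>Y. \<exists>c\<in>carrier R. \<forall>\<eta>\<in>carrier N. v (x \<otimes>\<^bsub>N\<^esub> \<eta>) = c \<otimes> v \<eta>)"
  using assms
proof (induction Y rule: finite_induct)
  case empty
  then show ?case by auto
next
  case (insert x Y)
  have x: "x \<in> carrier N" and Y: "Y \<subseteq> carrier N" using insert.prems by auto
  obtain v where vc: "v \<in> carrier N \<rightarrow> carrier R" and vf: "\<forall>\<chi>\<in>characters N R. fourier v \<chi> = \<zero>"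
    and vn: "\<exists>\<eta>\<in>carrier N. v \<eta> \<noteq> \<zero>"
    and ve: "\<forall>y\<in>Y. \<exists>c\<in>carrier R. \<forall>\<eta>\<in>carrier N. v (y \<otimes>\<^bsub>N\<^esub> \<eta>) = c \<otimes> v \<eta>"
    using insert.IH[OF Y insert.prems(2-4)] by (elim exE conjE) (rule that)
  from vn obtain \<eta>0 where \<eta>0: "\<eta>0 \<in> carrier N" "v \<eta>0 \<noteq> \<zero>" by blast
  have v: "v \<eta> \<in> carrier R" if "\<eta> \<in> carrier N" for \<eta> using vc that by auto
  \<comment> \<open>Up to the factor \<open>e\<close>, \<open>u j\<close> is the projection of
    \<open>v\<close> to the eigenspace of translation by \<open>x\<close> whose eigenvalue is the
    inverse of \<open>\<zeta> [^] j\<close>; the eigenvalues are \<open>e\<close>-th roots of unity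
    because the \<open>e\<close>-th power of \<open>x\<close> is trivial.\<close>
  define u where "u j \<eta> = (\<Oplus>i\<in>{..e - 1}. \<zeta> [^] (i * j) \<otimes> v (x [^]\<^bsub>N\<^esub> i \<otimes>\<^bsub>N\<^esub> \<eta>))" for j :: nat and \<eta>
  have uc: "u j \<eta> \<in> carrier R" if "\<eta> \<in> carrier N" for j \<eta>
    unfolding u_def using that x v \<zeta>_closed by (intro finsum_closed) auto
  \<comment> \<open>The projections add up to \<open>e\<close> times \<open>v\<close>: in the double
    sum every \<open>i > 0\<close> is cancelled by \<open>root_powers_sum\<close>. So they cannot
    all vanish where \<open>v\<close> does not.\<close>
  have "\<exists>j. u j \<eta>0 \<noteq> \<zero>"
  proof (rule ccontr)
    assume "\<not> ?thesis"
    then have "(\<Oplus>j\<in>{..e - 1}. u j \<eta>0) = \<zero>" by simp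
    moreover have "(\<Oplus>j\<in>{..e - 1}. u j \<eta>0) = [e] \<cdot> v \<eta>0"
    proof -
      have "(\<Oplus>j\<in>{..e - 1}. u j \<eta>0) =
          (\<Oplus>i\<in>{..e - 1}. \<Oplus>j\<in>{..e - 1}. \<zeta> [^] (i * j) \<otimes> v (x [^]\<^bsub>N\<^esub> i \<otimes>\<^bsub>N\<^esub> \<eta>0))"
        unfolding u_def using \<eta>0 x v \<zeta>_closed by (intro finsum_swap) auto
      also have "\<dots> = (\<Oplus>i\<in>{..e - 1}. (\<Oplus>j\<in>{..e - 1}. \<zeta> [^] (i * j)) \<otimes> v (x [^]\<^bsub>N\<^esub> i \<otimes>\<^bsub>N\<^esub> \<eta>0))"
        using \<eta>0 x v \<zeta>_closed
        by (intro finsum_cong' finsum_ldistr[symmetric]) (auto intro!: finsum_closed)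
      also have "\<dots> = (\<Oplus>i\<in>{..e - 1}. if i = 0 then [e] \<cdot> v \<eta>0 else \<zero>)"
      proof (intro finsum_cong' refl)
        fix i assume "i \<in> {..e - 1}"
        then have i: "i < e" using e_pos by auto
        show "(\<Oplus>j\<in>{..e - 1}. \<zeta> [^] (i * j)) \<otimes> v (x [^]\<^bsub>N\<^esub> i \<otimes>\<^bsub>N\<^esub> \<eta>0) =
            (if i = 0 then [e] \<cdot> v \<eta>0 else \<zero>)"
        proof (cases "i = 0")
          case True
          have "(\<Oplus>j\<in>{..e - 1}. \<one>) = [e] \<cdot> \<one>"
            using add.finprod_const[of \<one> "{..e - 1}"] e_pos by simp
          then show ?thesis using True \<eta>0 v by (simp add: add_pow_ldistr)
        next
          case False
          then show ?thesis using root_powers_sum[of i] i \<eta>0 x v by simp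
        qed
      qed (use \<eta>0 v in auto)
      also have "\<dots> = [e] \<cdot> v \<eta>0" using \<eta>0 v by (intro finsum_delta) auto
      finally show ?thesis .
    qed
    ultimately show False using nat_mult_nonzero[OF e_pos v[OF \<eta>0(1)] \<eta>0(2)] by simp
  qed
  then obtain j where j: "u j \<eta>0 \<noteq> \<zero>" by blast
  \<comment> \<open>The kernel is translation invariant, since translating \<open>v\<close> by
    \<open>y\<close> multiplies its transform at \<chi> by \<chi> of the inverse of
    \<open>y\<close>; and \<open>u j\<close> is a combination of translates of
    \<open>v\<close>.\<close>
  have "fourier (u j) \<chi> = \<zero>" if \<chi>: "\<chi> \<in> characters N R" for \<chi>
  proof -
    have "fourier (u j) \<chi> =
        (\<Oplus>\<eta>\<in>carrier N. \<Oplus>i\<in>{..e - 1}. \<zeta> [^] (i * j) \<otimes> (v (x [^]\<^bsub>N\<^esub> i \<otimes>\<^bsub>N\<^esub> \<eta>) \<otimes> \<chi> \<eta>))"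
      unfolding fourier_apply[OF \<chi>] u_def using x v \<zeta>_closed character_closed[OF \<chi>]
      by (intro finsum_cong') (auto simp: finsum_ldistr m_assoc intro!: finsum_closed)
    also have "\<dots> = (\<Oplus>i\<in>{..e - 1}. \<Oplus>\<eta>\<in>carrier N. \<zeta> [^] (i * j) \<otimes> (v (x [^]\<^bsub>N\<^esub> i \<otimes>\<^bsub>N\<^esub> \<eta>) \<otimes> \<chi> \<eta>))"
      using x v \<zeta>_closed character_closed[OF \<chi>] finite_N by (intro finsum_swap) auto
    also have "\<dots> = (\<Oplus>i\<in>{..e - 1}. \<zero>)"
    proof (intro finsum_cong' refl)
      fix i :: nat
      define y where "y = x [^]\<^bsub>N\<^esub> i"
      have y: "y \<in> carrier N" using x by (simp add: y_def)
      define f where "f \<eta> = \<chi> (inv\<^bsub>N\<^esub> y) \<otimes> (v \<eta> \<otimes> \<chi> \<eta>)" for \<eta>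
      have "v (y \<otimes>\<^bsub>N\<^esub> \<eta>) \<otimes> \<chi> \<eta> = f (y \<otimes>\<^bsub>N\<^esub> \<eta>)" if "\<eta> \<in> carrier N" for \<eta>
      proof -
        have "\<chi> \<eta> = \<chi> (inv\<^bsub>N\<^esub> y) \<otimes> \<chi> (y \<otimes>\<^bsub>N\<^esub> \<eta>)"
          using character_mult[OF \<chi>, of "inv\<^bsub>N\<^esub> y" "y \<otimes>\<^bsub>N\<^esub> \<eta>"] y that by (simp flip: N.m_assoc)
        then show ?thesis unfolding f_def using v y that character_closed[OF \<chi>]
          by (simp add: m_lcomm)
      qed
      then have "(\<Oplus>\<eta>\<in>carrier N. v (y \<otimes>\<^bsub>N\<^esub> \<eta>) \<otimes> \<chi> \<eta>) = (\<Oplus>\<eta>\<in>carrier N. f (y \<otimes>\<^bsub>N\<^esub> \<eta>))"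
        using v y character_closed[OF \<chi>] by (intro finsum_cong') (auto simp: f_def)
      also have "\<dots> = (\<Oplus>\<eta>\<in>carrier N. f \<eta>)"
        using v y character_closed[OF \<chi>] by (intro finsum_translate) (auto simp: f_def)
      also have "\<dots> = \<chi> (inv\<^bsub>N\<^esub> y) \<otimes> fourier v \<chi>"
        unfolding fourier_apply[OF \<chi>] f_def using v y character_closed[OF \<chi>] finite_N
        by (intro finsum_rdistr[symmetric]) auto
      also have "\<dots> = \<zero>" using bspec[OF vf \<chi>] y character_closed[OF \<chi>] by simp
      finally have z: "(\<Oplus>\<eta>\<in>carrier N. v (y \<otimes>\<^bsub>N\<^esub> \<eta>) \<otimes> \<chi> \<eta>) = \<zero>" .
      have "(\<Oplus>\<eta>\<in>carrier N. \<zeta> [^] (i * j) \<otimes> (v (y \<otimes>\<^bsub>N\<^esub> \<eta>) \<otimes> \<chi> \<eta>)) =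
          \<zeta> [^] (i * j) \<otimes> (\<Oplus>\<eta>\<in>carrier N. v (y \<otimes>\<^bsub>N\<^esub> \<eta>) \<otimes> \<chi> \<eta>)"
        using v y character_closed[OF \<chi>] \<zeta>_closed finite_N
        by (intro finsum_rdistr[symmetric]) auto
      then show "(\<Oplus>\<eta>\<in>carrier N. \<zeta> [^] (i * j) \<otimes> (v (x [^]\<^bsub>N\<^esub> i \<otimes>\<^bsub>N\<^esub> \<eta>) \<otimes> \<chi> \<eta>)) = \<zero>"
        using z \<zeta>_closed by (simp add: y_def)
    qed auto
    finally show ?thesis by simp
  qed
  \<comment> \<open>Translations commute, so the projection keeps the eigenvalues already reached
    for \<open>Y\<close>.\<close>
  moreover have "\<exists>c\<in>carrier R. \<forall>\<eta>\<in>carrier N. u j (y \<otimes>\<^bsub>N\<^esub> \<eta>) = c \<otimes> u j \<eta>" if y: "y \<in> Y" for y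
  proof -
    obtain c where c: "c \<in> carrier R" "\<And>\<eta>. \<eta> \<in> carrier N \<Longrightarrow> v (y \<otimes>\<^bsub>N\<^esub> \<eta>) = c \<otimes> v \<eta>"
      using bspec[OF ve y] by blast
    have yN: "y \<in> carrier N" using y Y by auto
    have "u j (y \<otimes>\<^bsub>N\<^esub> \<eta>) = c \<otimes> u j \<eta>" if \<eta>: "\<eta> \<in> carrier N" for \<eta>
    proof -
      have "u j (y \<otimes>\<^bsub>N\<^esub> \<eta>) = (\<Oplus>i\<in>{..e - 1}. c \<otimes> (\<zeta> [^] (i * j) \<otimes> v (x [^]\<^bsub>N\<^esub> i \<otimes>\<^bsub>N\<^esub> \<eta>)))"
        unfolding u_def
      proof (intro finsum_cong' refl)
        fix i :: nat
        have "x [^]\<^bsub>N\<^esub> i \<otimes>\<^bsub>N\<^esub> (y \<otimes>\<^bsub>N\<^esub> \<eta>) = y \<otimes>\<^bsub>N\<^esub> (x [^]\<^bsub>N\<^esub> i \<otimes>\<^bsub>N\<^esub> \<eta>)"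
          using x yN \<eta> by (intro N.m_lcomm) auto
        then show "\<zeta> [^] (i * j) \<otimes> v (x [^]\<^bsub>N\<^esub> i \<otimes>\<^bsub>N\<^esub> (y \<otimes>\<^bsub>N\<^esub> \<eta>)) =
            c \<otimes> (\<zeta> [^] (i * j) \<otimes> v (x [^]\<^bsub>N\<^esub> i \<otimes>\<^bsub>N\<^esub> \<eta>))"
          using c x \<eta> v \<zeta>_closed by (simp add: m_lcomm)
      qed (use c x \<eta> v \<zeta>_closed in auto)
      also have "\<dots> = c \<otimes> u j \<eta>"
        unfolding u_def using c x \<eta> v \<zeta>_closed by (intro finsum_rdistr[symmetric]) auto
      finally show ?thesis .
    qed
    then show ?thesis using c(1) by blast
  qed
  \<comment> \<open>Moving the argument by \<open>x\<close> and multiplying by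
    \<open>\<zeta> [^] j\<close> raises the summation index by one, and the terms have period
    \<open>e\<close>.\<close>
  moreover have "\<exists>c\<in>carrier R. \<forall>\<eta>\<in>carrier N. u j (x \<otimes>\<^bsub>N\<^esub> \<eta>) = c \<otimes> u j \<eta>"
  proof -
    have zj: "\<zeta> [^] j \<in> Units R"
      using \<zeta>_e \<zeta>_closed e_pos by (metis Units_pow_closed Units_one_closed nat_pow_closed
          unit_factor nat_pow_Suc Suc_pred m_comm)
    have "u j (x \<otimes>\<^bsub>N\<^esub> \<eta>) = inv (\<zeta> [^] j) \<otimes> u j \<eta>" if \<eta>: "\<eta> \<in> carrier N" for \<eta>
    proof -
      define g where "g i = \<zeta> [^] (i * j) \<otimes> v (x [^]\<^bsub>N\<^esub> i \<otimes>\<^bsub>N\<^esub> \<eta>)" for i :: nat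
      have gc: "g i \<in> carrier R" for i unfolding g_def using x \<eta> v \<zeta>_closed by auto
      have "\<zeta> [^] (e * j) = \<one>" using \<zeta>_e \<zeta>_closed by (metis nat_pow_pow nat_pow_one)
      then have ge: "g e = g 0" using exponent[OF x] by (simp add: g_def)
      have "\<zeta> [^] j \<otimes> u j (x \<otimes>\<^bsub>N\<^esub> \<eta>) = (\<Oplus>i\<in>{..e - 1}. g (Suc i))"
      proof -
        have "\<zeta> [^] j \<otimes> u j (x \<otimes>\<^bsub>N\<^esub> \<eta>) =
            (\<Oplus>i\<in>{..e - 1}. \<zeta> [^] j \<otimes> (\<zeta> [^] (i * j) \<otimes> v (x [^]\<^bsub>N\<^esub> i \<otimes>\<^bsub>N\<^esub> (x \<otimes>\<^bsub>N\<^esub> \<eta>))))"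
          unfolding u_def using x \<eta> v \<zeta>_closed by (intro finsum_rdistr) auto
        also have "\<dots> = (\<Oplus>i\<in>{..e - 1}. g (Suc i))"
          using gc x \<eta> v \<zeta>_closed
          by (intro finsum_cong') (auto simp: g_def N.m_assoc m_assoc[symmetric] nat_pow_mult)
        finally show ?thesis .
      qed
      also have "\<dots> = (\<Oplus>i\<in>{..e - 1}. g i)"
        using gc ge e_pos by (intro finsum_shift) auto
      also have "\<dots> = u j \<eta>" by (simp add: u_def g_def)
      finally have *: "\<zeta> [^] j \<otimes> u j (x \<otimes>\<^bsub>N\<^esub> \<eta>) = u j \<eta>" .
      have "u j (x \<otimes>\<^bsub>N\<^esub> \<eta>) = inv (\<zeta> [^] j) \<otimes> \<zeta> [^] j \<otimes> u j (x \<otimes>\<^bsub>N\<^esub> \<eta>)"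
        using zj uc x \<eta> by simp
      also have "\<dots> = inv (\<zeta> [^] j) \<otimes> u j \<eta>"
        unfolding *[symmetric] using zj uc x \<eta> by (intro m_assoc) auto
      finally show ?thesis .
    qed
    then show ?thesis using zj by blast
  qed
  ultimately show ?case using j \<eta>0 uc by (intro exI[of _ "u j"]) auto
qed

text \<open>A common eigenfunction \<open>v\<close> of all translations is \<open>v(1)\<close> times
  its eigenvalue function \<open>c\<close>, and \<open>c\<close> is multiplicative. For the inverse
  character every term of the transform equals \<open>v(1)\<close>, so the transform there is
  \<open>|N| v(1) \<noteq> 0\<close>.\<close>

lemma fourier_injective:
  assumes w: "w \<in> carrier N \<rightarrow> carrier R" and z: "\<forall>\<chi>\<in>characters N R. fourier w \<chi> = \<zero>"
    and \<eta>: "\<eta> \<in> carrier N"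
  shows "w \<eta> = \<zero>"
proof (rule ccontr)
  assume "w \<eta> \<noteq> \<zero>"
  then obtain v where vc: "v \<in> carrier N \<rightarrow> carrier R" and vf: "\<forall>\<chi>\<in>characters N R. fourier v \<chi> = \<zero>"
    and vn: "\<exists>\<eta>\<in>carrier N. v \<eta> \<noteq> \<zero>"
    and ve: "\<forall>x\<in>carrier N. \<exists>c\<in>carrier R. \<forall>\<eta>\<in>carrier N. v (x \<otimes>\<^bsub>N\<^esub> \<eta>) = c \<otimes> v \<eta>"
    using fourier_kernel_eigenfunction[OF finite_N subset_refl w z] \<eta> by blast
  from ve obtain c where c: "\<And>x. x \<in> carrier N \<Longrightarrow> c x \<in> carrier R"
    "\<And>x \<eta>. x \<in> carrier N \<Longrightarrow> \<eta> \<in> carrier N \<Longrightarrow> v (x \<otimes>\<^bsub>N\<^esub> \<eta>) = c x \<otimes> v \<eta>" by metis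
  have v: "v \<eta> \<in> carrier R" if "\<eta> \<in> carrier N" for \<eta> using vc that by auto
  have v1: "v x = c x \<otimes> v \<one>\<^bsub>N\<^esub>" if "x \<in> carrier N" for x using c(2)[OF that N.one_closed] that by simp
  have nz: "v \<one>\<^bsub>N\<^esub> \<noteq> \<zero>" using vn v1 c(1) by force
  have cm: "c (x \<otimes>\<^bsub>N\<^esub> y) = c x \<otimes> c y" if x: "x \<in> carrier N" and y: "y \<in> carrier N" for x y
  proof -
    have "c (x \<otimes>\<^bsub>N\<^esub> y) \<otimes> v \<one>\<^bsub>N\<^esub> = (c x \<otimes> c y) \<otimes> v \<one>\<^bsub>N\<^esub>"
      using v1[of "x \<otimes>\<^bsub>N\<^esub> y"] v1[OF y] c(2)[OF x y] c(1) x y v by (simp add: m_assoc)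
    then show ?thesis using nz c(1) x y v m_rcancel[of "v \<one>\<^bsub>N\<^esub>"] by simp
  qed
  have c1: "c \<one>\<^bsub>N\<^esub> = \<one>"
    using v1[OF N.one_closed] nz c(1) v m_rcancel[of "v \<one>\<^bsub>N\<^esub>" "c \<one>\<^bsub>N\<^esub>" \<one>] by simp
  have ci: "c x \<otimes> c (inv\<^bsub>N\<^esub> x) = \<one>" if "x \<in> carrier N" for x
    using cm[of x "inv\<^bsub>N\<^esub> x"] c1 that by simp
  define \<chi> where "\<chi> = (\<lambda>x\<in>carrier N. c (inv\<^bsub>N\<^esub> x))"
  have \<chi>: "\<chi> \<in> characters N R"
  proof (rule characterI)
    fix x assume x: "x \<in> carrier N"
    show "\<chi> x \<noteq> \<zero>" using ci[OF x] c(1)[OF x] x by (auto simp: \<chi>_def)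
  qed (use c cm in \<open>auto simp: \<chi>_def N.inv_mult\<close>)
  have "fourier v \<chi> = (\<Oplus>\<eta>\<in>carrier N. v \<one>\<^bsub>N\<^esub>)"
    unfolding fourier_apply[OF \<chi>]
  proof (intro finsum_cong' refl)
    fix x assume x: "x \<in> carrier N"
    then have "v x \<otimes> \<chi> x = v \<one>\<^bsub>N\<^esub> \<otimes> (c x \<otimes> c (inv\<^bsub>N\<^esub> x))"
      using v1[OF x] c(1) v by (simp add: \<chi>_def m_ac)
    then show "v x \<otimes> \<chi> x = v \<one>\<^bsub>N\<^esub>" using ci[OF x] v by simp
  qed (use v in auto)
  also have "\<dots> = [card (carrier N)] \<cdot> v \<one>\<^bsub>N\<^esub>" using v by (intro add.finprod_const) auto
  finally show False using vf \<chi> nat_mult_nonzero[OF card_N_pos v[OF N.one_closed] nz] by simp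
qed

end

section \<open>Compatibility of the Fourier transform with the Galois action\<close>

locale galois_module = galois_action R G K + character_setting R N e \<zeta>
  for R :: "('a, 'b) ring_scheme" (structure) and G :: "('a \<Rightarrow> 'a, 'c) monoid_scheme" and K
    and N :: "('n, 'd) monoid_scheme" and e \<zeta> +
  fixes \<phi> :: "('a \<Rightarrow> 'a) \<Rightarrow> 'n \<Rightarrow> 'n"
  assumes acts: "acts_by_automorphisms G N \<phi>"
begin

lemma \<phi>_auto: "\<gamma> \<in> carrier G \<Longrightarrow> \<phi> \<gamma> \<in> auto N"
  using group_hom.hom_closed[OF acts[unfolded acts_by_automorphisms_def]]
  by (auto simp: AutoGroup_def)

lemma \<phi>_closed [simp]: "\<gamma> \<in> carrier G \<Longrightarrow> \<eta> \<in> carrier N \<Longrightarrow> \<phi> \<gamma> \<eta> \<in> carrier N"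
  using \<phi>_auto[of \<gamma>] by (auto simp: auto_def hom_def)

lemma \<phi>_hom: "\<gamma> \<in> carrier G \<Longrightarrow> \<eta> \<in> carrier N \<Longrightarrow> \<mu> \<in> carrier N \<Longrightarrow>
    \<phi> \<gamma> (\<eta> \<otimes>\<^bsub>N\<^esub> \<mu>) = \<phi> \<gamma> \<eta> \<otimes>\<^bsub>N\<^esub> \<phi> \<gamma> \<mu>"
  using \<phi>_auto[of \<gamma>] by (auto simp: auto_def hom_def)

lemma \<phi>_one: "\<eta> \<in> carrier N \<Longrightarrow> \<phi> \<one>\<^bsub>G\<^esub> \<eta> = \<eta>"
  using group_hom.hom_one[OF acts[unfolded acts_by_automorphisms_def]]
  by (simp add: AutoGroup_def BijGroup_def)

lemma \<phi>_mult:
  assumes "\<gamma> \<in> carrier G" "\<delta> \<in> carrier G" "\<eta> \<in> carrier N"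
  shows "\<phi> (\<gamma> \<otimes>\<^bsub>G\<^esub> \<delta>) \<eta> = \<phi> \<gamma> (\<phi> \<delta> \<eta>)"
  using group_hom.hom_mult[OF acts[unfolded acts_by_automorphisms_def] assms(1,2)] assms
    \<phi>_auto[OF assms(1)] \<phi>_auto[OF assms(2)]
  by (simp add: AutoGroup_def BijGroup_def auto_def compose_eq)

lemma finsum_\<phi>:
  assumes "\<gamma> \<in> carrier G" "f \<in> carrier N \<rightarrow> carrier R"
  shows "(\<Oplus>\<eta>\<in>carrier N. f (\<phi> \<gamma> \<eta>)) = (\<Oplus>\<eta>\<in>carrier N. f \<eta>)"
proof -
  have "bij_betw (\<phi> \<gamma>) (carrier N) (carrier N)"
    using \<phi>_auto[OF assms(1)] by (auto simp: auto_def Bij_def)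
  then have "inj_on (\<phi> \<gamma>) (carrier N)" "\<phi> \<gamma> ` carrier N = carrier N"
    by (simp_all add: bij_betw_def)
  then show ?thesis using finsum_reindex[of f "\<phi> \<gamma>" "carrier N"] assms(2) by simp
qed

abbreviation "act \<equiv> twisted_action G N \<phi>"

lemma act_apply: "\<eta> \<in> carrier N \<Longrightarrow> act \<gamma> f \<eta> = \<gamma> (f (\<phi> (inv\<^bsub>G\<^esub> \<gamma>) \<eta>))"
  by (simp add: twisted_action_def)

lemma act_character:
  assumes \<gamma>: "\<gamma> \<in> carrier G" and \<chi>: "\<chi> \<in> characters N R"
  shows "act \<gamma> \<chi> \<in> characters N R"
proof (rule characterI)
  show "act \<gamma> \<chi> \<in> extensional (carrier N)" by (simp add: twisted_action_def)
  fix \<eta> assume \<eta>: "\<eta> \<in> carrier N"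
  show "act \<gamma> \<chi> \<eta> \<in> carrier R" using \<gamma> \<eta> \<chi> by (simp add: act_apply character_closed)
  show "act \<gamma> \<chi> \<eta> \<noteq> \<zero>"
  proof
    assume "act \<gamma> \<chi> \<eta> = \<zero>"
    then have "\<gamma> (\<chi> (\<phi> (inv\<^bsub>G\<^esub> \<gamma>) \<eta>)) = \<gamma> \<zero>" using \<eta> \<gamma> by (simp add: act_apply aut_zero)
    then have "\<chi> (\<phi> (inv\<^bsub>G\<^esub> \<gamma>) \<eta>) = \<zero>"
      using aut_inv_apply(2)[OF \<gamma>] \<gamma> \<eta> character_closed[OF \<chi>] by (metis zero_closed G.inv_closed \<phi>_closed)
    then show False using character_nonzero[OF \<chi>] \<gamma> \<eta> by simp
  qed
  fix \<mu> assume \<mu>: "\<mu> \<in> carrier N"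
  show "act \<gamma> \<chi> (\<eta> \<otimes>\<^bsub>N\<^esub> \<mu>) = act \<gamma> \<chi> \<eta> \<otimes> act \<gamma> \<chi> \<mu>"
    using \<gamma> \<eta> \<mu> character_closed[OF \<chi>]
    by (simp add: act_apply \<phi>_hom character_mult[OF \<chi>] aut_mult)
qed

lemma galois_set_characters: "galois_set R G K (characters N R) act"
proof
  show "finite (characters N R)" by (rule finite_characters)
  fix \<chi> assume \<chi>: "\<chi> \<in> characters N R"
  show "act \<one>\<^bsub>G\<^esub> \<chi> = \<chi>"
    using character_closed[OF \<chi>] character_extensional[OF \<chi>]
    by (intro extensionalityI[of _ "carrier N"])
       (auto simp: twisted_action_def one_apply \<phi>_one)
  fix \<gamma> assume \<gamma>: "\<gamma> \<in> carrier G"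
  show "act \<gamma> \<chi> \<in> characters N R" using \<gamma> \<chi> by (rule act_character)
  fix \<delta> assume \<delta>: "\<delta> \<in> carrier G"
  show "act (\<gamma> \<otimes>\<^bsub>G\<^esub> \<delta>) \<chi> = act \<gamma> (act \<delta> \<chi>)"
    using character_closed[OF \<chi>] \<gamma> \<delta>
    by (intro extensionalityI[of _ "carrier N"])
       (auto simp: twisted_action_def mult_apply \<phi>_mult G.inv_mult_group)
qed

sublocale chars: galois_set R G K "characters N R" act
  by (rule galois_set_characters)

abbreviation "A \<equiv> fixed_group_algebra R G N \<phi>"

lemma A_carrier_iff:
  "a \<in> carrier A \<longleftrightarrow> a \<in> carrier N \<rightarrow>\<^sub>E carrier R \<and> (\<forall>\<gamma>\<in>carrier G. act \<gamma> a = a)"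
  by (simp add: fixed_group_algebra_def group_algebra_def)

lemma A_ops:
  "a \<otimes>\<^bsub>A\<^esub> b = (\<lambda>\<eta>\<in>carrier N. \<Oplus>\<mu>\<in>carrier N. a \<mu> \<otimes> b (inv\<^bsub>N\<^esub> \<mu> \<otimes>\<^bsub>N\<^esub> \<eta>))"
  "\<one>\<^bsub>A\<^esub> = (\<lambda>\<eta>\<in>carrier N. if \<eta> = \<one>\<^bsub>N\<^esub> then \<one> else \<zero>)"
  "a \<oplus>\<^bsub>A\<^esub> b = (\<lambda>\<eta>\<in>carrier N. a \<eta> \<oplus> b \<eta>)"
  "k \<odot>\<^bsub>A\<^esub> a = (\<lambda>\<eta>\<in>carrier N. k \<otimes> a \<eta>)"
  by (simp_all add: fixed_group_algebra_def group_algebra_def)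

lemma fourier_extensional: "fourier a \<in> extensional (characters N R)"
  by (simp add: fourier_def)

text \<open>The convolution theorem: \<open>\<chi> \<eta>\<close> splits as
  \<open>\<chi> \<mu>\<close> times \<chi> of the argument of \<open>b\<close>, after which
  translation by the inverse of \<mu> frees the inner sum from \<mu>.\<close>

lemma fourier_mult:
  assumes a: "a \<in> carrier N \<rightarrow> carrier R" and b: "b \<in> carrier N \<rightarrow> carrier R"
  shows "fourier (a \<otimes>\<^bsub>A\<^esub> b) = fourier a \<otimes>\<^bsub>chars.M\<^esub> fourier b"
proof (intro chars.maps_eqI fourier_extensional chars.maps_ops_extensional)
  fix \<chi> assume \<chi>: "\<chi> \<in> characters N R"
  have ac: "a \<eta> \<in> carrier R" and bc: "b \<eta> \<in> carrier R" if "\<eta> \<in> carrier N" for \<eta>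
    using a b that by auto
  note \<chi>c = character_closed[OF \<chi>]
  have "fourier (a \<otimes>\<^bsub>A\<^esub> b) \<chi> =
      (\<Oplus>\<eta>\<in>carrier N. \<Oplus>\<mu>\<in>carrier N. a \<mu> \<otimes> b (inv\<^bsub>N\<^esub> \<mu> \<otimes>\<^bsub>N\<^esub> \<eta>) \<otimes> \<chi> \<eta>)"
    unfolding fourier_apply[OF \<chi>] A_ops using ac bc \<chi>c finite_N
    by (intro finsum_cong') (auto simp: finsum_ldistr intro!: finsum_closed)
  also have "\<dots> = (\<Oplus>\<mu>\<in>carrier N. \<Oplus>\<eta>\<in>carrier N. a \<mu> \<otimes> b (inv\<^bsub>N\<^esub> \<mu> \<otimes>\<^bsub>N\<^esub> \<eta>) \<otimes> \<chi> \<eta>)"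
    using ac bc \<chi>c finite_N by (intro finsum_swap) auto
  also have "\<dots> = (\<Oplus>\<mu>\<in>carrier N. a \<mu> \<otimes> \<chi> \<mu> \<otimes> fourier b \<chi>)"
  proof (intro finsum_cong' refl)
    fix \<mu> assume \<mu>: "\<mu> \<in> carrier N"
    define f where "f \<eta> = a \<mu> \<otimes> \<chi> \<mu> \<otimes> (b \<eta> \<otimes> \<chi> \<eta>)" for \<eta>
    have "(\<Oplus>\<eta>\<in>carrier N. a \<mu> \<otimes> b (inv\<^bsub>N\<^esub> \<mu> \<otimes>\<^bsub>N\<^esub> \<eta>) \<otimes> \<chi> \<eta>) =
        (\<Oplus>\<eta>\<in>carrier N. f (inv\<^bsub>N\<^esub> \<mu> \<otimes>\<^bsub>N\<^esub> \<eta>))"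
    proof (intro finsum_cong' refl)
      fix \<eta> assume \<eta>: "\<eta> \<in> carrier N"
      have "\<chi> \<eta> = \<chi> \<mu> \<otimes> \<chi> (inv\<^bsub>N\<^esub> \<mu> \<otimes>\<^bsub>N\<^esub> \<eta>)"
        using character_mult[OF \<chi> \<mu>, of "inv\<^bsub>N\<^esub> \<mu> \<otimes>\<^bsub>N\<^esub> \<eta>"] \<mu> \<eta> by (simp flip: N.m_assoc)
      then show "a \<mu> \<otimes> b (inv\<^bsub>N\<^esub> \<mu> \<otimes>\<^bsub>N\<^esub> \<eta>) \<otimes> \<chi> \<eta> = f (inv\<^bsub>N\<^esub> \<mu> \<otimes>\<^bsub>N\<^esub> \<eta>)"
        using ac bc \<chi>c \<mu> \<eta> by (simp add: f_def m_ac)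
    qed (use ac bc \<chi>c \<mu> in \<open>auto simp: f_def\<close>)
    also have "\<dots> = (\<Oplus>\<eta>\<in>carrier N. f \<eta>)"
      using ac bc \<chi>c \<mu> by (intro finsum_translate) (auto simp: f_def)
    also have "\<dots> = a \<mu> \<otimes> \<chi> \<mu> \<otimes> fourier b \<chi>"
      unfolding fourier_apply[OF \<chi>] f_def using ac bc \<chi>c \<mu> finite_N
      by (intro finsum_rdistr[symmetric]) auto
    finally show "(\<Oplus>\<eta>\<in>carrier N. a \<mu> \<otimes> b (inv\<^bsub>N\<^esub> \<mu> \<otimes>\<^bsub>N\<^esub> \<eta>) \<otimes> \<chi> \<eta>) = a \<mu> \<otimes> \<chi> \<mu> \<otimes> fourier b \<chi>" .
  qed (use ac \<chi>c fourier_closed[OF b \<chi>] in auto)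
  also have "\<dots> = fourier a \<chi> \<otimes> fourier b \<chi>"
    unfolding fourier_apply[OF \<chi>, of a] using ac \<chi>c fourier_closed[OF b \<chi>] finite_N
    by (intro finsum_ldistr[symmetric]) auto
  finally show "fourier (a \<otimes>\<^bsub>A\<^esub> b) \<chi> = (fourier a \<otimes>\<^bsub>chars.M\<^esub> fourier b) \<chi>"
    using \<chi> by (simp add: chars.maps_apply)
qed

lemma fourier_add:
  assumes a: "a \<in> carrier N \<rightarrow> carrier R" and b: "b \<in> carrier N \<rightarrow> carrier R"
  shows "fourier (a \<oplus>\<^bsub>A\<^esub> b) = fourier a \<oplus>\<^bsub>chars.M\<^esub> fourier b"
proof (intro chars.maps_eqI fourier_extensional chars.maps_ops_extensional)
  fix \<chi> assume \<chi>: "\<chi> \<in> characters N R"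
  have "fourier (a \<oplus>\<^bsub>A\<^esub> b) \<chi> = (\<Oplus>\<eta>\<in>carrier N. a \<eta> \<otimes> \<chi> \<eta> \<oplus> b \<eta> \<otimes> \<chi> \<eta>)"
    unfolding fourier_apply[OF \<chi>] A_ops using a b character_closed[OF \<chi>]
    by (intro finsum_cong') (auto simp: l_distr Pi_def)
  also have "\<dots> = fourier a \<chi> \<oplus> fourier b \<chi>"
    unfolding fourier_apply[OF \<chi>] using a b character_closed[OF \<chi>]
    by (intro finsum_addf) (auto simp: Pi_def)
  finally show "fourier (a \<oplus>\<^bsub>A\<^esub> b) \<chi> = (fourier a \<oplus>\<^bsub>chars.M\<^esub> fourier b) \<chi>"
    using \<chi> by (simp add: chars.maps_apply)
qed

lemma fourier_smult:
  assumes k: "k \<in> carrier R" and a: "a \<in> carrier N \<rightarrow> carrier R"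
  shows "fourier (k \<odot>\<^bsub>A\<^esub> a) = k \<odot>\<^bsub>chars.M\<^esub> fourier a"
proof (intro chars.maps_eqI fourier_extensional chars.maps_ops_extensional)
  fix \<chi> assume \<chi>: "\<chi> \<in> characters N R"
  have "fourier (k \<odot>\<^bsub>A\<^esub> a) \<chi> = (\<Oplus>\<eta>\<in>carrier N. k \<otimes> (a \<eta> \<otimes> \<chi> \<eta>))"
    unfolding fourier_apply[OF \<chi>] A_ops using a k character_closed[OF \<chi>]
    by (intro finsum_cong') (auto simp: m_assoc Pi_def)
  also have "\<dots> = k \<otimes> fourier a \<chi>"
    unfolding fourier_apply[OF \<chi>] using a k character_closed[OF \<chi>] finite_N
    by (intro finsum_rdistr[symmetric]) (auto simp: Pi_def)
  finally show "fourier (k \<odot>\<^bsub>A\<^esub> a) \<chi> = (k \<odot>\<^bsub>chars.M\<^esub> fourier a) \<chi>"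
    using \<chi> by (simp add: chars.maps_apply)
qed

lemma fourier_one: "fourier \<one>\<^bsub>A\<^esub> = \<one>\<^bsub>chars.M\<^esub>"
proof (intro chars.maps_eqI fourier_extensional chars.maps_ops_extensional)
  fix \<chi> assume \<chi>: "\<chi> \<in> characters N R"
  have "fourier \<one>\<^bsub>A\<^esub> \<chi> = (\<Oplus>\<eta>\<in>carrier N. if \<eta> = \<one>\<^bsub>N\<^esub> then \<chi> \<eta> else \<zero>)"
    unfolding fourier_apply[OF \<chi>] A_ops using character_closed[OF \<chi>]
    by (intro finsum_cong') auto
  also have "\<dots> = \<chi> \<one>\<^bsub>N\<^esub>"
    using character_closed[OF \<chi>] finite_N by (intro finsum_delta) auto
  finally show "fourier \<one>\<^bsub>A\<^esub> \<chi> = \<one>\<^bsub>chars.M\<^esub> \<chi>"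
    using \<chi> by (simp add: chars.maps_apply character_one)
qed

text \<open>Moving both \<open>a\<close> and \<chi> reindexes the sum by an automorphism of
  \<open>N\<close> and applies \<gamma> to each term. For \<open>a\<close> fixed by the action this
  is exactly equivariance of \<open>fourier a\<close>.\<close>

lemma fourier_act:
  assumes \<gamma>: "\<gamma> \<in> carrier G" and a: "a \<in> carrier N \<rightarrow> carrier R" and \<chi>: "\<chi> \<in> characters N R"
  shows "fourier (act \<gamma> a) (act \<gamma> \<chi>) = \<gamma> (fourier a \<chi>)"
proof -
  have ac: "a \<eta> \<in> carrier R" if "\<eta> \<in> carrier N" for \<eta> using a that by auto
  note \<chi>c = character_closed[OF \<chi>]
  define f where "f \<eta> = \<gamma> (a \<eta> \<otimes> \<chi> \<eta>)" for \<eta>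
  have "fourier (act \<gamma> a) (act \<gamma> \<chi>) = (\<Oplus>\<eta>\<in>carrier N. f (\<phi> (inv\<^bsub>G\<^esub> \<gamma>) \<eta>))"
    unfolding fourier_apply[OF act_character[OF \<gamma> \<chi>]] f_def using ac \<chi>c \<gamma>
    by (intro finsum_cong') (auto simp: act_apply aut_mult)
  also have "\<dots> = (\<Oplus>\<eta>\<in>carrier N. f \<eta>)"
    using ac \<chi>c \<gamma> by (intro finsum_\<phi>) (auto simp: f_def)
  also have "\<dots> = \<gamma> (fourier a \<chi>)"
    unfolding fourier_apply[OF \<chi>] f_def using ac \<chi>c \<gamma> by (intro aut_finsum[symmetric]) auto
  finally show ?thesis .
qed

lemma fourier_inj_on: "inj_on fourier (carrier N \<rightarrow>\<^sub>E carrier R)"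
proof (rule inj_onI)
  fix a b assume a: "a \<in> carrier N \<rightarrow>\<^sub>E carrier R" and b: "b \<in> carrier N \<rightarrow>\<^sub>E carrier R"
    and eq: "fourier a = fourier b"
  have ac: "a \<eta> \<in> carrier R" and bc: "b \<eta> \<in> carrier R" if "\<eta> \<in> carrier N" for \<eta>
    using a b that by auto
  have "fourier (\<lambda>\<eta>. a \<eta> \<ominus> b \<eta>) \<chi> = \<zero>" if \<chi>: "\<chi> \<in> characters N R" for \<chi>
  proof -
    have "fourier (\<lambda>\<eta>. a \<eta> \<ominus> b \<eta>) \<chi> = (\<Oplus>\<eta>\<in>carrier N. a \<eta> \<otimes> \<chi> \<eta> \<ominus> b \<eta> \<otimes> \<chi> \<eta>)"
      unfolding fourier_apply[OF \<chi>] using ac bc character_closed[OF \<chi>]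
      by (intro finsum_cong') (auto simp: a_minus_def l_distr l_minus)
    also have "\<dots> = fourier a \<chi> \<ominus> fourier b \<chi>"
      unfolding fourier_apply[OF \<chi>] using ac bc character_closed[OF \<chi>]
      by (intro finsum_minus) auto
    also have "\<dots> = \<zero>"
      using eq fourier_closed[of b \<chi>] bc \<chi> by (simp add: a_minus_def r_neg)
    finally show ?thesis .
  qed
  then have "a \<eta> \<ominus> b \<eta> = \<zero>" if "\<eta> \<in> carrier N" for \<eta>
    using fourier_injective[of "\<lambda>\<eta>. a \<eta> \<ominus> b \<eta>" \<eta>] ac bc that by auto
  then have "a \<eta> = b \<eta>" if "\<eta> \<in> carrier N" for \<eta>
    using ac bc that by auto
  then show "a = b" using a b by (intro PiE_ext[of a "carrier N" _ b]) auto
qed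

text \<open>The direction to \<open>A\<close> writes a given \<chi> as
  \<open>act \<gamma> \<psi>\<close>: equivariance then shows that \<open>act \<gamma> a\<close> and
  \<open>a\<close> have the same transform, and injectivity makes them equal. The other direction is
  \<open>fourier_act\<close>.\<close>

lemma fourier_in_maps_iff:
  assumes a: "a \<in> carrier N \<rightarrow>\<^sub>E carrier R"
  shows "fourier a \<in> carrier chars.M \<longleftrightarrow> a \<in> carrier A"
proof
  have ac: "a \<eta> \<in> carrier R" if "\<eta> \<in> carrier N" for \<eta> using a that by auto
  have aP: "a \<in> carrier N \<rightarrow> carrier R" using a by auto
  {
    assume F: "fourier a \<in> carrier chars.M"
    have "act \<gamma> a = a" if \<gamma>: "\<gamma> \<in> carrier G" for \<gamma>
    proof (rule inj_onD[OF fourier_inj_on _ _ a])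
      show "act \<gamma> a \<in> carrier N \<rightarrow>\<^sub>E carrier R" using \<gamma> ac by (auto simp: twisted_action_def)
      show "fourier (act \<gamma> a) = fourier a"
      proof (intro chars.maps_eqI fourier_extensional)
        fix \<chi> assume \<chi>: "\<chi> \<in> characters N R"
        define \<psi> where "\<psi> = act (inv\<^bsub>G\<^esub> \<gamma>) \<chi>"
        have \<psi>: "\<psi> \<in> characters N R" unfolding \<psi>_def using \<gamma> \<chi> by (simp add: act_character)
        have \<chi>\<psi>: "\<chi> = act \<gamma> \<psi>" unfolding \<psi>_def using chars.act_inv(1)[OF \<gamma> \<chi>] by simp
        show "fourier (act \<gamma> a) \<chi> = fourier a \<chi>"
          unfolding \<chi>\<psi> using fourier_act[OF \<gamma> aP \<psi>] chars.maps_equivariant[OF F \<gamma> \<psi>] by simp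
      qed
    qed
    then show "a \<in> carrier A" using a by (simp add: A_carrier_iff)
  next
    assume A: "a \<in> carrier A"
    have "fourier a (act \<gamma> \<chi>) = \<gamma> (fourier a \<chi>)" if "\<gamma> \<in> carrier G" "\<chi> \<in> characters N R" for \<gamma> \<chi>
      using fourier_act[OF that(1) aP that(2)] A that by (simp add: A_carrier_iff)
    then show "fourier a \<in> carrier chars.M"
      using fourier_closed[OF aP] fourier_extensional by (auto simp: chars.maps_carrier_iff PiE_iff)
  }
qed

theorem fixed_algebra_isomorphic_maps: "isomorphic_algebras K A chars.M"
proof -
  have sub: "carrier A \<subseteq> carrier N \<rightarrow>\<^sub>E carrier R" by (auto simp: A_carrier_iff)
  then have sub': "a \<in> carrier N \<rightarrow> carrier R" if "a \<in> carrier A" for a using that by blast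
  have "fourier \<in> ring_hom A chars.M"
  proof (rule ring_hom_memI)
    show "fourier a \<in> carrier chars.M" if "a \<in> carrier A" for a
      using fourier_in_maps_iff sub that by blast
  qed (simp_all add: fourier_mult fourier_add fourier_one sub')
  moreover have "bij_betw fourier (carrier A) (carrier chars.M)"
  proof (rule bij_betw_imageI)
    show "inj_on fourier (carrier A)" by (rule inj_on_subset[OF fourier_inj_on sub])
    show "fourier ` carrier A = carrier chars.M"
    proof
      show "fourier ` carrier A \<subseteq> carrier chars.M" using fourier_in_maps_iff sub by blast
      show "carrier chars.M \<subseteq> fourier ` carrier A"
      proof
        fix b assume b: "b \<in> carrier chars.M"
        then have "b \<in> characters N R \<rightarrow>\<^sub>E carrier R" by (simp add: chars.maps_carrier_iff)
        then obtain a where a: "a \<in> carrier N \<rightarrow>\<^sub>E carrier R" "fourier a = b" by (rule fourier_surj)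
        then show "b \<in> fourier ` carrier A" using fourier_in_maps_iff[OF a(1)] b by blast
      qed
    qed
  qed
  ultimately show ?thesis
    using fourier_smult K_sub sub' by (auto simp: isomorphic_algebras_def ring_iso_def)
qed

end

text \<open>Closure is pulled back from the equivariant maps through
  \<open>fourier_in_maps_iff\<close>, which spares computing the twisted action on a convolution. It
  is what allows the Fourier isomorphism to be inverted.\<close>

lemma (in galois_module) fixed_algebra_closed:
  "a \<in> carrier A \<Longrightarrow> b \<in> carrier A \<Longrightarrow> a \<otimes>\<^bsub>A\<^esub> b \<in> carrier A"
  "a \<in> carrier A \<Longrightarrow> b \<in> carrier A \<Longrightarrow> a \<oplus>\<^bsub>A\<^esub> b \<in> carrier A"
  "\<one>\<^bsub>A\<^esub> \<in> carrier A"
  "k \<in> K \<Longrightarrow> a \<in> carrier A \<Longrightarrow> k \<odot>\<^bsub>A\<^esub> a \<in> carrier A"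
proof -
  have sub: "a \<in> carrier N \<rightarrow>\<^sub>E carrier R" if "a \<in> carrier A" for a
    using that by (simp add: A_carrier_iff)
  have c: "a \<eta> \<in> carrier R" if "a \<in> carrier A" "\<eta> \<in> carrier N" for a \<eta>
    using sub[OF that(1)] that(2) by auto
  have F: "fourier a \<in> carrier chars.M" if "a \<in> carrier A" for a
    using that fourier_in_maps_iff[OF sub] by blast
  show "a \<otimes>\<^bsub>A\<^esub> b \<in> carrier A" if "a \<in> carrier A" "b \<in> carrier A"
  proof (subst fourier_in_maps_iff[symmetric])
    show "a \<otimes>\<^bsub>A\<^esub> b \<in> carrier N \<rightarrow>\<^sub>E carrier R"
      using c[OF that(1)] c[OF that(2)] by (auto simp: A_ops intro!: finsum_closed)
    show "fourier (a \<otimes>\<^bsub>A\<^esub> b) \<in> carrier chars.M"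
      using fourier_mult[of a b] chars.maps_ops_closed(1)[OF F F] that c by auto
  qed
  show "a \<oplus>\<^bsub>A\<^esub> b \<in> carrier A" if "a \<in> carrier A" "b \<in> carrier A"
  proof (subst fourier_in_maps_iff[symmetric])
    show "a \<oplus>\<^bsub>A\<^esub> b \<in> carrier N \<rightarrow>\<^sub>E carrier R"
      using c[OF that(1)] c[OF that(2)] by (auto simp: A_ops)
    show "fourier (a \<oplus>\<^bsub>A\<^esub> b) \<in> carrier chars.M"
      using fourier_add[of a b] chars.maps_ops_closed(2)[OF F F] that c by auto
  qed
  show "\<one>\<^bsub>A\<^esub> \<in> carrier A"
  proof (subst fourier_in_maps_iff[symmetric])
    show "\<one>\<^bsub>A\<^esub> \<in> carrier N \<rightarrow>\<^sub>E carrier R" by (auto simp: A_ops)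
    show "fourier \<one>\<^bsub>A\<^esub> \<in> carrier chars.M" using fourier_one chars.maps_ops_closed(3) by simp
  qed
  show "k \<odot>\<^bsub>A\<^esub> a \<in> carrier A" if "k \<in> K" "a \<in> carrier A"
  proof (subst fourier_in_maps_iff[symmetric])
    show "k \<odot>\<^bsub>A\<^esub> a \<in> carrier N \<rightarrow>\<^sub>E carrier R"
      using c[OF that(2)] that(1) K_sub by (auto simp: A_ops)
    show "fourier (k \<odot>\<^bsub>A\<^esub> a) \<in> carrier chars.M"
      using fourier_smult[of k a] chars.maps_ops_closed(4)[OF _ F] that c K_sub by auto
  qed
qed

theorem isomorphic_fixed_algebras_iff_isomorphic_characters:
  assumes "galois_module R G K N\<^sub>1 e \<zeta> \<phi>\<^sub>1" "galois_module R G K N\<^sub>2 e' \<zeta>' \<phi>\<^sub>2"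
  shows "isomorphic_algebras K (fixed_group_algebra R G N\<^sub>1 \<phi>\<^sub>1) (fixed_group_algebra R G N\<^sub>2 \<phi>\<^sub>2) \<longleftrightarrow>
    isomorphic_gsets G (characters N\<^sub>1 R) (twisted_action G N\<^sub>1 \<phi>\<^sub>1) (characters N\<^sub>2 R) (twisted_action G N\<^sub>2 \<phi>\<^sub>2)"
proof -
  interpret A1: galois_module R G K N\<^sub>1 e \<zeta> \<phi>\<^sub>1 by fact
  interpret A2: galois_module R G K N\<^sub>2 e' \<zeta>' \<phi>\<^sub>2 by fact
  have iso: "isomorphic_algebras K A1.chars.M A1.A" "isomorphic_algebras K A2.chars.M A2.A"
    by (rule isomorphic_algebras_sym[OF A1.fixed_algebra_isomorphic_maps A1.fixed_algebra_closed];
        assumption)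
       (rule isomorphic_algebras_sym[OF A2.fixed_algebra_isomorphic_maps A2.fixed_algebra_closed];
        assumption)
  have "isomorphic_algebras K A1.A A2.A \<longleftrightarrow> isomorphic_algebras K A1.chars.M A2.chars.M"
    using isomorphic_algebras_trans[OF iso(1)] isomorphic_algebras_trans[OF _ iso(2)]
      isomorphic_algebras_trans[OF A1.fixed_algebra_isomorphic_maps]
      isomorphic_algebras_trans[OF _ A2.fixed_algebra_isomorphic_maps] by blast
  also have "\<dots> \<longleftrightarrow> isomorphic_gsets G (characters N\<^sub>1 R) A1.act (characters N\<^sub>2 R) A2.act"
    by (rule isomorphic_maps_iff_isomorphic_gsets[OF A1.galois_set_characters A2.galois_set_characters
          A1.char0])
  finally show ?thesis .
qed

section \<open>Adjoining a root of unity to a Galois extension\<close>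

text \<open>The library bounds the roots counted with multiplicity; forgetting multiplicities only
  lowers the number. The zero polynomial is covered because \<open>is_root\<close> excludes
  it.\<close>

lemma (in field) card_roots_le_degree:
  assumes p: "p \<in> carrier (poly_ring R)"
  shows "finite {x. is_root p x}" "card {x. is_root p x} \<le> degree p"
proof -
  have eq: "{x. is_root p x} = set_mset (roots p)" using roots_mem_iff_is_root[OF p] by auto
  have "card (set_mset M) \<le> size M" for M :: "'a multiset"
    by (induction M) (auto simp: card_insert_if)
  from le_trans[OF this size_roots_le_degree[OF p]]
  show "finite {x. is_root p x}" "card {x. is_root p x} \<le> degree p"
    by (simp_all add: eq)
qed

lemma (in ring) coeff_in_subring:
  assumes "subring F R" "set p \<subseteq> F"
  shows "coeff p i \<in> F"
  using ring.coeff_in_carrier[OF subring_is_ring[OF assms(1)], of p i] assms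
  by (simp add: coeff_consistent[OF assms(1)])

locale root_extension = field R for R :: "('a, 'b) ring_scheme" (structure) +
  fixes F :: "'a set" and e :: nat and \<zeta> :: 'a
  assumes F: "subfield F R" and primitive: "primitive_root_of_unity R e \<zeta>"
begin

lemma e_pos: "e > 0" and \<zeta>_closed: "\<zeta> \<in> carrier R" and \<zeta>_e: "\<zeta> [^] e = \<one>"
  and \<zeta>_less: "0 < m \<Longrightarrow> m < e \<Longrightarrow> \<zeta> [^] m \<noteq> \<one>" for m
  using primitive by (auto simp: primitive_root_of_unity_def)

lemma F_subring: "subring F R" by (rule subfieldE(1)[OF F])
lemma F_sub: "F \<subseteq> carrier R" by (rule subfieldE(3)[OF F])

lemma \<zeta>_algebraic: "(algebraic over F) \<zeta>"
  using algebraicI[OF unity_poly_carrier[OF F_subring, of e]] eval_unity_poly[OF e_pos \<zeta>_closed] \<zeta>_e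
  by (simp add: unity_poly_def a_minus_def r_neg)

abbreviation "m \<equiv> Irr F \<zeta>"
abbreviation "E' \<equiv> simple_extension F \<zeta>"
text \<open>Conjugates of \<zeta> are sought only among its powers: these lie in \<open>E'\<close>,
  and there are exactly \<open>e\<close> of them, as many as the degree of
  \<open>X^e - 1\<close>.\<close>

abbreviation "Z \<equiv> (\<lambda>j::nat. \<zeta> [^] j) ` {..<e}"

lemmas m_carrier = IrrE(1)[OF F \<zeta>_closed \<zeta>_algebraic]
  and m_irreducible = IrrE(2)[OF F \<zeta>_closed \<zeta>_algebraic]
  and m_root = IrrE(4)[OF F \<zeta>_closed \<zeta>_algebraic]

lemma m_nonzero: "m \<noteq> []"
  using pirreducible_degree[OF F m_carrier m_irreducible] by auto

lemma E'_subfield: "subfield E' R"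
  using simple_extension_is_subfield[OF F \<zeta>_closed] \<zeta>_algebraic by simp

lemma E'_subring: "subring E' R" by (rule subfieldE(1)[OF E'_subfield])

lemma E'_sub: "E' \<subseteq> carrier R" by (rule subfieldE(3)[OF E'_subfield])

lemma F_sub_E': "F \<subseteq> E'"
  by (rule simple_extension_incl[OF F_sub \<zeta>_closed])

lemma \<zeta>_in_E': "\<zeta> \<in> E'"
  by (rule simple_extension_mem[OF F_subring \<zeta>_closed])

lemma E'_eval: "E' = (\<lambda>p. eval p \<zeta>) ` carrier (F[X])"
  by (rule simple_extension_as_eval_img[OF F_sub \<zeta>_closed])

lemma poly_set: "p \<in> carrier (F[X]) \<Longrightarrow> set p \<subseteq> F"
  using polynomial_incl[of F p] by (simp add: univ_poly_carrier)

lemma pow_in_E': "x \<in> E' \<Longrightarrow> x [^] (n::nat) \<in> E'"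
  by (induction n) (use subringE(3,6)[OF E'_subring] in auto)

lemma Z_sub: "Z \<subseteq> E'"
  using pow_in_E'[OF \<zeta>_in_E'] by auto

lemma \<zeta>_pow_mod: "\<zeta> [^] (n::nat) \<in> Z"
proof -
  have "\<zeta> [^] n = \<zeta> [^] (e * (n div e) + n mod e)" by simp
  also have "\<dots> = (\<zeta> [^] e) [^] (n div e) \<otimes> \<zeta> [^] (n mod e)"
    using \<zeta>_closed by (simp only: nat_pow_mult nat_pow_pow)
  also have "\<dots> = \<zeta> [^] (n mod e)" using \<zeta>_closed by (simp add: \<zeta>_e)
  finally show ?thesis using e_pos by auto
qed

lemma pow_injective:
  assumes "x \<in> carrier R" "\<And>n. 0 < n \<Longrightarrow> n < e \<Longrightarrow> x [^] n \<noteq> \<one>" "x \<noteq> \<zero>"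
  shows "inj_on (\<lambda>j::nat. x [^] j) {..<e}"
proof (rule linorder_inj_onI)
  fix i j :: nat assume ij: "i < j" "i \<in> {..<e}" "j \<in> {..<e}"
  show "x [^] i \<noteq> x [^] j"
  proof
    assume eq: "x [^] i = x [^] j"
    have "x [^] i \<otimes> x [^] (j - i) = x [^] i \<otimes> \<one>"
      unfolding nat_pow_mult[OF assms(1)] using ij assms(1) eq by simp
    moreover have "x [^] i \<noteq> \<zero>"
      using assms by (induction i) (auto simp: integral_iff)
    ultimately have "x [^] (j - i) = \<one>" using assms(1) m_lcancel[of "x [^] i"] by blast
    moreover have "0 < j - i" "j - i < e" using ij by auto
    ultimately show False using assms(2) by blast
  qed
qed auto

lemma \<zeta>_nonzero: "\<zeta> \<noteq> \<zero>"
  using \<zeta>_e e_pos by (metis nat_pow_zero zero_not_one not_gr_zero)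

lemma card_Z: "card Z = e"
  using card_image[OF pow_injective[OF \<zeta>_closed \<zeta>_less \<zeta>_nonzero]] by simp

lemma Z_root_of_unity: "z \<in> Z \<Longrightarrow> z [^] e = \<one>"
proof -
  assume "z \<in> Z"
  then obtain j where "z = \<zeta> [^] (j::nat)" by auto
  then have "z [^] e = (\<zeta> [^] e) [^] j" using \<zeta>_closed by (simp add: nat_pow_pow mult.commute)
  then show ?thesis using \<zeta>_e by simp
qed

end

text \<open>Here \<sigma> is a surjective endomorphism of \<open>F\<close> and need not be
  extensional, so that the plain identity function is an instance alongside the elements of the
  Galois group.\<close>

locale root_extension_aut = root_extension +
  fixes \<sigma> :: "'a \<Rightarrow> 'a"
  assumes \<sigma>_hom: "\<sigma> \<in> ring_hom (R \<lparr> carrier := F \<rparr>) (R \<lparr> carrier := F \<rparr>)" and \<sigma>_surj: "\<sigma> ` F = F"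
begin

lemma \<sigma>_closed: "a \<in> F \<Longrightarrow> \<sigma> a \<in> F"
  using ring_hom_closed[OF \<sigma>_hom] by simp

lemma \<sigma>_hom_R: "\<sigma> \<in> ring_hom (R \<lparr> carrier := F \<rparr>) R"
  using \<sigma>_hom F_sub by (auto simp: ring_hom_def Pi_def)

lemma F_field: "field (R \<lparr> carrier := F \<rparr>)"
  by (rule subfield_iff(2)[OF F])

sublocale \<sigma>: ring_hom_ring "R \<lparr> carrier := F \<rparr>" R \<sigma>
  by (rule ring_hom_ringI2[OF subring_is_ring[OF F_subring] ring_axioms \<sigma>_hom_R])

lemma map_set: "p \<in> carrier (F[X]) \<Longrightarrow> set (map \<sigma> p) \<subseteq> carrier R"
  using poly_set \<sigma>_closed F_sub by fastforce

lemma map_carrier: "p \<in> carrier (F[X]) \<Longrightarrow> map \<sigma> p \<in> carrier (poly_ring R)"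
  using polynomial_hom[OF \<sigma>_hom_R F_field field_axioms] by (simp add: univ_poly_consistent[OF F_subring])

text \<open>Applying \<sigma> to a product of coefficient lists gives the product of the images only
  after \<open>normalize\<close>, so the equality is stated for values, which do not see leading
  zeros.\<close>

lemma eval_map_mult:
  assumes p: "p \<in> carrier (F[X])" and q: "q \<in> carrier (F[X])" and w: "w \<in> carrier R"
  shows "eval (map \<sigma> (p \<otimes>\<^bsub>F[X]\<^esub> q)) w = eval (map \<sigma> p) w \<otimes> eval (map \<sigma> q) w"
proof -
  have pq: "p \<otimes>\<^bsub>F[X]\<^esub> q \<in> carrier (F[X])"
    using p q ring.ring_simprules(5)[OF univ_poly_is_ring[OF F_subring]] by blast
  have "normalize (map \<sigma> (poly_mult p q)) = poly_mult (map \<sigma> p) (map \<sigma> q)"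
    using \<sigma>.poly_mult_hom'[of p q] poly_set[OF p] poly_set[OF q]
    by (simp add: poly_mult_consistent[OF F_subring])
  then show ?thesis
    using eval_normalize[OF map_set[OF pq] w] eval_poly_mult[OF map_set[OF p] map_set[OF q] w]
    by (simp add: univ_poly_mult)
qed

lemma eval_map_add:
  assumes p: "p \<in> carrier (F[X])" and q: "q \<in> carrier (F[X])" and w: "w \<in> carrier R"
  shows "eval (map \<sigma> (p \<oplus>\<^bsub>F[X]\<^esub> q)) w = eval (map \<sigma> p) w \<oplus> eval (map \<sigma> q) w"
proof -
  have pq: "p \<oplus>\<^bsub>F[X]\<^esub> q \<in> carrier (F[X])"
    using p q ring.ring_simprules(1)[OF univ_poly_is_ring[OF F_subring]] by blast
  have "normalize (map \<sigma> (poly_add p q)) = poly_add (map \<sigma> p) (map \<sigma> q)"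
    using \<sigma>.poly_add_hom'[of p q] poly_set[OF p] poly_set[OF q]
    by (simp add: poly_add_consistent[OF F_subring] del: poly_add.simps)
  then show ?thesis
    using eval_normalize[OF map_set[OF pq] w] eval_poly_add[OF map_set[OF p] map_set[OF q] w]
    by (simp add: univ_poly_add del: poly_add.simps)
qed

text \<open>The possible images of \<zeta> under a lift of \<sigma>: such an image must be a root of
  the polynomial obtained from the minimal polynomial by applying \<sigma> to its
  coefficients.\<close>

definition conjugates :: "'a set" where
  "conjugates = {w \<in> Z. eval (map \<sigma> m) w = \<zero>}"

lemma m_divides:
  assumes p: "p \<in> carrier (F[X])" and "eval p \<zeta> = \<zero>"
  obtains q where "q \<in> carrier (F[X])" "p = m \<otimes>\<^bsub>F[X]\<^esub> q"
proof -
  have "m pdivides p" using Irr_minimal[OF F \<zeta>_closed \<zeta>_algebraic] assms by auto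
  then have "m divides\<^bsub>F[X]\<^esub> p" using pdivides_iff_shell[OF F m_carrier p] by simp
  then show thesis using that by (auto simp: factor_def)
qed

text \<open>Write \<open>X^e - 1 = m q\<close>. Its coefficients are fixed by \<sigma>, so each of
  the \<open>e\<close> elements of \<open>Z\<close> is a root of \<open>\<sigma>(m)\<close> or of
  \<open>\<sigma>(q)\<close>. The latter accounts for at most \<open>degree q = e - degree m\<close>
  of them.\<close>

lemma card_conjugates: "degree m \<le> card conjugates"
proof -
  have U: "unity_poly e \<in> carrier (F[X])" by (rule unity_poly_carrier[OF F_subring])
  have "eval (unity_poly e) \<zeta> = \<zero>"
    using eval_unity_poly[OF e_pos \<zeta>_closed] \<zeta>_e by (simp add: a_minus_def r_neg)
  then obtain q where q: "q \<in> carrier (F[X])" and Uq: "unity_poly e = m \<otimes>\<^bsub>F[X]\<^esub> q"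
    using m_divides[OF U] by blast
  have qn: "q \<noteq> []"
  proof
    assume "q = []"
    then have "unity_poly e = []" using Uq poly_mult_zero(2)[OF polynomial_in_carrier[OF F_subring, of m]] m_carrier
      by (simp add: univ_poly_mult univ_poly_carrier)
    then show False by (simp add: unity_poly_def)
  qed
  have "degree (unity_poly e) = e" using e_pos by (simp add: unity_poly_def)
  then have deg: "e = degree m + degree q"
    using poly_mult_degree_eq[OF F_subring, of m q] m_carrier q Uq qn m_nonzero e_pos
    by (simp add: univ_poly_carrier univ_poly_mult flip: Uq)
  have F1: "\<one> \<in> F" "\<ominus> \<one> \<in> F" using subringE(3,5)[OF F_subring] by auto
  have \<sigma>1: "\<sigma> \<one> = \<one>" "\<sigma> \<zero> = \<zero>" using \<sigma>.hom_one \<sigma>.hom_zero by auto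
  have "\<sigma> (\<ominus> \<one>) \<oplus> \<one> = \<sigma> (\<ominus> \<one> \<oplus> \<one>)" using \<sigma>.hom_add[of "\<ominus> \<one>" \<one>] F1 \<sigma>1 by simp
  then have "\<sigma> (\<ominus> \<one>) = \<ominus> \<one>"
    using minus_equality[of "\<sigma> (\<ominus> \<one>)" \<one>] \<sigma>1 \<sigma>_closed[OF F1(2)] F_sub by (auto simp: l_neg)
  then have mapU: "map \<sigma> (unity_poly e) = unity_poly e"
    using \<sigma>1 by (simp add: unity_poly_def)
  have "Z \<subseteq> conjugates \<union> {x. is_root (map \<sigma> q) x}"
  proof
    fix z assume z: "z \<in> Z"
    then have zc: "z \<in> carrier R" using Z_sub E'_sub by auto
    have "eval (map \<sigma> m) z \<otimes> eval (map \<sigma> q) z = eval (unity_poly e) z"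
      using eval_map_mult[OF m_carrier q zc] mapU Uq by simp
    also have "\<dots> = \<zero>"
      using eval_unity_poly[OF e_pos zc] Z_root_of_unity[OF z] by (simp add: a_minus_def r_neg)
    finally have "eval (map \<sigma> m) z = \<zero> \<or> eval (map \<sigma> q) z = \<zero>"
      using integral eval_in_carrier[OF map_set[OF m_carrier] zc] eval_in_carrier[OF map_set[OF q] zc]
      by blast
    then show "z \<in> conjugates \<union> {x. is_root (map \<sigma> q) x}"
      using z zc qn by (auto simp: conjugates_def is_root_def)
  qed
  then have "card Z \<le> card (conjugates \<union> {x. is_root (map \<sigma> q) x})"
    using card_roots_le_degree(1)[OF map_carrier[OF q]] by (intro card_mono) (auto simp: conjugates_def)
  also have "\<dots> \<le> card conjugates + card {x. is_root (map \<sigma> q) x}" by (rule card_Un_le)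
  also have "\<dots> \<le> card conjugates + degree q"
    using card_roots_le_degree(2)[OF map_carrier[OF q]] by simp
  finally show ?thesis using deg card_Z by simp
qed

end

section \<open>Lifting an automorphism to the simple extension\<close>

context root_extension_aut
begin

text \<open>The lift of \<sigma> that sends \<zeta> to \<open>w\<close>. An arbitrary polynomial
  representing \<open>x\<close> is chosen; \<open>eval_map_eqI\<close> shows that the choice does
  not matter when \<open>w\<close> is a conjugate. The restriction to \<open>E'\<close> matches the
  extensional form of Galois group elements.\<close>

definition extension :: "'a \<Rightarrow> 'a \<Rightarrow> 'a" where
  "extension w = (\<lambda>x\<in>E'. eval (map \<sigma> (SOME p. p \<in> carrier (F[X]) \<and> eval p \<zeta> = x)) w)"

context
  fixes w assumes w: "w \<in> conjugates"
begin

lemma w_in_E': "w \<in> E'" using w Z_sub by (auto simp: conjugates_def)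

lemma w_closed: "w \<in> carrier R" using w_in_E' E'_sub by auto

text \<open>The difference of \<open>p\<close> and \<open>q\<close> vanishes at \<zeta>, so it is a
  multiple of \<open>m\<close>, and \<open>\<sigma>(m)\<close> vanishes at \<open>w\<close>.\<close>

lemma eval_map_eqI:
  assumes p: "p \<in> carrier (F[X])" and q: "q \<in> carrier (F[X])" and eq: "eval p \<zeta> = eval q \<zeta>"
  shows "eval (map \<sigma> p) w = eval (map \<sigma> q) w"
proof -
  interpret P: ring "F[X]" by (rule univ_poly_is_ring[OF F_subring])
  interpret h: ring_hom_ring "F[X]" R "\<lambda>p. eval p \<zeta>" by (rule eval_ring_hom[OF F_subring \<zeta>_closed])
  have d: "p \<ominus>\<^bsub>F[X]\<^esub> q \<in> carrier (F[X])" using p q by simp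
  have "p = (p \<ominus>\<^bsub>F[X]\<^esub> q) \<oplus>\<^bsub>F[X]\<^esub> q"
    using p q by (simp add: P.minus_eq P.a_assoc P.l_neg)
  moreover have "eval (p \<ominus>\<^bsub>F[X]\<^esub> q) \<zeta> = \<zero>"
  proof -
    have "eval (p \<ominus>\<^bsub>F[X]\<^esub> q) \<zeta> \<oplus> eval q \<zeta> = eval p \<zeta>"
      using h.hom_add[OF d q] \<open>p = _\<close> by simp
    then have "eval (p \<ominus>\<^bsub>F[X]\<^esub> q) \<zeta> \<oplus> eval q \<zeta> = \<zero> \<oplus> eval q \<zeta>" using eq h.hom_closed[OF q] by simp
    then show ?thesis using h.hom_closed[OF d] h.hom_closed[OF q] add.right_cancel zero_closed by blast
  qed
  then obtain r where r: "r \<in> carrier (F[X])" "p \<ominus>\<^bsub>F[X]\<^esub> q = m \<otimes>\<^bsub>F[X]\<^esub> r"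
    using m_divides[OF d] by blast
  ultimately have "eval (map \<sigma> p) w = eval (map \<sigma> ((m \<otimes>\<^bsub>F[X]\<^esub> r) \<oplus>\<^bsub>F[X]\<^esub> q)) w" by simp
  also have "\<dots> = eval (map \<sigma> m) w \<otimes> eval (map \<sigma> r) w \<oplus> eval (map \<sigma> q) w"
    using eval_map_add[OF _ q w_closed] eval_map_mult[OF m_carrier r(1) w_closed] m_carrier r(1) by simp
  also have "\<dots> = eval (map \<sigma> q) w"
    using w eval_in_carrier[OF map_set[OF q] w_closed] eval_in_carrier[OF map_set[OF r(1)] w_closed]
    by (simp add: conjugates_def)
  finally show ?thesis .
qed

lemma extension_eval:
  assumes p: "p \<in> carrier (F[X])"
  shows "extension w (eval p \<zeta>) = eval (map \<sigma> p) w"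
proof -
  have x: "eval p \<zeta> \<in> E'" using p by (auto simp: E'_eval)
  define q where "q = (SOME q. q \<in> carrier (F[X]) \<and> eval q \<zeta> = eval p \<zeta>)"
  have "q \<in> carrier (F[X]) \<and> eval q \<zeta> = eval p \<zeta>"
    unfolding q_def by (rule someI[of _ p]) (simp add: p)
  then have "eval (map \<sigma> q) w = eval (map \<sigma> p) w" using eval_map_eqI[OF _ p] by blast
  then show ?thesis using x by (simp add: extension_def q_def)
qed

lemma extension_F:
  assumes a: "a \<in> F"
  shows "extension w a = \<sigma> a"
\<comment> \<open>Polynomials have a nonzero leading coefficient, so the constant zero is
  represented by \<open>[]\<close> and not by \<open>[a]\<close>.\<close>
proof (cases "a = \<zero>")
  case True
  have "[] \<in> carrier (F[X])" by auto
  from extension_eval[OF this] show ?thesis using True \<sigma>.hom_zero by simp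
next
  case False
  have "[a] \<in> carrier (F[X])" using a False by (auto simp: polynomial_def simp flip: univ_poly_carrier)
  from extension_eval[OF this] show ?thesis
    using a F_sub \<sigma>_closed[OF a] w_closed \<zeta>_closed by auto
qed

lemma extension_\<zeta>: "extension w \<zeta> = w"
proof -
  have "[\<one>, \<zero>] \<in> carrier (F[X])"
    using subringE(2,3)[OF F_subring] by (auto simp: polynomial_def simp flip: univ_poly_carrier)
  from extension_eval[OF this] show ?thesis
    using \<zeta>_closed w_closed \<sigma>.hom_one \<sigma>.hom_zero by simp
qed

lemma extension_hom: "extension w \<in> ring_hom (R \<lparr> carrier := E' \<rparr>) (R \<lparr> carrier := E' \<rparr>)"
proof (rule ring_hom_memI)
  interpret P: ring "F[X]" by (rule univ_poly_is_ring[OF F_subring])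
  interpret h: ring_hom_ring "F[X]" R "\<lambda>p. eval p \<zeta>" by (rule eval_ring_hom[OF F_subring \<zeta>_closed])
  fix x assume "x \<in> carrier (R \<lparr> carrier := E' \<rparr>)"
  then obtain p where p: "p \<in> carrier (F[X])" "x = eval p \<zeta>" by (auto simp: E'_eval)
  have "set (map \<sigma> p) \<subseteq> E'" using poly_set[OF p(1)] \<sigma>_closed F_sub_E' by fastforce
  then have "eval (map \<sigma> p) w \<in> E'"
    using ring.eval_in_carrier[OF subring_is_ring[OF E'_subring], of "map \<sigma> p" w] w_in_E'
    by (simp add: eval_consistent[OF E'_subring])
  then show "extension w x \<in> carrier (R \<lparr> carrier := E' \<rparr>)"
    using extension_eval[OF p(1)] p(2) by simp
  fix y assume "y \<in> carrier (R \<lparr> carrier := E' \<rparr>)"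
  then obtain q where q: "q \<in> carrier (F[X])" "y = eval q \<zeta>" by (auto simp: E'_eval)
  show "extension w (x \<otimes>\<^bsub>R \<lparr> carrier := E' \<rparr>\<^esub> y) = extension w x \<otimes>\<^bsub>R \<lparr> carrier := E' \<rparr>\<^esub> extension w y"
    using h.hom_mult[OF p(1) q(1)] extension_eval[OF P.m_closed[OF p(1) q(1)]]
      extension_eval[OF p(1)] extension_eval[OF q(1)] eval_map_mult[OF p(1) q(1) w_closed] p(2) q(2)
    by simp
  show "extension w (x \<oplus>\<^bsub>R \<lparr> carrier := E' \<rparr>\<^esub> y) = extension w x \<oplus>\<^bsub>R \<lparr> carrier := E' \<rparr>\<^esub> extension w y"
    using h.hom_add[OF p(1) q(1)] extension_eval[OF P.a_closed[OF p(1) q(1)]]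
      extension_eval[OF p(1)] extension_eval[OF q(1)] eval_map_add[OF p(1) q(1) w_closed] p(2) q(2)
    by simp
next
  show "extension w \<one>\<^bsub>R \<lparr> carrier := E' \<rparr>\<^esub> = \<one>\<^bsub>R \<lparr> carrier := E' \<rparr>\<^esub>"
    using extension_F[of \<one>] subringE(3)[OF F_subring] \<sigma>.hom_one by simp
qed

text \<open>A homomorphism of fields is injective, so the powers of \<open>w\<close>, being images
  of the powers of \<zeta>, are \<open>e\<close> distinct elements of \<open>Z\<close> and exhaust
  it. Hence \<zeta> is a power of \<open>w\<close> and lies in the image, a subring that also
  contains \<open>F\<close> because \<sigma> is onto.\<close>

lemma extension_bij: "bij_betw (extension w) E' E'"
proof -
  let ?R' = "R \<lparr> carrier := E' \<rparr>"
  have fld: "field ?R'" by (rule subfield_iff(2)[OF E'_subfield])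
  interpret R': field ?R' by (rule fld)
  interpret t: ring_hom_ring ?R' ?R' "extension w"
    by (rule ring_hom_ringI2[OF R'.ring_axioms R'.ring_axioms extension_hom])
  have inj: "inj_on (extension w) E'"
    using non_trivial_field_hom_is_inj[OF extension_hom fld fld] by simp
  have pow: "extension w (\<zeta> [^] (n::nat)) = w [^] n" for n
    using t.hom_nat_pow[of \<zeta> n] \<zeta>_in_E' extension_\<zeta> by (simp add: nat_pow_def)
  have "inj_on (\<lambda>j::nat. w [^] j) {..<e}"
  proof (rule inj_onI)
    fix i j assume ij: "i \<in> {..<e}" "j \<in> {..<e}" "w [^] i = w [^] j"
    then have "\<zeta> [^] i = \<zeta> [^] j"
      using inj_onD[OF inj, of "\<zeta> [^] i" "\<zeta> [^] j"] pow pow_in_E'[OF \<zeta>_in_E'] by simp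
    then show "i = j" using inj_onD[OF pow_injective[OF \<zeta>_closed \<zeta>_less \<zeta>_nonzero]] ij by blast
  qed
  then have "card ((\<lambda>j::nat. w [^] j) ` {..<e}) = card Z" by (simp add: card_image card_Z)
  moreover have "(\<lambda>j::nat. w [^] j) ` {..<e} \<subseteq> Z"
  proof -
    obtain k :: nat where "w = \<zeta> [^] k" using w by (auto simp: conjugates_def)
    then show ?thesis using \<zeta>_pow_mod \<zeta>_closed by (auto simp: nat_pow_pow)
  qed
  ultimately have "(\<lambda>j::nat. w [^] j) ` {..<e} = Z" by (intro card_subset_eq) auto
  moreover have "\<zeta> \<in> Z" using \<zeta>_pow_mod[of 1] \<zeta>_closed by simp
  ultimately obtain j :: nat where "\<zeta> = w [^] j" by auto
  then have "\<zeta> \<in> extension w ` E'" using pow pow_in_E'[OF \<zeta>_in_E'] by (intro image_eqI[of _ _ "\<zeta> [^] j"]) auto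
  moreover have "F \<subseteq> extension w ` E'"
  proof
    fix a assume "a \<in> F"
    then obtain b where "b \<in> F" "a = \<sigma> b" using \<sigma>_surj by auto
    then show "a \<in> extension w ` E'" using extension_F F_sub_E' by (intro image_eqI[of _ _ b]) auto
  qed
  moreover have "subring (extension w ` E') R"
  proof -
    have "extension w \<in> ring_hom ?R' R"
      using extension_hom E'_sub by (auto simp: ring_hom_def Pi_def)
    then interpret t': ring_hom_ring ?R' R "extension w"
      by (intro ring_hom_ringI2[OF R'.ring_axioms ring_axioms])
    show ?thesis using t'.img_is_subring[OF R'.carrier_is_subring] by simp
  qed
  ultimately have "E' \<subseteq> extension w ` E'" using simple_extension_subring_incl by blast
  moreover have "extension w ` E' \<subseteq> E'" using t.hom_closed by auto
  ultimately show ?thesis using inj by (auto simp: bij_betw_def)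
qed

lemma extension_in_galois_group:
  assumes "K \<subseteq> F" "\<And>k. k \<in> K \<Longrightarrow> \<sigma> k = k"
  shows "extension w \<in> carrier (galois_group R K E')"
  using assms extension_hom extension_bij extension_F
  by (auto simp: galois_group_def Bij_def ring_iso_def) (simp add: extension_def)

end

end

section \<open>The fixed field and the finiteness of the Galois group\<close>

lemma galois_group_carrier_iff:
  "\<sigma> \<in> carrier (galois_group L K F) \<longleftrightarrow> \<sigma> \<in> extensional F \<and> bij_betw \<sigma> F F \<and>
     \<sigma> \<in> ring_hom (L \<lparr> carrier := F \<rparr>) (L \<lparr> carrier := F \<rparr>) \<and> (\<forall>k\<in>K. \<sigma> k = k)"
  by (auto simp: galois_group_def Bij_def ring_iso_def)

text \<open>The lifts of the identity of \<open>F\<close> come first. Writing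
  \<open>x = p(\<zeta>)\<close> with \<open>p\<close> of degree below that of \<open>m\<close>,
  invariance gives \<open>p(w) = x\<close> for every conjugate \<open>w\<close>; these are too many
  roots for \<open>p - x\<close> unless it is zero, so \<open>x\<close> lies in \<open>F\<close>.
  Each element of the Galois group of \<open>F\<close> over \<open>K\<close> then has a lift, so it
  fixes \<open>x\<close> as well.\<close>

lemma (in root_extension) fixed_by_galois_group_imp:
  assumes K: "K \<subseteq> F" and galois: "{x \<in> F. \<forall>\<sigma>\<in>carrier (galois_group R K F). \<sigma> x = x} = K"
    and x: "x \<in> E'" and fixed: "\<And>\<tau>. \<tau> \<in> carrier (galois_group R K E') \<Longrightarrow> \<tau> x = x"
  shows "x \<in> K"
proof -
  have xF: "x \<in> F"
  proof -
    interpret root_extension_aut R F e \<zeta> "\<lambda>x. x"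
      by unfold_locales (auto simp: ring_hom_def)
    have d: "degree m \<ge> 1" by (rule pirreducible_degree[OF F m_carrier m_irreducible])
    \<comment> \<open>A nonzero list is one longer than its degree, so the bound on the length says
      that the degree of a nonzero \<open>p\<close> is strictly below that of \<open>m\<close>; this
      strictness produces the contradiction.\<close>
    obtain p where p: "p \<in> carrier (F[X])" "length p \<le> degree m" "x = eval p \<zeta>"
      using x Span_exp_base[OF F \<zeta>_closed \<zeta>_algebraic] Span_eq_eval_img[OF F \<zeta>_closed] by blast
    have xc: "x \<in> carrier R" using x E'_sub by auto
    have sp: "set p \<subseteq> carrier R" using poly_set[OF p(1)] F_sub by auto
    define q where "q = poly_add p [\<ominus> x]"
    have q: "q \<in> carrier (poly_ring R)"
      unfolding q_def using sp xc poly_add_is_polynomial[OF carrier_is_subring, of p "[\<ominus> x]"]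
      by (simp flip: univ_poly_carrier)
    have "q = []"
    proof (rule ccontr)
      assume qn: "q \<noteq> []"
      have "conjugates \<subseteq> {y. is_root q y}"
      proof
        fix w assume w: "w \<in> conjugates"
        have "eval p w = x"
          using fixed[OF extension_in_galois_group[OF w K]] extension_eval[OF w p(1)] p(3) by simp
        then have "eval q w = \<zero>"
          unfolding q_def using sp xc w_closed[OF w] by (subst eval_poly_add) (auto simp: r_neg)
        then show "w \<in> {y. is_root q y}" using qn w_closed[OF w] by (simp add: is_root_def)
      qed
      then have "card conjugates \<le> degree q"
        using card_roots_le_degree[OF q] card_mono le_trans by blast
      moreover have "length q \<le> degree m"
        unfolding q_def using poly_add_length_le[of p "[\<ominus> x]"] p(2) d by simp
      moreover have "length q > 0" using qn by simp
      ultimately show False using card_conjugates by linarith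
    qed
    \<comment> \<open>Coefficients are compared instead of lists because
      \<open>[\<ominus> x]\<close> is not in normal form when \<open>x\<close> is zero.\<close>
    then have "coeff p 0 \<oplus> \<ominus> x = \<zero>"
      using fun_cong[OF poly_add_coeff[OF sp, of "[\<ominus> x]"], of 0] xc by (simp add: q_def)
    then have "coeff p 0 = x" using coeff_in_carrier[OF sp] xc
      by (metis minus_equality minus_minus a_inv_closed)
    then show ?thesis using coeff_in_subring[OF F_subring poly_set[OF p(1)], of 0] by simp
  qed
  have "\<sigma> x = x" if \<sigma>: "\<sigma> \<in> carrier (galois_group R K F)" for \<sigma>
  proof -
    interpret root_extension_aut R F e \<zeta> \<sigma>
      using \<sigma> by unfold_locales (auto simp: galois_group_carrier_iff bij_betw_def)
    have "card conjugates \<ge> 1"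
      using card_conjugates pirreducible_degree[OF F m_carrier m_irreducible] by linarith
    then obtain w where w: "w \<in> conjugates" by (metis card.empty all_not_in_conv not_one_le_zero)
    have "extension w \<in> carrier (galois_group R K E')"
      using extension_in_galois_group[OF w K] \<sigma> by (simp add: galois_group_carrier_iff)
    then have "extension w x = x" by (rule fixed)
    then show ?thesis by (simp only: extension_F[OF w xF])
  qed
  then show ?thesis using galois xF by blast
qed

lemma galois_group_mult_apply:
  assumes "\<sigma> \<in> carrier (galois_group L K F)" "\<tau> \<in> carrier (galois_group L K F)" "x \<in> F"
  shows "(\<sigma> \<otimes>\<^bsub>galois_group L K F\<^esub> \<tau>) x = \<sigma> (\<tau> x)"
  using assms by (simp add: galois_group_def BijGroup_def compose_eq)

lemma galois_group_one_apply: "x \<in> F \<Longrightarrow> \<one>\<^bsub>galois_group L K F\<^esub> x = x"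
  by (simp add: galois_group_def BijGroup_def)

text \<open>The condition \<open>K \<subseteq> F\<close> matters because the identity, inverses and
  products of \<open>BijGroup F\<close> are restricted to \<open>F\<close>: only there do they
  inherit the property of fixing \<open>K\<close>.\<close>

lemma (in ring) group_galois_group:
  assumes F: "subring F R" and K: "K \<subseteq> F"
  shows "group (galois_group R K F)"
proof -
  interpret B: group "BijGroup F" by (rule group_BijGroup)
  let ?R' = "R \<lparr> carrier := F \<rparr>"
  let ?H = "{\<sigma> \<in> Bij F. \<sigma> \<in> ring_iso ?R' ?R' \<and> (\<forall>k \<in> K. \<sigma> k = k)}"
  have "subgroup ?H (BijGroup F)"
  proof (rule B.subgroupI)
    show "?H \<subseteq> carrier (BijGroup F)" by (auto simp: BijGroup_def)
    have "(\<lambda>x\<in>F. x) \<in> ?H"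
      using id_Bij[of F] K subringE(3,6,7)[OF F]
      by (auto simp: ring_iso_def Bij_def intro!: ring_hom_memI)
    then show "?H \<noteq> {}" by blast
    fix \<sigma> assume \<sigma>: "\<sigma> \<in> ?H"
    then have b: "bij_betw \<sigma> F F" and hom: "\<sigma> \<in> ring_hom ?R' ?R'" by (auto simp: ring_iso_def)
    have "(\<lambda>x\<in>F. inv_into F \<sigma> x) \<in> ring_hom ?R' ?R'"
    proof (rule ring_hom_memI)
      have c: "inv_into F \<sigma> x \<in> F" if "x \<in> F" for x
        using b that by (metis bij_betw_imp_surj_on inv_into_into)
      show "(\<lambda>x\<in>F. inv_into F \<sigma> x) x \<in> carrier ?R'" if "x \<in> carrier ?R'" for x
        using c that by simp
      fix x y assume xy: "x \<in> carrier ?R'" "y \<in> carrier ?R'"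
      define x' y' where "x' = inv_into F \<sigma> x" and "y' = inv_into F \<sigma> y"
      have x': "x' \<in> F" "x = \<sigma> x'" "y' \<in> F" "y = \<sigma> y'"
        using c xy bij_betw_inv_into_right[OF b] by (auto simp: x'_def y'_def)
      have "inv_into F \<sigma> (\<sigma> (x' \<otimes> y')) = x' \<otimes> y'" "inv_into F \<sigma> (\<sigma> (x' \<oplus> y')) = x' \<oplus> y'"
        using x' subringE(6,7)[OF F] by (auto intro!: bij_betw_inv_into_left[OF b])
      then have "inv_into F \<sigma> (x \<otimes> y) = x' \<otimes> y'" "inv_into F \<sigma> (x \<oplus> y) = x' \<oplus> y'"
        using ring_hom_mult[OF hom, of x' y'] ring_hom_add[OF hom, of x' y'] x' by simp_all
      then show "(\<lambda>x\<in>F. inv_into F \<sigma> x) (x \<otimes>\<^bsub>?R'\<^esub> y) =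
          (\<lambda>x\<in>F. inv_into F \<sigma> x) x \<otimes>\<^bsub>?R'\<^esub> (\<lambda>x\<in>F. inv_into F \<sigma> x) y"
        "(\<lambda>x\<in>F. inv_into F \<sigma> x) (x \<oplus>\<^bsub>?R'\<^esub> y) =
          (\<lambda>x\<in>F. inv_into F \<sigma> x) x \<oplus>\<^bsub>?R'\<^esub> (\<lambda>x\<in>F. inv_into F \<sigma> x) y"
        using xy subringE(6,7)[OF F] by (simp_all add: x'_def y'_def)
    next
      show "(\<lambda>x\<in>F. inv_into F \<sigma> x) \<one>\<^bsub>?R'\<^esub> = \<one>\<^bsub>?R'\<^esub>"
        using bij_betw_inv_into_left[OF b, of \<one>] subringE(3)[OF F] ring_hom_one[OF hom] by simp
    qed
    moreover have "inv_into F \<sigma> k = k" if "k \<in> K" for k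
      using bij_betw_inv_into_left[OF b, of k] \<sigma> that K by auto
    ultimately show "inv\<^bsub>BijGroup F\<^esub> \<sigma> \<in> ?H"
      using \<sigma> restrict_inv_into_Bij[of \<sigma> F] K
      by (auto simp: inv_BijGroup ring_iso_def Bij_def)
    fix \<tau> assume \<tau>: "\<tau> \<in> ?H"
    have st: "compose F \<sigma> \<tau> \<in> Bij F" using \<sigma> \<tau> compose_Bij by auto
    moreover have "compose F \<sigma> \<tau> \<in> ring_hom ?R' ?R'"
    proof (rule ring_hom_memI)
      have \<tau>h: "\<tau> \<in> ring_hom ?R' ?R'" using \<tau> by (auto simp: ring_iso_def)
      have c: "\<tau> x \<in> F" "\<sigma> x \<in> F" if "x \<in> F" for x
        using ring_hom_closed[OF \<tau>h] ring_hom_closed[OF hom] that by auto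
      show "compose F \<sigma> \<tau> x \<in> carrier ?R'" if "x \<in> carrier ?R'" for x
        using that c by (simp add: compose_def)
      fix x y assume "x \<in> carrier ?R'" "y \<in> carrier ?R'"
      then show "compose F \<sigma> \<tau> (x \<otimes>\<^bsub>?R'\<^esub> y) = compose F \<sigma> \<tau> x \<otimes>\<^bsub>?R'\<^esub> compose F \<sigma> \<tau> y"
        "compose F \<sigma> \<tau> (x \<oplus>\<^bsub>?R'\<^esub> y) = compose F \<sigma> \<tau> x \<oplus>\<^bsub>?R'\<^esub> compose F \<sigma> \<tau> y"
        using c subringE(6,7)[OF F] ring_hom_mult[OF \<tau>h] ring_hom_mult[OF hom]
          ring_hom_add[OF \<tau>h] ring_hom_add[OF hom] by (simp_all add: compose_def)
    next
      show "compose F \<sigma> \<tau> \<one>\<^bsub>?R'\<^esub> = \<one>\<^bsub>?R'\<^esub>"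
        using \<tau> ring_hom_one[OF hom] ring_hom_one[of \<tau> ?R' ?R'] subringE(3)[OF F]
        by (simp add: compose_def ring_iso_def)
    qed
    ultimately show "\<sigma> \<otimes>\<^bsub>BijGroup F\<^esub> \<tau> \<in> ?H"
      using \<sigma> \<tau> K by (auto simp: BijGroup_def ring_iso_def Bij_def compose_def)
  qed
  then have "group (BijGroup F \<lparr> carrier := ?H \<rparr>)"
    by (rule subgroup.subgroup_is_group) (rule group_BijGroup)
  then show ?thesis by (simp add: galois_group_def)
qed

context root_extension
begin

text \<open>An automorphism is determined by its values on \<open>B\<close>, consisting of \<zeta>
  and a spanning list of \<open>F\<close> over \<open>K\<close>. Each element of \<open>B\<close> is
  a root of a nonzero polynomial over \<open>K\<close>, and automorphisms fixing \<open>K\<close>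
  can only send it to one of the finitely many roots of that polynomial.\<close>

lemma galois_group_finite:
  assumes K: "subfield K R" "K \<subseteq> F" and fin: "finite_dimension K F"
  shows "finite (carrier (galois_group R K E'))"
proof -
  let ?\<Gamma> = "carrier (galois_group R K E')"
  obtain n where "dimension n K F" using fin by (rule finite_dimensionE')
  then obtain Us where Us: "set Us \<subseteq> carrier R" "Span K Us = F"
    using exists_base[OF K(1)] by blast
  have UsF: "set Us \<subseteq> F" using Us Span_base_incl[OF K(1) Us(1)] by auto
  define B where "B = insert \<zeta> (set Us)"
  have BE: "B \<subseteq> E'" unfolding B_def using UsF F_sub_E' \<zeta>_in_E' by auto
  define V where "V b = (\<lambda>\<sigma>. \<sigma> b) ` ?\<Gamma>" for b
  have hom: "\<sigma> \<in> ring_hom (R \<lparr> carrier := E' \<rparr>) R" if "\<sigma> \<in> ?\<Gamma>" for \<sigma>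
    using that E'_sub by (auto simp: galois_group_carrier_iff ring_hom_def Pi_def)
  have finV: "finite (V b)" if b: "b \<in> B" for b
  proof -
    have bE: "b \<in> E'" "b \<in> carrier R" using b BE E'_sub by auto
    obtain p where p: "p \<in> carrier (K[X])" "p \<noteq> []" "eval p b = \<zero>"
    \<comment> \<open>Elements of \<open>F\<close> are algebraic by finite dimension. Outside
      \<open>F\<close> only \<zeta> remains, and \<open>X^e - 1\<close> has coefficients in
      \<open>K\<close> already.\<close>
    proof (cases "b \<in> F")
      case True
      then show ?thesis
        using algebraicE[OF subfieldE(1)[OF K(1)] bE(2) finite_dimension_imp_algebraic[OF K(1) F_subring fin True]]
          that by blast
    next
      case False
      then have "b = \<zeta>" using b UsF by (auto simp: B_def)
      then show ?thesis
        using that[OF unity_poly_carrier[OF subfieldE(1)[OF K(1)], of e]]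
          eval_unity_poly[OF e_pos \<zeta>_closed] \<zeta>_e by (simp add: unity_poly_def a_minus_def r_neg)
    qed
    have pR: "p \<in> carrier (poly_ring R)"
      using carrier_polynomial[OF subfieldE(1)[OF K(1)]] p(1) by (simp flip: univ_poly_carrier)
    have pK: "set p \<subseteq> K" using p(1) polynomial_incl[of K p] by (simp flip: univ_poly_carrier)
    have "V b \<subseteq> {x. is_root p x}"
    proof
      fix y assume "y \<in> V b"
      then obtain \<sigma> where \<sigma>: "\<sigma> \<in> ?\<Gamma>" "y = \<sigma> b" by (auto simp: V_def)
      interpret s: ring_hom_ring "R \<lparr> carrier := E' \<rparr>" R \<sigma>
        by (rule ring_hom_ringI2[OF subring_is_ring[OF E'_subring] ring_axioms hom[OF \<sigma>(1)]])
      have "map \<sigma> p = p" using pK \<sigma>(1) by (intro map_idI) (auto simp: galois_group_carrier_iff)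
      moreover have "\<sigma> (eval p b) = eval (map \<sigma> p) (\<sigma> b)"
        using s.eval_hom'[of b p] bE pK K(2) F_sub_E' by (auto simp: eval_consistent[OF E'_subring])
      moreover have "\<sigma> \<zero> = \<zero>" using s.hom_zero by simp
      ultimately have "eval p y = \<zero>" using p(3) \<sigma>(2) by simp
      then show "y \<in> {x. is_root p x}"
        using p(2) s.hom_closed[of b] bE \<sigma>(2) by (simp add: is_root_def)
    qed
    then show ?thesis using card_roots_le_degree(1)[OF pR] by (rule finite_subset)
  qed
  have "inj_on (\<lambda>\<sigma>. restrict \<sigma> B) ?\<Gamma>"
  proof (rule inj_onI)
    fix \<sigma> \<tau> assume \<sigma>: "\<sigma> \<in> ?\<Gamma>" and \<tau>: "\<tau> \<in> ?\<Gamma>" and eq: "restrict \<sigma> B = restrict \<tau> B"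
    interpret s: ring_hom_ring "R \<lparr> carrier := E' \<rparr>" R \<sigma>
      by (rule ring_hom_ringI2[OF subring_is_ring[OF E'_subring] ring_axioms hom[OF \<sigma>]])
    interpret t: ring_hom_ring "R \<lparr> carrier := E' \<rparr>" R \<tau>
      by (rule ring_hom_ringI2[OF subring_is_ring[OF E'_subring] ring_axioms hom[OF \<tau>]])
    \<comment> \<open>The set of agreement is closed under sums and products and contains
      \<open>K\<close> and \<open>B\<close>; hence it contains the span \<open>F\<close>, and then
      everything built from \<open>F\<close> and \<zeta>.\<close>
    define D where "D = {x \<in> E'. \<sigma> x = \<tau> x}"
    have BD: "B \<subseteq> D" using BE fun_cong[OF eq] unfolding D_def restrict_def by auto metis
    have KD: "K \<subseteq> D" using \<sigma> \<tau> K(2) F_sub_E' by (auto simp: D_def galois_group_carrier_iff)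
    have Dm: "x \<otimes> y \<in> D" and Da: "x \<oplus> y \<in> D" if "x \<in> D" "y \<in> D" for x y
      using that subringE(6,7)[OF E'_subring] s.hom_mult[of x y] t.hom_mult[of x y]
        s.hom_add[of x y] t.hom_add[of x y] by (auto simp: D_def)
    have D0: "\<zero> \<in> D" using s.hom_zero t.hom_zero subringE(2)[OF E'_subring] by (auto simp: D_def)
    have "Span K Vs \<subseteq> D" if "set Vs \<subseteq> D" for Vs
      using that
    proof (induction Vs)
      case Nil
      then show ?case using D0 by simp
    next
      case (Cons v Vs)
      have "k \<otimes> v \<oplus> u \<in> D" if "k \<in> K" "u \<in> Span K Vs" for k u
        using that Cons KD by (intro Da Dm) auto
      then show ?case by (auto simp: line_extension_mem_iff)
    qed
    then have FD: "F \<subseteq> D" using Us(2) BD by (auto simp: B_def)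
    have "x \<in> D" if "x \<in> E'" for x
      using that
    proof (induction rule: simple_extension.induct)
      case zero
      then show ?case by (rule D0)
    next
      case (lin k1 k2)
      then show ?case using Da Dm FD BD by (auto simp: B_def)
    qed
    then have "\<sigma> x = \<tau> x" if "x \<in> E'" for x using that by (auto simp: D_def)
    then show "\<sigma> = \<tau>" using \<sigma> \<tau> by (intro extensionalityI[of _ E']) (auto simp: galois_group_carrier_iff)
  qed
  moreover have "(\<lambda>\<sigma>. restrict \<sigma> B) ` ?\<Gamma> \<subseteq> Pi\<^sub>E B V"
    by (auto simp: V_def)
  moreover have "finite (Pi\<^sub>E B V)" using finV by (intro finite_PiE) (auto simp: B_def)
  ultimately show ?thesis using inj_on_finite by blast
qed

lemma galois_action_simple_extension:
  assumes K: "subfield K R" "K \<subseteq> F" and fin: "finite_dimension K F"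
    and galois: "{x \<in> F. \<forall>\<sigma>\<in>carrier (galois_group R K F). \<sigma> x = x} = K"
  shows "galois_action (R \<lparr> carrier := E' \<rparr>) (galois_group R K E') K"
proof -
  let ?\<Gamma> = "galois_group R K E'"
  have KE: "K \<subseteq> E'" using K(2) F_sub_E' by auto
  interpret E': field "R \<lparr> carrier := E' \<rparr>" by (rule subfield_iff(2)[OF E'_subfield])
  interpret \<Gamma>: group ?\<Gamma> by (rule group_galois_group[OF E'_subring KE])
  show ?thesis
  proof
    show "finite (carrier ?\<Gamma>)" by (rule galois_group_finite[OF K fin])
    show "\<gamma> \<in> ring_hom (R \<lparr> carrier := E' \<rparr>) (R \<lparr> carrier := E' \<rparr>)" if "\<gamma> \<in> carrier ?\<Gamma>" for \<gamma>
      using that by (simp add: galois_group_carrier_iff)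
    show "\<exists>x\<in>carrier (R \<lparr> carrier := E' \<rparr>). \<gamma> x \<noteq> \<delta> x"
      if "\<gamma> \<in> carrier ?\<Gamma>" "\<delta> \<in> carrier ?\<Gamma>" "\<gamma> \<noteq> \<delta>" for \<gamma> \<delta>
      using that extensionalityI[of \<gamma> E' \<delta>] by (auto simp: galois_group_carrier_iff)
    show "K = {x \<in> carrier (R \<lparr> carrier := E' \<rparr>). \<forall>\<gamma>\<in>carrier ?\<Gamma>. \<gamma> x = x}"
      using fixed_by_galois_group_imp[OF K(2) galois] KE by (auto simp: galois_group_carrier_iff)
  qed (simp_all add: galois_group_mult_apply galois_group_one_apply)
qed

text \<open>The simple extension is by construction only the ring generated by \<open>F\<close> and
  \<zeta>. It is a field because \<zeta> is algebraic over \<open>F\<close>, so it also contains the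
  generated field.\<close>

lemma generate_field_eq: "generate_field R (insert \<zeta> F) = E'"
proof
  show "generate_field R (insert \<zeta> F) \<subseteq> E'"
    using generate_field_min_subfield1[OF _ E'_subfield] F_sub \<zeta>_closed F_sub_E' \<zeta>_in_E' by auto
  show "E' \<subseteq> generate_field R (insert \<zeta> F)"
    using F_sub \<zeta>_closed
    by (intro simple_extension_subring_incl subfieldE(1) generate_field_is_subfield)
       (auto intro: generate_field.incl)
qed

end

text \<open>The \<open>LEAST\<close> in \<open>group_exponent\<close> is attained, because the order
  of the group is a positive exponent by Lagrange.\<close>

lemma finite_comm_group_pow_exponent_multiple:
  assumes "comm_group N" "finite (carrier N)" "group_exponent N dvd e" "x \<in> carrier N"
  shows "x [^]\<^bsub>N\<^esub> e = \<one>\<^bsub>N\<^esub>"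
proof -
  interpret comm_group N by fact
  have "card (carrier N) > 0" using assms(2) one_closed card_gt_0_iff by blast
  then have "\<exists>n::nat. 0 < n \<and> (\<forall>x\<in>carrier N. x [^]\<^bsub>N\<^esub> n = \<one>\<^bsub>N\<^esub>)"
    by (intro exI[of _ "card (carrier N)"]) (simp add: power_order_eq_one[OF assms(2)])
  from LeastI_ex[OF this] have "x [^]\<^bsub>N\<^esub> group_exponent N = \<one>\<^bsub>N\<^esub>"
    unfolding group_exponent_def using assms(4) by blast
  moreover obtain k where "e = group_exponent N * k" using assms(3) by (rule dvdE)
  ultimately show ?thesis using assms(4) by (simp flip: nat_pow_pow)
qed

theorem theorem3p1:
  fixes L :: "('a, 'b) ring_scheme"
    and K E E' :: "'a set"
    and \<zeta> :: 'a
    and e :: nat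
    and \<Gamma> :: "('a \<Rightarrow> 'a) monoid"
    and N\<^sub>1 :: "('m, 'c) monoid_scheme"
    and N\<^sub>2 :: "('n, 'd) monoid_scheme"
    and \<phi>\<^sub>1 :: "('a \<Rightarrow> 'a) \<Rightarrow> 'm \<Rightarrow> 'm"
    and \<phi>\<^sub>2 :: "('a \<Rightarrow> 'a) \<Rightarrow> 'n \<Rightarrow> 'n"
  assumes "algebraic_closure L E"
    and "char_zero (L \<lparr> carrier := K \<rparr>)"
    and "finite_galois_extension L K E"
    and "comm_group N\<^sub>1" and "finite (carrier N\<^sub>1)"
    and "comm_group N\<^sub>2" and "finite (carrier N\<^sub>2)"
    and "e = lcm (group_exponent N\<^sub>1) (group_exponent N\<^sub>2)"
    and "primitive_root_of_unity L e \<zeta>"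
    and "E' = generate_field L (insert \<zeta> E)"
    and "\<Gamma> = galois_group L K E'"
    and "acts_by_automorphisms \<Gamma> N\<^sub>1 \<phi>\<^sub>1"
    and "acts_by_automorphisms \<Gamma> N\<^sub>2 \<phi>\<^sub>2"
  shows "isomorphic_algebras K
           (fixed_group_algebra (L \<lparr> carrier := E' \<rparr>) \<Gamma> N\<^sub>1 \<phi>\<^sub>1)
           (fixed_group_algebra (L \<lparr> carrier := E' \<rparr>) \<Gamma> N\<^sub>2 \<phi>\<^sub>2)
     \<longleftrightarrow>
         isomorphic_gsets \<Gamma>
           (characters N\<^sub>1 (L \<lparr> carrier := E' \<rparr>)) (twisted_action \<Gamma> N\<^sub>1 \<phi>\<^sub>1)
           (characters N\<^sub>2 (L \<lparr> carrier := E' \<rparr>)) (twisted_action \<Gamma> N\<^sub>2 \<phi>\<^sub>2)"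
proof -
  interpret L: field L by (rule algebraic_closure.axioms(1)[OF assms(1)])
  have K: "subfield K L" "K \<subseteq> E" and E: "subfield E L" and dim: "L.finite_dimension K E"
    and fixed: "{x \<in> E. \<forall>\<sigma>\<in>carrier (galois_group L K E). \<sigma> x = x} = K"
    using assms(3) unfolding finite_galois_extension_def by blast+
  interpret ext: root_extension L E e \<zeta>
    by (intro root_extension.intro root_extension_axioms.intro L.field_axioms E assms(9))
  have E': "E' = L.simple_extension E \<zeta>" using assms(10) ext.generate_field_eq by simp
  let ?R = "L \<lparr> carrier := E' \<rparr>"
  have act: "galois_action ?R \<Gamma> K"
    unfolding E' assms(11) by (rule ext.galois_action_simple_extension[OF K dim fixed])
  \<comment> \<open>Multiples of the unit are computed by the operations of \<open>L\<close>
    whatever the carrier, so they are nonzero in \<open>E'\<close> exactly as in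
    \<open>K\<close>.\<close>
  have char0: "char_zero ?R"
    using assms(2) by (simp add: char_zero_def add_pow_def nat_pow_def)
  have prim: "primitive_root_of_unity ?R e \<zeta>"
    using assms(9) ext.\<zeta>_in_E' by (simp add: primitive_root_of_unity_def nat_pow_def E')
  have dvd: "group_exponent N\<^sub>1 dvd e" "group_exponent N\<^sub>2 dvd e" by (simp_all add: assms(8))
  have "character_setting ?R N\<^sub>1 e \<zeta>" "character_setting ?R N\<^sub>2 e \<zeta>"
    using galois_action.axioms(1)[OF act] assms(4-7) prim char0
      finite_comm_group_pow_exponent_multiple[OF assms(4,5) dvd(1)]
      finite_comm_group_pow_exponent_multiple[OF assms(6,7) dvd(2)]
    by (simp_all add: character_setting_def character_setting_axioms_def)
  then have "galois_module ?R \<Gamma> K N\<^sub>1 e \<zeta> \<phi>\<^sub>1" "galois_module ?R \<Gamma> K N\<^sub>2 e \<zeta> \<phi>\<^sub>2"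
    using act assms(12,13) by (simp_all add: galois_module_def galois_module_axioms_def)
  then show ?thesis by (rule isomorphic_fixed_algebras_iff_isomorphic_characters)
qed

end
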